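(* Let $J$ be a semi-infinite Jacobi matrix with coefficients $a_n>0$, $b_n\in\mathbb{R}$ ($n\ge 1$) satisfying $\sup_n a_n^{-1}+\sup_n a_n+\sup_n|b_n|<\infty$, and suppose that for some $q\in\mathbb{N}$, $$\sum_{n=1}^\infty |a_{n+q}-a_n|^2+\sum_{n=1}^\infty|b_{n+q}-b_n|^2<\infty .$$ Let $\mathcal{R}$ be the set of right limits of $J$ (all of which are $q$-periodic). Then, modulo sets of Lebesgue measure zero, $$\bigcap_{J^{(r)}\in\mathcal{R}} q\text{-int}(\sigma(J^{(r)}))\;\subset\;\Sigma_{\mathrm{ac}}(J)\;\subset\;\bigcap_{J^{(r)}\in\mathcal{R}}\sigma(J^{(r)}).$$ Moreover, for any closed interval $I\subset\bigcap_{J^{(r)}\in\mathcal{R}} q\text{-int}(\sigma(J^{(r)}))$, $$\int_I\log f(x)\,dx>-\infty,$$ where $f$ is the density of the absolutely continuous part of the canonical spectral measure of $J$.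
   Context: The semi-infinite Jacobi matrix $J$ with coefficients $\{a_n,b_n\}_{n\ge1}$ is the tridiagonal matrix with diagonal entries $b_1,b_2,\dots$ and off-diagonal entries $a_1,a_2,\dots$, a bounded self-adjoint operator on $\ell^2(\mathbb{N})$, $\mathbb{N}=\{1,2,\dots\}$. Its canonical spectral measure $\mu$ is the spectral measure of $\delta_1$: $\int x^n\,d\mu(x)=\langle\delta_1,J^n\delta_1\rangle$, $n\ge0$. Write the Lebesgue decomposition $d\mu=f(x)\,dx+d\mu_{\mathrm{s}}$; the essential support of the a.c. spectrum is $\Sigma_{\mathrm{ac}}(J)=\{x\in\mathbb{R}\mid f(x)>0\}$, viewed as an equivalence class modulo sets of Lebesgue measure zero (so inclusions involving it are modulo null sets). A two-sided Jacobi matrix $J^{(r)}$ on $\ell^2(\mathbb{Z})$ with coefficients $a^{(r)}_n>0$, $b^{(r)}_n\in\mathbb{R}$, $n\in\mathbb{Z}$, is a right limit of $J$ if there is a sequence of integers $n_j\to+\infty$ with $\lim_j a_{n+n_j}=a_n^{(r)}$ and $\lim_j b_{n+n_j}=b_n^{(r)}$ for all $n\in\mathbb{Z}$. $\mathcal{R}$ denotes the set of all right limits of $J$. For a two-sided $q$-periodic Jacobi matrix $J^{(r)}$, its discriminant is $\Delta^{(r)}(z)=\operatorname{tr}\big(A(a_q^{(r)},b_q^{(r)};z)\cdots A(a_1^{(r)},b_1^{(r)};z)\big)$ where $A(a,b;z)=\begin{pmatrix}\frac{z-b}{a}&-\frac1a\\ a&0\end{pmatrix}$. One has $\sigma(J^{(r)})=\{x\in\mathbb{R}\mid\Delta^{(r)}(x)\in[-2,2]\}$,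 and one defines $q\text{-int}(\sigma(J^{(r)}))=\{x\in\mathbb{R}\mid\Delta^{(r)}(x)\in(-2,2)\}$. *)

theory Defs
  imports "HOL-Analysis.Analysis"
begin

section \<open>Square-summable sequences and spectra\<close>

definition ell2 :: "('i \<Rightarrow> complex) set" where
  "ell2 = {u. (\<lambda>n. (cmod (u n))\<^sup>2) summable_on UNIV}"

definition ell2_norm :: "('i \<Rightarrow> complex) \<Rightarrow> real" where
  "ell2_norm u = sqrt (\<Sum>\<^sub>\<infinity>n. (cmod (u n))\<^sup>2)"

definition ell2_inner :: "'i set \<Rightarrow> ('i \<Rightarrow> complex) \<Rightarrow> ('i \<Rightarrow> complex) \<Rightarrow> complex" where
  "ell2_inner S u v = (\<Sum>\<^sub>\<infinity>n\<in>S. cnj (u n) * v n)"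

text \<open>The complement of the resolvent set: \<open>z\<close> is in the resolvent set iff \<open>T - z\<close> maps
  \<^const>\<open>ell2\<close> bijectively onto itself with bounded inverse.\<close>

definition ell2_spectrum :: "(('i \<Rightarrow> complex) \<Rightarrow> ('i \<Rightarrow> complex)) \<Rightarrow> complex set" where
  "ell2_spectrum T = {z. \<not> (bij_betw (\<lambda>u n. T u n - z * u n) ell2 ell2 \<and>
      (\<exists>C. \<forall>u\<in>ell2. ell2_norm u \<le> C * ell2_norm (\<lambda>n. T u n - z * u n)))}"


section \<open>Semi-infinite Jacobi matrices\<close>

text \<open>Coefficients are indexed from 1 and the values \<open>a 0\<close>, \<open>b 0\<close> are never used. Sequences on
  \<open>{1, 2, ...}\<close> are functions on \<^typ>\<open>nat\<close> whose value at 0 is irrelevant.\<close>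

definition jacobi :: "(nat \<Rightarrow> real) \<Rightarrow> (nat \<Rightarrow> real) \<Rightarrow> (nat \<Rightarrow> complex) \<Rightarrow> (nat \<Rightarrow> complex)" where
  "jacobi a b u n =
     (if n = 0 then 0
      else (if n = 1 then 0 else of_real (a (n - 1)) * u (n - 1))
           + of_real (b n) * u n + of_real (a n) * u (n + 1))"

definition delta1 :: "nat \<Rightarrow> complex" where
  "delta1 n = (if n = 1 then 1 else 0)"

text \<open>For bounded coefficients the moments grow at most geometrically, so that they determine
  the Borel measure uniquely.\<close>

definition canonical_spectral_measure ::
    "(nat \<Rightarrow> real) \<Rightarrow> (nat \<Rightarrow> real) \<Rightarrow> real measure \<Rightarrow> bool" where
  "canonical_spectral_measure a b \<mu> \<longleftrightarrow>
     sets \<mu> = sets borel \<and>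
     (\<forall>n::nat. integrable \<mu> (\<lambda>x. x ^ n) \<and>
        complex_of_real (\<integral>x. x ^ n \<partial>\<mu>) = ell2_inner {1..} delta1 ((jacobi a b ^^ n) delta1))"

text \<open>\<open>d\<mu> = f dx + d\<mu>s\<close> with \<open>\<mu>s\<close> singular to Lebesgue measure; \<open>f\<close> is any everywhere
  finite, nonnegative version of the density.\<close>

definition lebesgue_decomposition ::
    "real measure \<Rightarrow> (real \<Rightarrow> real) \<Rightarrow> real measure \<Rightarrow> bool" where
  "lebesgue_decomposition \<mu> f \<mu>s \<longleftrightarrow>
     f \<in> borel_measurable borel \<and> (\<forall>x. 0 \<le> f x) \<and> sets \<mu>s = sets borel \<and>
     (\<exists>N\<in>sets borel. emeasure lborel N = 0 \<and> emeasure \<mu>s (UNIV - N) = 0) \<and>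
     (\<forall>A\<in>sets borel. emeasure \<mu> A = (\<integral>\<^sup>+x\<in>A. ennreal (f x) \<partial>lborel) + emeasure \<mu>s A)"

definition Sigma_ac :: "(real \<Rightarrow> real) \<Rightarrow> real set" where
  "Sigma_ac f = {x. 0 < f x}"


section \<open>Two-sided Jacobi matrices and right limits\<close>

definition jacobi2 :: "(int \<Rightarrow> real) \<Rightarrow> (int \<Rightarrow> real) \<Rightarrow> (int \<Rightarrow> complex) \<Rightarrow> (int \<Rightarrow> complex)" where
  "jacobi2 a b u n =
     of_real (a (n - 1)) * u (n - 1) + of_real (b n) * u n + of_real (a n) * u (n + 1)"

text \<open>For bounded coefficients \<^term>\<open>jacobi2 a b\<close> is self-adjoint, so that no part of the spectrum
  is lost by restricting it to the real line.\<close>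

definition jacobi2_spectrum :: "(int \<Rightarrow> real) \<Rightarrow> (int \<Rightarrow> real) \<Rightarrow> real set" where
  "jacobi2_spectrum a b = {x. complex_of_real x \<in> ell2_spectrum (jacobi2 a b)}"

text \<open>Truncation by \<^const>\<open>nat\<close> affects, for each \<open>n\<close>, only finitely many \<open>j\<close>.\<close>

definition right_limits ::
    "(nat \<Rightarrow> real) \<Rightarrow> (nat \<Rightarrow> real) \<Rightarrow> ((int \<Rightarrow> real) \<times> (int \<Rightarrow> real)) set" where
  "right_limits a b = {(a', b'). (\<forall>n. 0 < a' n) \<and>
     (\<exists>k :: nat \<Rightarrow> int. filterlim k at_top sequentially \<and>
        (\<forall>n. (\<lambda>j. a (nat (n + k j))) \<longlonglongrightarrow> a' n) \<and>
        (\<forall>n. (\<lambda>j. b (nat (n + k j))) \<longlonglongrightarrow> b' n))}"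

definition periodic_coeffs :: "nat \<Rightarrow> (int \<Rightarrow> real) \<Rightarrow> (int \<Rightarrow> real) \<Rightarrow> bool" where
  "periodic_coeffs q a b \<longleftrightarrow> (\<forall>n. a (n + int q) = a n \<and> b (n + int q) = b n)"

definition transfer_matrix :: "real \<Rightarrow> real \<Rightarrow> 'k::real_normed_field \<Rightarrow> 'k ^ 2 ^ 2" where
  "transfer_matrix a b z =
     vector [vector [(z - of_real b) / of_real a, - (1 / of_real a)],
             vector [of_real a, 0]]"

primrec transfer_product ::
    "nat \<Rightarrow> (int \<Rightarrow> real) \<Rightarrow> (int \<Rightarrow> real) \<Rightarrow> 'k::real_normed_field \<Rightarrow> 'k ^ 2 ^ 2" where
  "transfer_product 0 a b z = mat 1"
| "transfer_product (Suc n) a b z =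
     transfer_matrix (a (int (Suc n))) (b (int (Suc n))) z ** transfer_product n a b z"

definition discriminant ::
    "nat \<Rightarrow> (int \<Rightarrow> real) \<Rightarrow> (int \<Rightarrow> real) \<Rightarrow> 'k::real_normed_field \<Rightarrow> 'k" where
  "discriminant q a b z = trace (transfer_product q a b z)"

definition q_int :: "nat \<Rightarrow> (int \<Rightarrow> real) \<Rightarrow> (int \<Rightarrow> real) \<Rightarrow> real set" where
  "q_int q a b = {x. discriminant q a b x \<in> {-2<..<2}}"


section \<open>Integrals with values in the extended reals\<close>

text \<open>The library has \<open>ln 0 = 0\<close> on the reals.\<close>

definition ext_log :: "real \<Rightarrow> ereal" where
  "ext_log y = (if 0 < y then ereal (ln y) else -\<infinity>)"

text \<open>Positive part minus negative part. As \<open>\<infinity> - \<infinity> = \<infinity>\<close> on \<^typ>\<open>ereal\<close>, the difference is written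
  with the signs reversed: the undefined case yields \<open>-\<infinity>\<close>, and a value above \<open>-\<infinity>\<close> does say that
  the negative part has finite integral.\<close>

definition ext_integral :: "real set \<Rightarrow> (real \<Rightarrow> ereal) \<Rightarrow> ereal" where
  "ext_integral I g =
     - (enn2ereal (\<integral>\<^sup>+x\<in>I. e2ennreal (- g x) \<partial>lborel) - enn2ereal (\<integral>\<^sup>+x\<in>I. e2ennreal (g x) \<partial>lborel))"

end

theory Submission
  imports Defs "HOL-Complex_Analysis.Complex_Analysis"
begin

text \<open>
  Let \<open>p\<^sub>n\<close> be the orthonormal polynomials, \<open>v\<^sub>n = (p\<^sub>n, a\<^sub>n p\<^sub>n\<^sub>-\<^sub>1)\<close> and \<open>T\<^sub>n\<close> the transfer matrix over the
  period that follows \<open>n\<close>. The measures \<open>dx / (\<pi> |v\<^sub>n|\<^sup>2)\<close> have the moments of \<open>\<mu>\<close> up to order \<open>n - 1\<close>, so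
  everything follows from real-variable bounds on \<open>|v\<^sub>n|\<close>.

  If \<open>|tr T\<^sub>n| \<ge> 2 + \<eta>\<close> on an interval for infinitely many \<open>n\<close>, then the norms \<open>|v\<^sub>m|\<close>, taken once per period,
  are convex on long stretches around these \<open>n\<close>. Hence \<open>|v\<^sub>n|\<close> is small where \<open>f\<close> is bounded below,
  and this contradicts \<open>\<integral> dx / |v\<^sub>n|\<^sup>2 = \<pi>\<close> unless \<open>f = 0\<close> almost everywhere on the interval.

  If \<open>|tr T\<^sub>n| \<le> 2 - \<eta>\<close> on an interval for all large \<open>n\<close>, let \<open>m\<^sub>\<plusminus>\<close> be the fixed points of the Moebius map of
  \<open>T\<^sub>n\<close> in the upper and lower half-plane. In the coordinates \<open>X = p\<^sub>n - m\<^sub>- a\<^sub>n p\<^sub>n\<^sub>-\<^sub>1\<close>, \<open>Y = p\<^sub>n - m\<^sub>+ a\<^sub>n p\<^sub>n\<^sub>-\<^sub>1\<close> the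
  ratio \<open>Y / X\<close> contracts for \<open>Im z > 0\<close> at a rate proportional to \<open>Im z\<close>, up to a square summable error. Therefore
  \<open>X\<close> is an explicit product, of bounded modulus on the real line, times \<open>exp \<Phi>\<^sub>n\<close> with \<open>\<Phi>\<^sub>n\<close> analytic and
  \<open>|\<Phi>\<^sub>n(z)| \<le> C / Im z\<close> uniformly in \<open>n\<close>. Cauchy's theorem with the weight \<open>(z - c)(d - z)\<close> bounds the weighted integral of
  \<open>ln |v\<^sub>n|\<close> from above, and semicontinuity of the entropy passes this bound on to \<open>f\<close>.
\<close>

text \<open>The obstacle is that the variation is square summable but need not be summable. On the
  real line the eigenvalues of \<open>T\<^sub>n\<close> inside a band have modulus one,
  \<open>Y / X\<close> does not contract, and errors of first order in the variation cannot be
  summed in absolute value. Two devices replace such a sum. The first-order error without the factor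
  \<open>Y / X\<close> is kept as an explicit product: on the real line the two fixed points are
  conjugate, and the squared modulus of each factor is a ratio of imaginary parts, which telescopes,
  up to a second-order error. The other errors are products of the variation with
  \<open>Y / X\<close>; at height y the contraction rate is proportional to y, and Young's
  inequality sums them to O(1 / y). Such a bound says nothing about single real points, but it
  controls integrals against a weight with simple zeros at the endpoints. Hence the conclusion is an
  integral bound on a logarithm, on an interval slightly smaller than the one where the traces are
  controlled. The link to right limits is compactness of the set of translates, which turns
  conditions on each right limit into bounds on \<open>tr T\<^sub>n\<close> for all large n.\<close>

section \<open>Solutions of the three-term recurrence\<close>

text \<open>The pair at \<open>n\<close> is \<open>(p\<^sub>n, a\<^sub>n p\<^sub>n\<^sub>-\<^sub>1)\<close>. Scaling the second entry by \<open>a\<^sub>n\<close> makes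
  every transfer matrix unimodular, and \<open>a 0\<close>, \<open>b 0\<close> do not enter.\<close>

primrec sol :: "(nat \<Rightarrow> real) \<Rightarrow> (nat \<Rightarrow> real) \<Rightarrow> 'k::real_normed_field \<Rightarrow> 'k \<times> 'k \<Rightarrow> nat \<Rightarrow> 'k \<times> 'k" where
  "sol a b z u 0 = u"
| "sol a b z u (Suc n) =
    (((z - of_real (b (Suc n))) * fst (sol a b z u n) - snd (sol a b z u n)) / of_real (a (Suc n)),
     of_real (a (Suc n)) * fst (sol a b z u n))"

definition shift :: "nat \<Rightarrow> (nat \<Rightarrow> real) \<Rightarrow> nat \<Rightarrow> real" where
  "shift n a i = a (n + i)"

lemma sol_add: "sol a b z u (n + k) = sol (shift n a) (shift n b) z (sol a b z u n) k"
  by (induction k) (auto simp: shift_def)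

lemma sol_linear:
  "fst (sol a b z u n) = fst u * fst (sol a b z (1, 0) n) + snd u * fst (sol a b z (0, 1) n) \<and>
   snd (sol a b z u n) = fst u * snd (sol a b z (1, 0) n) + snd u * snd (sol a b z (0, 1) n)"
  by (induction n) (auto simp: algebra_simps add_divide_distrib diff_divide_distrib)

lemma sol_wronskian:
  assumes "\<And>i. 1 \<le> i \<Longrightarrow> i \<le> n \<Longrightarrow> a i \<noteq> 0"
  shows "fst (sol a b z u n) * snd (sol a b z w n) - snd (sol a b z u n) * fst (sol a b z w n)
    = fst u * snd w - snd u * fst w"
  using assms
proof (induction n)
  case (Suc n)
  have "a (Suc n) \<noteq> 0" using Suc.prems by auto
  hence "fst (sol a b z u (Suc n)) * snd (sol a b z w (Suc n)) - snd (sol a b z u (Suc n)) * fst (sol a b z w (Suc n))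
     = fst (sol a b z u n) * snd (sol a b z w n) - snd (sol a b z u n) * fst (sol a b z w n)"
    by (simp add: field_simps)
  with Suc show ?case by auto
qed auto

lemma sol_of_real:
  "sol a b (of_real x :: 'k::real_normed_field) (of_real u1, of_real u2) n =
    (of_real (fst (sol a b x (u1, u2) n)), of_real (snd (sol a b x (u1, u2) n)))"
  by (induction n) auto

lemma sol_of_real_10:
  "sol a b (of_real x :: 'k::real_normed_field) (1, 0) n =
    (of_real (fst (sol a b x (1, 0) n)), of_real (snd (sol a b x (1, 0) n)))"
  using sol_of_real[of a b x 1 0 n] by simp

lemma sol_of_real_01:
  "sol a b (of_real x :: 'k::real_normed_field) (0, 1) n =
    (of_real (fst (sol a b x (0, 1) n)), of_real (snd (sol a b x (0, 1) n)))"
  using sol_of_real[of a b x 0 1 n] by simp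

text \<open>Green's identity: the coefficients are real, so a step changes this imaginary part only
  through \<open>Im z\<close>. It is the source of positivity below: Jost functions do not vanish,
  period maps contract in the upper half-plane, and \<open>X\<close> controls the solution.\<close>

lemma sol_Im:
  fixes z :: complex
  assumes "\<And>i. 1 \<le> i \<Longrightarrow> i \<le> n \<Longrightarrow> a i \<noteq> 0"
  shows "Im (fst (sol a b z u n) * cnj (snd (sol a b z u n))) =
    Im (fst u * cnj (snd u)) + Im z * (\<Sum>k<n. (cmod (fst (sol a b z u k)))\<^sup>2)"
  using assms
proof (induction n)
  case (Suc n)
  let ?P = "fst (sol a b z u n)" and ?Q = "snd (sol a b z u n)"
  have "a (Suc n) \<noteq> 0" using Suc.prems by auto
  hence "fst (sol a b z u (Suc n)) * cnj (snd (sol a b z u (Suc n))) = (z - of_real (b (Suc n))) * (?P * cnj ?P) - ?Q * cnj ?P"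
    by (simp add: field_simps)
  also have "Im \<dots> = Im z * (cmod ?P)\<^sup>2 + Im (?P * cnj ?Q)"
    unfolding complex_norm_square[symmetric] by simp
  finally show ?case using Suc by (simp add: algebra_simps)
qed auto

lemma continuous_on_sol [continuous_intros]:
  fixes g :: "'c::topological_space \<Rightarrow> 'k::real_normed_field"
  assumes "continuous_on A g" "\<And>i. 1 \<le> i \<Longrightarrow> i \<le> n \<Longrightarrow> a i \<noteq> 0"
  shows "continuous_on A (\<lambda>x. fst (sol a b (g x) u n))" "continuous_on A (\<lambda>x. snd (sol a b (g x) u n))"
proof -
  have "continuous_on A (\<lambda>x. fst (sol a b (g x) u n)) \<and> continuous_on A (\<lambda>x. snd (sol a b (g x) u n))"
    using assms(2) by (induction n) (auto intro!: continuous_intros assms(1))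
  thus "continuous_on A (\<lambda>x. fst (sol a b (g x) u n))" "continuous_on A (\<lambda>x. snd (sol a b (g x) u n))" by auto
qed

lemma holomorphic_on_sol [holomorphic_intros]:
  assumes "\<And>i. 1 \<le> i \<Longrightarrow> i \<le> n \<Longrightarrow> a i \<noteq> 0"
  shows "(\<lambda>z. fst (sol a b z u n)) holomorphic_on A" "(\<lambda>z. snd (sol a b z u n)) holomorphic_on A"
proof -
  have "(\<lambda>z. fst (sol a b z u n)) holomorphic_on A \<and> (\<lambda>z. snd (sol a b z u n)) holomorphic_on A"
    using assms by (induction n) (auto intro!: holomorphic_intros)
  thus "(\<lambda>z. fst (sol a b z u n)) holomorphic_on A" "(\<lambda>z. snd (sol a b z u n)) holomorphic_on A" by auto
qed

section \<open>Bounds that are uniform over a box of coefficients\<close>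

definition coeff_box :: "real \<Rightarrow> real \<Rightarrow> (nat \<Rightarrow> real) \<Rightarrow> (nat \<Rightarrow> real) \<Rightarrow> bool" where
  "coeff_box l M a b \<longleftrightarrow> (\<forall>i\<ge>1. l \<le> a i \<and> a i \<le> M \<and> \<bar>b i\<bar> \<le> M)"

lemma coeff_box_shift: "coeff_box l M a b \<Longrightarrow> coeff_box l M (shift n a) (shift n b)"
  by (auto simp: coeff_box_def shift_def)

text \<open>The constant is chosen before the coefficients and \<open>z\<close>. As the box is
  invariant under shifts, the bound holds for all \<open>shift n a\<close> at once, hence uniformly
  in the position of a period.\<close>

lemma sol_bound:
  assumes "0 < l"
  shows "\<exists>C\<ge>0. \<forall>a b (z::'k::real_normed_field). coeff_box l M a b \<longrightarrow> norm z \<le> R \<longrightarrow>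
    norm (fst (sol a b z u n)) \<le> C \<and> norm (snd (sol a b z u n)) \<le> C"
proof (induction n)
  case 0
  show ?case by (rule exI[of _ "max (norm (fst u)) (norm (snd u))"]) (auto simp: le_max_iff_disj)
next
  case (Suc n)
  then obtain C where C: "C \<ge> 0" "\<And>a b z::'k. coeff_box l M a b \<Longrightarrow> norm z \<le> R \<Longrightarrow>
    norm (fst (sol a b z u n)) \<le> C \<and> norm (snd (sol a b z u n)) \<le> C" by blast
  define D where "D = max 0 (max (((R + M) * C + C) / l) (M * C))"
  have "norm (fst (sol a b z u (Suc n))) \<le> D \<and> norm (snd (sol a b z u (Suc n))) \<le> D"
    if bx: "coeff_box l M a b" and z: "norm z \<le> R" for a b and z :: 'k
  proof -
    have ab: "l \<le> a (Suc n)" "a (Suc n) \<le> M" "\<bar>b (Suc n)\<bar> \<le> M" using bx by (auto simp: coeff_box_def)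
    note CC = C(2)[OF bx z]
    have RM: "0 \<le> R" "0 \<le> M" using order_trans[OF norm_ge_zero z] ab by linarith+
    have "norm ((z - of_real (b (Suc n))) * fst (sol a b z u n) - snd (sol a b z u n))
        \<le> norm (z - of_real (b (Suc n))) * norm (fst (sol a b z u n)) + norm (snd (sol a b z u n))"
      by (metis norm_mult norm_triangle_ineq4)
    also have "\<dots> \<le> (R + M) * C + C"
      using CC ab z C(1) norm_triangle_ineq4[of z "of_real (b (Suc n))"] RM
      by (intro add_mono mult_mono) auto
    finally have "norm (fst (sol a b z u (Suc n))) \<le> ((R + M) * C + C) / l"
      using ab assms by (auto simp: norm_divide intro!: frac_le intro: order_trans[OF norm_ge_zero])
    moreover have "norm (snd (sol a b z u (Suc n))) \<le> M * C"
      using ab assms CC by (auto simp: norm_mult intro!: mult_mono)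
    ultimately show ?thesis by (auto simp: D_def)
  qed
  moreover have "D \<ge> 0" by (simp add: D_def)
  ultimately show ?case by blast
qed

lemma mult_diff_bound:
  fixes u v :: "'k::real_normed_field"
  assumes "norm u \<le> B" "norm v' \<le> B'"
  shows "norm (u * v - u' * v') \<le> B * norm (v - v') + B' * norm (u - u')"
proof -
  have "u * v - u' * v' = u * (v - v') + v' * (u - u')" by (simp add: algebra_simps)
  hence "norm (u * v - u' * v') \<le> norm u * norm (v - v') + norm v' * norm (u - u')"
    by (metis norm_mult norm_triangle_ineq)
  also have "\<dots> \<le> B * norm (v - v') + B' * norm (u - u')"
    using assms by (intro add_mono mult_right_mono) auto
  finally show ?thesis .
qed

lemma inverse_diff_bound:
  fixes u v :: "'k::real_normed_field"
  assumes "0 < c" "c \<le> norm u" "c \<le> norm v"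
  shows "norm (inverse u - inverse v) \<le> norm (u - v) / c\<^sup>2"
proof -
  have nz: "u \<noteq> 0" "v \<noteq> 0" using assms by auto
  have "norm (inverse u - inverse v) = norm (u - v) / (norm u * norm v)"
    using nz by (simp add: inverse_diff_inverse norm_mult norm_inverse divide_inverse norm_minus_commute[of u v])
  also have "\<dots> \<le> norm (u - v) / c\<^sup>2"
    unfolding power2_eq_square using assms by (intro divide_left_mono mult_mono mult_pos_pos) auto
  finally show ?thesis .
qed

definition coeff_dist :: "nat \<Rightarrow> (nat \<Rightarrow> real) \<Rightarrow> (nat \<Rightarrow> real) \<Rightarrow> (nat \<Rightarrow> real) \<Rightarrow> (nat \<Rightarrow> real) \<Rightarrow> real" where
  "coeff_dist n a b a' b' = (\<Sum>i=1..n. \<bar>a i - a' i\<bar> + \<bar>b i - b' i\<bar>)"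

lemma coeff_dist_nonneg: "0 \<le> coeff_dist n a b a' b'"
  unfolding coeff_dist_def by (intro sum_nonneg) auto

lemma coeff_dist_Suc: "coeff_dist (Suc n) a b a' b' =
    coeff_dist n a b a' b' + (\<bar>a (Suc n) - a' (Suc n)\<bar> + \<bar>b (Suc n) - b' (Suc n)\<bar>)"
  unfolding coeff_dist_def by (simp add: sum.cl_ivl_Suc)

lemma coeff_dist_self [simp]: "coeff_dist n a b a b = 0"
  unfolding coeff_dist_def by simp

text \<open>Joint dependence on coefficients and spectral parameter. The first compares neighbouring
  periods, or a stretch with a right limit; the second compares nearby energies and leads from the
  real axis into a complex rectangle.\<close>

lemma sol_lipschitz:
  assumes l: "0 < l"
  shows "\<exists>C\<ge>0. \<forall>a b a' b' (z::'k::real_normed_field) z'. coeff_box l M a b \<longrightarrow> coeff_box l M a' b' \<longrightarrow>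
    norm z \<le> R \<longrightarrow> norm z' \<le> R \<longrightarrow>
    norm (fst (sol a b z u n) - fst (sol a' b' z' u n)) \<le> C * (coeff_dist n a b a' b' + norm (z - z')) \<and>
    norm (snd (sol a b z u n) - snd (sol a' b' z' u n)) \<le> C * (coeff_dist n a b a' b' + norm (z - z'))"
proof (induction n)
  case 0
  show ?case by (intro exI[of _ 0]) auto
next
  case (Suc n)
  then obtain C where C: "C \<ge> 0" "\<And>a b a' b' (z::'k) z'. coeff_box l M a b \<Longrightarrow> coeff_box l M a' b' \<Longrightarrow>
    norm z \<le> R \<Longrightarrow> norm z' \<le> R \<Longrightarrow>
    norm (fst (sol a b z u n) - fst (sol a' b' z' u n)) \<le> C * (coeff_dist n a b a' b' + norm (z - z')) \<and>
    norm (snd (sol a b z u n) - snd (sol a' b' z' u n)) \<le> C * (coeff_dist n a b a' b' + norm (z - z'))" by meson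
  obtain B where B: "B \<ge> 0" "\<And>a b z::'k. coeff_box l M a b \<Longrightarrow> norm z \<le> R \<Longrightarrow>
    norm (fst (sol a b z u n)) \<le> B \<and> norm (snd (sol a b z u n)) \<le> B" using sol_bound[OF l, of M R u n] by blast
  define D1 where "D1 = \<bar>R + M\<bar> * C + B + C"
  define N1 where "N1 = \<bar>R + M\<bar> * B + B"
  define D where "D = (D1 * inverse l + N1 / l\<^sup>2) + (\<bar>M\<bar> * C + B)"
  have D1: "D1 \<ge> 0" "N1 \<ge> 0" using B(1) C(1) by (auto simp: D1_def N1_def)
  have "norm (fst (sol a b z u (Suc n)) - fst (sol a' b' z' u (Suc n))) \<le> D * (coeff_dist (Suc n) a b a' b' + norm (z - z')) \<and>
    norm (snd (sol a b z u (Suc n)) - snd (sol a' b' z' u (Suc n))) \<le> D * (coeff_dist (Suc n) a b a' b' + norm (z - z'))"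
    if bx: "coeff_box l M a b" "coeff_box l M a' b'" and z: "norm z \<le> R" "norm z' \<le> R" for a b a' b' and z z' :: 'k
  proof -
    let ?d = "coeff_dist (Suc n) a b a' b' + norm (z - z')" and ?e = "coeff_dist n a b a' b' + norm (z - z')"
    have dd: "?d = ?e + \<bar>a (Suc n) - a' (Suc n)\<bar> + \<bar>b (Suc n) - b' (Suc n)\<bar>"
      unfolding coeff_dist_Suc by linarith
    have d0: "?e \<ge> 0" "\<bar>a (Suc n) - a' (Suc n)\<bar> \<le> ?d" "\<bar>b (Suc n) - b' (Suc n)\<bar> + norm (z - z') \<le> ?d" "?e \<le> ?d"
      using coeff_dist_nonneg[of n a b a' b'] by (auto simp: dd)
    have dn: "?d \<ge> 0" using coeff_dist_nonneg[of "Suc n" a b a' b'] by simp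
    have ab: "l \<le> a (Suc n)" "a (Suc n) \<le> M" "\<bar>b (Suc n)\<bar> \<le> M" "l \<le> a' (Suc n)" "a' (Suc n) \<le> M" "\<bar>b' (Suc n)\<bar> \<le> M"
      using bx by (auto simp: coeff_box_def)
    let ?P = "fst (sol a b z u n)" and ?Q = "snd (sol a b z u n)" and ?P' = "fst (sol a' b' z' u n)" and ?Q' = "snd (sol a' b' z' u n)"
    have PQ: "norm ?P \<le> B" "norm ?Q \<le> B" "norm ?P' \<le> B" "norm ?Q' \<le> B" using B(2)[OF bx(1) z(1)] B(2)[OF bx(2) z(2)] by auto
    have "C * ?e \<le> C * ?d" using C(1) d0 by (intro mult_left_mono) auto
    hence dPQ: "norm (?P - ?P') \<le> C * ?d" "norm (?Q - ?Q') \<le> C * ?d" using C(2)[OF bx z] by linarith+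
    define w where "w = z - of_real (b (Suc n))"
    define w' where "w' = z' - of_real (b' (Suc n))"
    have w: "norm w \<le> \<bar>R + M\<bar>" "norm w' \<le> \<bar>R + M\<bar>"
      unfolding w_def w'_def using z ab norm_triangle_ineq4[of z "of_real (b (Suc n))"]
        norm_triangle_ineq4[of z' "of_real (b' (Suc n))"] by auto
    have "w - w' = (z - z') - of_real (b (Suc n) - b' (Suc n))" by (simp add: w_def w'_def)
    hence "norm (w - w') \<le> norm (z - z') + norm (of_real (b (Suc n) - b' (Suc n)) :: 'k)"
      by (metis norm_triangle_ineq4)
    hence ww: "norm (w - w') \<le> ?d" using d0(3) by (simp del: of_real_diff)
    define N where "N = w * ?P - ?Q"
    define N' where "N' = w' * ?P' - ?Q'"
    have "norm (w * ?P - w' * ?P') \<le> \<bar>R + M\<bar> * norm (?P - ?P') + B * norm (w - w')"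
      by (rule mult_diff_bound) (use w PQ in auto)
    also have "\<dots> \<le> \<bar>R + M\<bar> * (C * ?d) + B * ?d" using dPQ ww B(1) by (intro add_mono mult_left_mono) auto
    finally have NN: "norm (N - N') \<le> D1 * ?d"
      unfolding N_def N'_def D1_def using dPQ(2) norm_triangle_ineq4[of "w * ?P - w' * ?P'" "?Q - ?Q'"]
      by (simp add: algebra_simps)
    have "norm N' \<le> norm w' * norm ?P' + norm ?Q'" unfolding N'_def by (metis norm_mult norm_triangle_ineq4)
    also have "\<dots> \<le> N1" unfolding N1_def using w PQ B(1) by (intro add_mono mult_mono) auto
    finally have N'1: "norm N' \<le> N1" .
    have inv: "norm (inverse (of_real (a (Suc n))) - inverse (of_real (a' (Suc n)) :: 'k)) \<le> norm (of_real (a (Suc n)) - of_real (a' (Suc n)) :: 'k) / l\<^sup>2"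
      by (rule inverse_diff_bound) (use l ab in auto)
    have "norm (of_real (a (Suc n)) - of_real (a' (Suc n)) :: 'k) \<le> ?d"
      using d0(2) by (metis norm_of_real of_real_diff)
    hence inv: "norm (inverse (of_real (a (Suc n))) - inverse (of_real (a' (Suc n)) :: 'k)) \<le> ?d / l\<^sup>2"
      using l by (intro order.trans[OF inv] divide_right_mono) auto
    have "norm (inverse (of_real (a (Suc n))) * N - inverse (of_real (a' (Suc n))) * N') \<le>
        inverse l * norm (N - N') + N1 * norm (inverse (of_real (a (Suc n))) - inverse (of_real (a' (Suc n)) :: 'k))"
      by (rule mult_diff_bound) (use l ab N'1 in \<open>auto simp: norm_inverse intro!: le_imp_inverse_le\<close>)
    also have "\<dots> \<le> inverse l * (D1 * ?d) + N1 * (?d / l\<^sup>2)"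
      using NN inv D1 l by (intro add_mono mult_left_mono) auto
    finally have 1: "norm (fst (sol a b z u (Suc n)) - fst (sol a' b' z' u (Suc n))) \<le> (D1 * inverse l + N1 / l\<^sup>2) * ?d"
      by (simp add: N_def N'_def w_def w'_def divide_inverse algebra_simps)
    have 2: "norm (snd (sol a b z u (Suc n)) - snd (sol a' b' z' u (Suc n))) \<le> (\<bar>M\<bar> * C + B) * ?d"
    proof -
      have "norm (of_real (a (Suc n)) * ?P - of_real (a' (Suc n)) * ?P') \<le> \<bar>M\<bar> * norm (?P - ?P') + B * norm (of_real (a (Suc n)) - of_real (a' (Suc n)) :: 'k)"
        by (rule mult_diff_bound) (use l ab PQ in auto)
      also have "\<dots> \<le> \<bar>M\<bar> * (C * ?d) + B * ?d"
        using dPQ \<open>norm (of_real (a (Suc n)) - of_real (a' (Suc n)) :: 'k) \<le> ?d\<close> B(1) by (intro add_mono mult_left_mono) auto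
      finally show ?thesis by (simp add: algebra_simps)
    qed
    have "(D1 * inverse l + N1 / l\<^sup>2) * ?d \<le> D * ?d" "(\<bar>M\<bar> * C + B) * ?d \<le> D * ?d"
      unfolding D_def using dn D1 B(1) C(1) l by (auto intro!: mult_right_mono)
    with 1 2 show ?thesis by linarith
  qed
  moreover have "D \<ge> 0" unfolding D_def using D1 B(1) C(1) l by auto
  ultimately show ?case by (intro exI[of _ D] conjI) blast+
qed

section \<open>Bernstein--Szego measures\<close>

lemma has_bochner_integral_inverse_1_plus_square:
  "has_bochner_integral lborel (\<lambda>x::real. 1 / (1 + x\<^sup>2)) pi"
proof (rule has_bochner_integral_nn_integral)
  let ?f = "\<lambda>x::real. ennreal (1 / (1 + x\<^sup>2))"
  have pos: "0 < 1 + x\<^sup>2" for x :: real by (smt (verit) zero_le_power2)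
  have half: "(\<integral>\<^sup>+x. ?f x * indicator {0..} x \<partial>lborel) = ennreal (pi / 2)"
  proof -
    have "(\<integral>\<^sup>+x. ?f x * indicator {0..} x \<partial>lborel) = ennreal (pi / 2 - arctan 0)"
    proof (rule nn_integral_FTC_atLeast)
      show "DERIV arctan x :> 1 / (1 + x\<^sup>2)" for x
        using DERIV_arctan[of x] by (simp add: divide_inverse)
      show "(arctan \<longlongrightarrow> pi / 2) at_top" by (rule tendsto_arctan_at_top)
    qed (use pos in \<open>auto simp: less_imp_le\<close>)
    thus ?thesis by simp
  qed
  have "(\<integral>\<^sup>+x. ?f x * indicator {..<0} x \<partial>lborel) = (\<integral>\<^sup>+x. ?f (- x) * indicator {..<0} (- x) \<partial>lborel)"
    using nn_integral_real_affine[of "\<lambda>x. ?f x * indicator {..<0} x" "-1" 0] by simp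
  also have "\<dots> = (\<integral>\<^sup>+x. ?f x * indicator {0..} x \<partial>lborel)"
  proof (rule nn_integral_cong_AE)
    show "AE x in lborel. ?f (- x) * indicator {..<0} (- x) = ?f x * indicator {0..} x"
      using AE_lborel_singleton[of "0::real"] by eventually_elim (auto simp: indicator_def)
  qed
  finally have neg: "(\<integral>\<^sup>+x. ?f x * indicator {..<0} x \<partial>lborel) = ennreal (pi / 2)" using half by simp
  have "(\<integral>\<^sup>+x. ?f x \<partial>lborel) = (\<integral>\<^sup>+x. ?f x * indicator {0..} x + ?f x * indicator {..<0} x \<partial>lborel)"
    by (intro nn_integral_cong) (auto simp: indicator_def)
  also have "\<dots> = ennreal (pi / 2) + ennreal (pi / 2)"
    by (subst nn_integral_add) (auto simp: half neg)
  also have "\<dots> = ennreal pi" by (subst ennreal_plus[symmetric]) auto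
  finally show "(\<integral>\<^sup>+x. ?f x \<partial>lborel) = ennreal pi" .
qed (auto intro!: AE_I2 add_nonneg_nonneg)

text \<open>The contour is closed by a half circle in the upper half-plane; quadratic decay makes
  the contribution of the arc of order 1 / r.\<close>

lemma integral_real_line_eq_0:
  fixes F :: "complex \<Rightarrow> complex"
  assumes cont: "continuous_on {z. 0 \<le> Im z} F" and hol: "F holomorphic_on {z. 0 < Im z}"
    and R: "0 < R" and bound: "\<And>z. 0 \<le> Im z \<Longrightarrow> R \<le> cmod z \<Longrightarrow> cmod (F z) \<le> C / (cmod z)\<^sup>2"
  shows "integrable lborel (\<lambda>x::real. F (of_real x))"
    and "(\<integral>x. F (of_real x) \<partial>lborel) = 0"
proof -
  have cr: "continuous_on A (\<lambda>x::real. F (of_real x))" for A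
    by (rule continuous_on_compose2[OF cont]) (auto intro: continuous_intros)
  have meas [measurable]: "(\<lambda>x::real. F (of_real x)) \<in> borel_measurable borel"
    by (rule borel_measurable_continuous_onI) (rule cr)
  have "0 \<le> C / R\<^sup>2" using order_trans[OF norm_ge_zero bound[of "of_real R"]] R by simp
  hence C: "0 \<le> C" using R by (simp add: zero_le_divide_iff)
  have "compact ((\<lambda>x::real. F (of_real x)) ` {-R..R})" by (rule compact_continuous_image[OF cr]) simp
  then obtain B where B: "\<And>x::real. x \<in> {-R..R} \<Longrightarrow> cmod (F (of_real x)) \<le> B"
    by (metis bounded_iff compact_imp_bounded imageI)
  have B0: "0 \<le> B" using B[of 0] R by (smt (verit) atLeastAtMost_iff norm_ge_zero)
  \<comment> \<open>\<open>K / (1 + x\<^sup>2)\<close> has to dominate on the whole line: the first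
    summand takes care of the points with modulus at most \<open>R\<close>, the second of the
    others.\<close>
  define K where "K = B * (1 + R\<^sup>2) + C * (1 + 1 / R\<^sup>2)"
  have K: "0 \<le> K" unfolding K_def using B0 C by simp
  have Kb: "cmod (F (of_real x)) \<le> K * (1 / (1 + x\<^sup>2))" for x :: real
  proof (cases "\<bar>x\<bar> \<le> R")
    case True
    have "cmod (F (of_real x)) * (1 + x\<^sup>2) \<le> B * (1 + R\<^sup>2)"
      using True R B0 by (intro mult_mono B) (auto simp: abs_le_square_iff[symmetric])
    also have "\<dots> \<le> K" using C by (auto simp: K_def)
    finally show ?thesis by (simp add: pos_le_divide_eq add_pos_nonneg)
  next
    case False
    have x: "x\<^sup>2 \<ge> R\<^sup>2" "x\<^sup>2 > 0" using False R by (auto simp: abs_le_square_iff[symmetric])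
    have "cmod (F (of_real x)) * (1 + x\<^sup>2) \<le> C / x\<^sup>2 * (1 + x\<^sup>2)"
      using bound[of "of_real x"] False by (intro mult_right_mono) auto
    also have "\<dots> = C * (1 + 1 / x\<^sup>2)" using x by (simp add: field_simps)
    also have "\<dots> \<le> C * (1 + 1 / R\<^sup>2)" using x C R by (intro mult_left_mono add_left_mono divide_left_mono) auto
    also have "\<dots> \<le> K" using B0 by (auto simp: K_def)
    finally show ?thesis by (simp add: pos_le_divide_eq add_pos_nonneg)
  qed
  have int1: "integrable lborel (\<lambda>x::real. K * (1 / (1 + x\<^sup>2)))"
    using has_bochner_integral_inverse_1_plus_square by (intro integrable_mult_right) (auto simp: has_bochner_integral_iff)
  show int: "integrable lborel (\<lambda>x::real. F (of_real x))"
    by (rule Bochner_Integration.integrable_bound[OF int1]) (use K in \<open>auto intro!: AE_I2 order_trans[OF Kb]\<close>)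
  have seg: "cmod (integral {- r..r} (\<lambda>x. F (of_real x))) \<le> C * pi / r" if r: "R \<le> r" for r
  proof -
    have r0: "r > 0" using r R by simp
    let ?g = "part_circlepath 0 r 0 pi" and ?L = "linepath (of_real (-r)) (of_real r) :: real \<Rightarrow> complex"
    have ends: "pathstart ?g = of_real r" "pathfinish ?g = of_real (-r)" by (auto simp: exp_Euler)
    have img: "path_image ?g \<subseteq> {z. 0 \<le> Im z} \<inter> {z. cmod z = r}"
      using r0 by (auto simp: path_image_part_circlepath' Im_exp norm_mult closed_segment_eq_real_ivl intro!: mult_nonneg_nonneg sin_ge_zero)
    have "convex {z. 0 \<le> Im z}" by (rule convex_halfspace_Im_ge)
    have imgL: "path_image ?L \<subseteq> {z. 0 \<le> Im z}"
      using r0 by (auto simp: closed_segment_def)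
    have "(F has_contour_integral 0) (?L +++ ?g)"
    proof (rule Cauchy_theorem_convex[where S = "{z. 0 \<le> Im z}" and K = "{}"])
      fix x assume "x \<in> interior {z. 0 \<le> Im z} - {}"
      hence "x \<in> {z. 0 < Im z}" using interior_halfspace_ge[of \<i> 0] by (simp add: inner_complex_def)
      thus "F field_differentiable at x" using hol holomorphic_on_imp_differentiable_at open_halfspace_Im_gt by blast
    next
      show "path_image (?L +++ ?g) \<subseteq> {z. 0 \<le> Im z}"
        using img imgL by (auto dest!: set_rev_mp[OF _ path_image_join_subset])
    qed (use cont ends in \<open>auto simp: convex_halfspace_Im_ge intro!: valid_path_join\<close>)
    have ci: "F contour_integrable_on ?g"
      by (intro contour_integrable_continuous_part_circlepath continuous_on_subset[OF cont]) (use img in auto)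
    have ciL: "F contour_integrable_on ?L"
      by (intro contour_integrable_continuous_linepath continuous_on_subset[OF cont]) (use imgL in auto)
    have "contour_integral ?L F + contour_integral ?g F = 0"
      using \<open>(F has_contour_integral 0) (?L +++ ?g)\<close> ci ciL ends
      by (metis contour_integral_join contour_integral_unique pathfinish_linepath valid_path_linepath valid_path_part_circlepath)
    moreover have "contour_integral ?L F = integral {-r..r} (\<lambda>x. F (of_real x))"
      by (subst contour_integral_linepath_Reals_eq) (use r0 in auto)
    moreover have "cmod (contour_integral ?g F) \<le> C / r\<^sup>2 * r * \<bar>pi - 0\<bar>"
    proof (rule contour_integral_bound_part_circlepath[OF ci])
      fix z assume "z \<in> path_image ?g"
      thus "cmod (F z) \<le> C / r\<^sup>2" using img bound[of z] r by auto
    qed (use C r0 in auto)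
    ultimately have "cmod (integral {- r..r} (\<lambda>x. F (of_real x))) \<le> C / r\<^sup>2 * r * \<bar>pi - 0\<bar>"
      by (metis add_eq_0_iff norm_minus_cancel)
    thus ?thesis using r0 by (simp add: power2_eq_square)
  qed
  have "(\<lambda>n. \<integral>x. indicator {- real n..real n} x *\<^sub>R F (of_real x) \<partial>lborel) \<longlonglongrightarrow> (\<integral>x. F (of_real x) \<partial>lborel)"
  proof (rule integral_dominated_convergence[where w = "\<lambda>x. K * (1 / (1 + x\<^sup>2))"])
    show "AE x in lborel. (\<lambda>n. indicator {- real n..real n} x *\<^sub>R F (of_real x)) \<longlonglongrightarrow> F (of_real x)"
    proof (intro AE_I2 tendsto_eventually)
      fix x :: real
      obtain N :: nat where "\<bar>x\<bar> \<le> real N" by (meson real_arch_simple)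
      thus "\<forall>\<^sub>F n in sequentially. indicator {- real n..real n} x *\<^sub>R F (of_real x) = F (of_real x)"
        by (intro eventually_sequentiallyI[of N]) (auto simp: indicator_def)
    qed
    show "AE x in lborel. norm (indicator {- real n..real n} x *\<^sub>R F (of_real x)) \<le> K * (1 / (1 + x\<^sup>2))" for n
      using Kb by (intro AE_I2) (auto simp: indicator_def intro: order_trans[OF norm_ge_zero])
  qed (use int1 in auto)
  moreover have "(\<lambda>n. \<integral>x. indicator {- real n..real n} x *\<^sub>R F (of_real x) \<partial>lborel) \<longlonglongrightarrow> 0"
  proof (rule Lim_null_comparison)
    have "norm (\<integral>x. indicator {- real n..real n} x *\<^sub>R F (of_real x) \<partial>lborel) \<le> C * pi / real n" if "real n \<ge> R" for n
    proof -
      have "(\<integral>x. indicator {- real n..real n} x *\<^sub>R F (of_real x) \<partial>lborel) = integral {- real n..real n} (\<lambda>x. F (of_real x))"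
        using set_borel_integral_eq_integral(2)[OF borel_integrable_atLeastAtMost'[OF cr]]
        by (simp add: set_lebesgue_integral_def)
      thus ?thesis using seg[OF that] by simp
    qed
    thus "\<forall>\<^sub>F n in sequentially. norm (\<integral>x. indicator {- real n..real n} x *\<^sub>R F (of_real x) \<partial>lborel) \<le> C * pi / real n"
      by (metis (mono_tags, lifting) eventually_sequentiallyI of_nat_le_iff order_trans real_arch_simple)
    show "(\<lambda>n. C * pi / real n) \<longlonglongrightarrow> 0" by (rule lim_const_over_n)
  qed
  ultimately show "(\<integral>x. F (of_real x) \<partial>lborel) = 0" by (rule LIMSEQ_unique)
qed

text \<open>At a zero, \<open>sol_Im\<close> is compatible with the boundary relation only if the
  second entry vanishes; then both entries do, against the Wronskian. For real \<open>z\<close> the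
  squared modulus of this function is the Bernstein-Szego denominator.\<close>

lemma jost_nonzero:
  fixes z :: complex
  assumes "\<And>i. 1 \<le> i \<Longrightarrow> a i \<noteq> 0" "0 \<le> Im z"
  shows "fst (sol a b z (1, 0) n) + \<i> * snd (sol a b z (1, 0) n) \<noteq> 0"
proof
  let ?P = "fst (sol a b z (1, 0) n)" and ?Q = "snd (sol a b z (1, 0) n)"
  assume "?P + \<i> * ?Q = 0"
  hence P: "?P = - \<i> * ?Q" by (simp add: eq_neg_iff_add_eq_0)
  have "?P * cnj ?Q = - \<i> * (?Q * cnj ?Q)" unfolding P by simp
  hence "Im (?P * cnj ?Q) = - (cmod ?Q)\<^sup>2" unfolding complex_norm_square[symmetric] by simp
  moreover have "Im (?P * cnj ?Q) \<ge> 0"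
    using sol_Im[of n a b z "(1,0)"] assms by (simp add: sum_nonneg)
  ultimately have "?Q = 0" by simp
  moreover have "?P * snd (sol a b z (0, 1) n) - ?Q * fst (sol a b z (0, 1) n) = 1"
    using sol_wronskian[of n a b z "(1,0)" "(0,1)"] assms by simp
  ultimately show False using P by simp
qed

lemma sol_norm_pos:
  fixes x :: real
  assumes "\<And>i. 1 \<le> i \<Longrightarrow> a i \<noteq> 0"
  shows "0 < (fst (sol a b x (1, 0) n))\<^sup>2 + (snd (sol a b x (1, 0) n))\<^sup>2"
  using sol_wronskian[of n a b x "(1,0)" "(0,1)"] assms
  by (auto simp: sum_power2_gt_zero_iff)

text \<open>\<open>G\<close> solves the recurrence with a source at \<open>0\<close> and a dissipative boundary condition at \<open>n\<close>: it is
  the first column of a resolvent, hence decays like one, and on the real line the real part of its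
  \<open>k\<close>-th entry is \<open>p\<^sub>k / (p\<^sub>n\<^sup>2 + a\<^sub>n\<^sup>2 p\<^sub>n\<^sub>-\<^sub>1\<^sup>2)\<close>.\<close>

lemma bernstein_szego_aux:
  assumes l: "0 < l" and bx: "coeff_box l M a b" and n: "1 \<le> n"
  defines "g \<equiv> \<lambda>z::complex. - \<i> * (fst (sol a b z (0, 1) n) + \<i> * snd (sol a b z (0, 1) n)) /
      (fst (sol a b z (1, 0) n) + \<i> * snd (sol a b z (1, 0) n))"
  defines "G \<equiv> \<lambda>z. sol a b z (g z, \<i>)"
  assumes z: "0 \<le> Im z" "2 * (M + M\<^sup>2 + 1) \<le> cmod z"
  shows "1 \<le> k \<Longrightarrow> k < n \<Longrightarrow> cmod (fst (G z k)) \<le> 4 * M / (cmod z)\<^sup>2"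
    and "cmod (fst (G z 0) - \<i> / (z + \<i>)) \<le> 2 * (M + M\<^sup>2 + 1) / (cmod z)\<^sup>2"
proof -
  have a: "l \<le> a i" "a i \<le> M" "\<bar>b i\<bar> \<le> M" "0 < a i" if "1 \<le> i" for i
    using bx that l by (force simp: coeff_box_def)+
  have M0: "0 < M" using a(2,4)[of 1] by simp
  obtain m where m: "m = M\<^sup>2" "0 \<le> m" by simp
  have z2: "2 * M \<le> cmod z" "2 \<le> cmod z" "cmod z / 2 \<le> cmod z - M - M\<^sup>2" "1 \<le> cmod z - M - M\<^sup>2"
    using z M0 m(2) unfolding m(1)[symmetric] by auto
  have z0: "cmod z > 0" using z2 by linarith
  define P where "P = fst (sol a b z (1, 0) n)"
  define Q where "Q = snd (sol a b z (1, 0) n)"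
  define P2 where "P2 = fst (sol a b z (0, 1) n)"
  define Q2 where "Q2 = snd (sol a b z (0, 1) n)"
  have S: "P + \<i> * Q \<noteq> 0" unfolding P_def Q_def by (rule jost_nonzero) (use a z in force)+
  have "g z * (P + \<i> * Q) = - \<i> * (P2 + \<i> * Q2)"
    unfolding g_def P_def[symmetric] Q_def[symmetric] P2_def[symmetric] Q2_def[symmetric] using S by simp
  hence gS: "\<i> * (g z * (P + \<i> * Q)) = \<i> * (- \<i> * (P2 + \<i> * Q2))" by simp
  \<comment> \<open>This dissipative boundary condition is the linear equation that determines
    \<open>g z\<close>.\<close>
  have bc: "snd (G z n) = \<i> * fst (G z n)"
    unfolding G_def sol_linear[of a b z "(g z, \<i>)" n, THEN conjunct1] sol_linear[of a b z "(g z, \<i>)" n, THEN conjunct2]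
    using gS by (simp add: P_def[symmetric] Q_def[symmetric] P2_def[symmetric] Q2_def[symmetric] algebra_simps)
  have step: "of_real (a (Suc k)) * fst (G z (Suc k)) = (z - of_real (b (Suc k))) * fst (G z k) - snd (G z k)"
    "snd (G z (Suc k)) = of_real (a (Suc k)) * fst (G z k)" for k
    using a(4)[of "Suc k"] by (auto simp: G_def)
  \<comment> \<open>Information travels from the boundary condition at \<open>n\<close> down to 0.
    The recurrence is solved for the lower index, where the term with \<open>z\<close> dominates;
    the threshold on \<open>cmod z\<close> makes the factor at least 1 and at least
    \<open>cmod z / 2\<close>.\<close>
  have down: "(cmod z - M - M\<^sup>2) * cmod (fst (G z k)) \<le> cmod (snd (G z k))"
    if "cmod (fst (G z (Suc k))) \<le> cmod (snd (G z (Suc k)))" for k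
  proof -
    have "snd (G z k) = (z - of_real (b (Suc k))) * fst (G z k) - of_real (a (Suc k)) * fst (G z (Suc k))"
      using step(1)[of k] by simp
    hence "cmod (snd (G z k)) \<ge> cmod (z - of_real (b (Suc k))) * cmod (fst (G z k)) - cmod (of_real (a (Suc k)) * fst (G z (Suc k)))"
      by (metis norm_mult norm_triangle_ineq2)
    moreover have "cmod (z - of_real (b (Suc k))) \<ge> cmod z - M"
      using norm_triangle_ineq2[of z "of_real (b (Suc k))"] a(3)[of "Suc k"] by simp
    hence "cmod (z - of_real (b (Suc k))) * cmod (fst (G z k)) \<ge> (cmod z - M) * cmod (fst (G z k))"
      by (intro mult_right_mono) auto
    moreover have "cmod (of_real (a (Suc k)) * fst (G z (Suc k))) \<le> M\<^sup>2 * cmod (fst (G z k))"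
    proof -
      have "cmod (of_real (a (Suc k)) * fst (G z (Suc k))) \<le> a (Suc k) * cmod (snd (G z (Suc k)))"
        using that a(4)[of "Suc k"] by (simp add: norm_mult)
      also have "\<dots> = (a (Suc k))\<^sup>2 * cmod (fst (G z k))"
        using a(4)[of "Suc k"] by (simp add: step(2) norm_mult power2_eq_square)
      also have "\<dots> \<le> M\<^sup>2 * cmod (fst (G z k))"
        using a[of "Suc k"] by (intro mult_right_mono power_mono) auto
      finally show ?thesis .
    qed
    ultimately show ?thesis by (simp add: algebra_simps)
  qed
  have ub: "cmod (fst (G z k)) \<le> cmod (snd (G z k))" if "k \<le> n" for k
    using that
  proof (induction k rule: inc_induct)
    case base
    show ?case by (simp add: bc norm_mult)
  next
    case (step k)
    have "1 * cmod (fst (G z k)) \<le> (cmod z - M - M\<^sup>2) * cmod (fst (G z k))"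
      using z2 by (intro mult_right_mono) auto
    thus ?case using down[OF step.IH] by simp
  qed
  have ub2: "cmod (fst (G z k)) \<le> 2 / cmod z * cmod (snd (G z k))" if "k < n" for k
  proof -
    have "cmod z / 2 * cmod (fst (G z k)) \<le> (cmod z - M - M\<^sup>2) * cmod (fst (G z k))"
      using z2 by (intro mult_right_mono) auto
    thus ?thesis using down[OF ub[of "Suc k"]] that z0 by (simp add: field_simps)
  qed
  have "snd (G z 0) = \<i>" by (simp add: G_def)
  hence g0: "cmod (fst (G z 0)) \<le> 2 / cmod z" using ub2[of 0] n by simp
  \<comment> \<open>One factor \<open>1 / cmod z\<close> is gained here, at the source, and a second
    one from \<open>ub2\<close>; together they give the quadratic decay needed for closing the
    contour.\<close>
  have H: "cmod (snd (G z (Suc k))) \<le> 2 * M / cmod z" if "Suc k \<le> n" for k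
    using that
  proof (induction k)
    case 0
    have "cmod (snd (G z (Suc 0))) = a 1 * cmod (fst (G z 0))" using a(4)[of 1] by (simp add: step(2) norm_mult)
    also have "\<dots> \<le> M * (2 / cmod z)" using a[of 1] g0 M0 by (intro mult_mono) auto
    finally show ?case by (simp add: mult.commute)
  next
    case (Suc k)
    have "cmod (snd (G z (Suc (Suc k)))) = a (Suc (Suc k)) * cmod (fst (G z (Suc k)))"
      using a(4)[of "Suc (Suc k)"] by (simp add: step(2) norm_mult)
    also have "\<dots> \<le> M * (2 / cmod z * cmod (snd (G z (Suc k))))"
      using a[of "Suc (Suc k)"] ub2[of "Suc k"] M0 Suc.prems by (intro mult_mono) auto
    also have "\<dots> \<le> M * (2 / cmod z * (2 * M / cmod z))"
      using Suc M0 by (intro mult_left_mono) auto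
    also have "\<dots> = 2 * M / cmod z * (2 * M / cmod z)" by simp
    also have "\<dots> \<le> 2 * M / cmod z * 1" using z2 z0 M0 by (intro mult_left_mono) auto
    finally show ?case by simp
  qed
  {
    assume k: "1 \<le> k" "k < n"
    then obtain j where j: "k = Suc j" by (cases k) auto
    have "cmod (fst (G z k)) \<le> 2 / cmod z * (2 * M / cmod z)"
      using k z0 by (intro order_trans[OF ub2[OF k(2)]] mult_left_mono) (auto simp: j intro!: H)
    thus "cmod (fst (G z k)) \<le> 4 * M / (cmod z)\<^sup>2" by (simp add: power2_eq_square)
  }
  have "cmod z \<le> cmod (z + \<i>)"
  proof -
    have "(Im z)\<^sup>2 \<le> (Im z + 1)\<^sup>2" using z(1) by (intro power_mono) auto
    thus ?thesis by (simp add: cmod_def)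
  qed
  hence zi: "z + \<i> \<noteq> 0" "cmod z \<le> cmod (z + \<i>)" using z0 by auto
  have "fst (G z 0) * (z + \<i>) - \<i> = of_real (b 1) * fst (G z 0) + of_real (a 1) * fst (G z 1) + \<i> * fst (G z 0)"
    using step(1)[of 0] \<open>snd (G z 0) = \<i>\<close> by (simp add: algebra_simps)
  hence "cmod (fst (G z 0) * (z + \<i>) - \<i>) \<le> cmod (of_real (b 1) * fst (G z 0)) + cmod (of_real (a 1) * fst (G z 1)) + cmod (\<i> * fst (G z 0))"
    by (metis norm_triangle_le norm_triangle_ineq add_right_mono)
  also have "\<dots> \<le> M * cmod (fst (G z 0)) + M * (M * cmod (fst (G z 0))) + cmod (fst (G z 0))"
  proof (intro add_mono)
    show "cmod (of_real (b 1) * fst (G z 0)) \<le> M * cmod (fst (G z 0))" 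
      using a[of 1] by (simp add: norm_mult mult_right_mono)
    have "cmod (fst (G z 1)) \<le> cmod (snd (G z 1))" using ub[of 1] n by simp
    also have "\<dots> \<le> M * cmod (fst (G z 0))"
      using step(2)[of 0] a[of 1] by (simp add: norm_mult mult_right_mono)
    finally show "cmod (of_real (a 1) * fst (G z 1)) \<le> M * (M * cmod (fst (G z 0)))"
      using a[of 1] M0 by (simp add: norm_mult mult_mono)
  qed (auto simp: norm_mult)
  also have "\<dots> = (M + M\<^sup>2 + 1) * cmod (fst (G z 0))" by (simp add: algebra_simps power2_eq_square)
  also have "\<dots> \<le> (M + M\<^sup>2 + 1) * (2 / cmod z)" using M0 g0 by (intro mult_left_mono) auto
  finally have num: "cmod (fst (G z 0) * (z + \<i>) - \<i>) \<le> 2 * (M + M\<^sup>2 + 1) / cmod z" by (simp add: mult.commute)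
  have "fst (G z 0) - \<i> / (z + \<i>) = (fst (G z 0) * (z + \<i>) - \<i>) / (z + \<i>)" using zi by (simp add: field_simps)
  hence "cmod (fst (G z 0) - \<i> / (z + \<i>)) = cmod (fst (G z 0) * (z + \<i>) - \<i>) / cmod (z + \<i>)" by (simp add: norm_divide)
  also have "\<dots> \<le> (2 * (M + M\<^sup>2 + 1) / cmod z) / cmod z" using num zi z0 M0 by (intro frac_le) auto
  finally show "cmod (fst (G z 0) - \<i> / (z + \<i>)) \<le> 2 * (M + M\<^sup>2 + 1) / (cmod z)\<^sup>2" by (simp add: power2_eq_square)
qed

text \<open>On the real line the numerator of \<open>Re (g x)\<close> is the Wronskian, so
  \<open>Re (g x)\<close> is the reciprocal of the weight. For \<open>k = 0\<close> the resolvent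
  entry decays only like \<open>\<i> / z\<close>; subtracting \<open>\<i> / (z + \<i>)\<close>
  restores quadratic decay, and the real part \<open>1 / (1 + x\<^sup>2)\<close> of this term
  supplies the mass \<open>pi\<close>.\<close>

lemma bernstein_szego:
  assumes l: "0 < l" and bx: "coeff_box l M a b" and k: "k < n"
  defines "w \<equiv> \<lambda>x::real. (fst (sol a b x (1, 0) n))\<^sup>2 + (snd (sol a b x (1, 0) n))\<^sup>2"
  shows "has_bochner_integral lborel (\<lambda>x. fst (sol a b x (1, 0) k) / w x) (if k = 0 then pi else 0)"
proof -
  have a: "l \<le> a i" "a i \<le> M" "\<bar>b i\<bar> \<le> M" "0 < a i" if "1 \<le> i" for i
    using bx that l by (force simp: coeff_box_def)+
  have M0: "0 < M" using a(2,4)[of 1] by simp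
  define S where "S = (\<lambda>z::complex. fst (sol a b z (1, 0) n) + \<i> * snd (sol a b z (1, 0) n))"
  define g where "g = (\<lambda>z::complex. - \<i> * (fst (sol a b z (0, 1) n) + \<i> * snd (sol a b z (0, 1) n)) / S z)"
  define F where "F = (\<lambda>z. g z * fst (sol a b z (1, 0) k) + \<i> * fst (sol a b z (0, 1) k) - (if k = 0 then \<i> / (z + \<i>) else 0))"
  have FG: "F z = fst (sol a b z (g z, \<i>) k) - (if k = 0 then \<i> / (z + \<i>) else 0)" for z
    using sol_linear[of a b z "(g z, \<i>)" k] by (simp add: F_def)
  have S0: "S z \<noteq> 0" if "0 \<le> Im z" for z unfolding S_def by (rule jost_nonzero) (use a that in force)+
  have zi: "z + \<i> \<noteq> 0" if "0 \<le> Im z" for z using that by (auto simp: complex_eq_iff)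
  have nz: "\<And>i. 1 \<le> i \<Longrightarrow> i \<le> m \<Longrightarrow> a i \<noteq> 0" for m using a(4) by force
  have contS: "continuous_on A (\<lambda>z. fst (sol a b z u m))" "continuous_on A (\<lambda>z. snd (sol a b z u m))" for A :: "complex set" and u m
    using continuous_on_sol[OF continuous_on_id, of m a A b u] nz by auto
  have holS: "(\<lambda>z. fst (sol a b z u m)) holomorphic_on A" "(\<lambda>z. snd (sol a b z u m)) holomorphic_on A" for A u m
    using holomorphic_on_sol[of m a b u A] nz by auto
  have contg: "continuous_on {z. 0 \<le> Im z} g"
    unfolding g_def using S0 unfolding S_def by (intro continuous_intros contS) auto
  have contF: "continuous_on {z. 0 \<le> Im z} F"
    unfolding F_def using zi by (cases "k = 0") (auto intro!: continuous_intros contS contg)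
  have holg: "g holomorphic_on {z. 0 < Im z}"
    unfolding g_def using S0 unfolding S_def by (intro holomorphic_intros holS) auto
  have holF: "F holomorphic_on {z. 0 < Im z}"
    unfolding F_def using zi by (cases "k = 0") (auto intro!: holomorphic_intros holS holg)
  define C where "C = max (4 * M) (2 * (M + M\<^sup>2 + 1))"
  define R where "R = 2 * (M + M\<^sup>2 + 1)"
  have R0: "0 < R" unfolding R_def using M0 by (simp add: add_pos_nonneg)
  have bd: "cmod (F z) \<le> C / (cmod z)\<^sup>2" if z: "0 \<le> Im z" "R \<le> cmod z" for z
  proof (cases "k = 0")
    case True
    have "cmod (F z) \<le> 2 * (M + M\<^sup>2 + 1) / (cmod z)\<^sup>2"
      using bernstein_szego_aux(2)[OF l bx _ z(1), of n] z(2) k True by (simp add: FG g_def S_def R_def)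
    also have "\<dots> \<le> C / (cmod z)\<^sup>2" by (intro divide_right_mono) (auto simp: C_def)
    finally show ?thesis .
  next
    case False
    have "cmod (F z) \<le> 4 * M / (cmod z)\<^sup>2"
      using bernstein_szego_aux(1)[OF l bx _ z(1), of n k] z(2) k False by (simp add: FG g_def S_def R_def)
    also have "\<dots> \<le> C / (cmod z)\<^sup>2" by (intro divide_right_mono) (auto simp: C_def)
    finally show ?thesis .
  qed
  note I = integral_real_line_eq_0[OF contF holF R0 bd]
  have hb: "has_bochner_integral lborel (\<lambda>x. Re (F (of_real x))) 0"
    unfolding has_bochner_integral_iff using I by (auto simp: integral_Re)
  have ReF: "fst (sol a b x (1, 0) k) / w x = Re (F (of_real x)) + (if k = 0 then 1 / (1 + x\<^sup>2) else 0)" for x :: real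
  proof -
    define P where "P = fst (sol a b x (1, 0) n)"
    define Q where "Q = snd (sol a b x (1, 0) n)"
    define P2 where "P2 = fst (sol a b x (0, 1) n)"
    define Q2 where "Q2 = snd (sol a b x (0, 1) n)"
    have W: "P * Q2 - Q * P2 = 1" unfolding P_def Q_def P2_def Q2_def
      using sol_wronskian[of n a b x "(1,0)" "(0,1)"] nz by simp
    have pos: "P\<^sup>2 + Q\<^sup>2 > 0" using sol_norm_pos[of a b x n] nz unfolding P_def Q_def by blast
    have "g (of_real x) = - \<i> * (of_real P2 + \<i> * of_real Q2) / (of_real P + \<i> * of_real Q)"
      by (simp add: g_def S_def sol_of_real_10 sol_of_real_01 P_def Q_def P2_def Q2_def)
    also have "Re \<dots> = (P * Q2 - Q * P2) / (P\<^sup>2 + Q\<^sup>2)"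
      by (simp add: Re_divide algebra_simps)
    finally have Reg: "Re (g (of_real x)) = 1 / (P\<^sup>2 + Q\<^sup>2)" using W by simp
    have "Re (\<i> / (of_real x + \<i>)) = 1 / (1 + x\<^sup>2)" by (simp add: Re_divide power2_eq_square add.commute)
    thus ?thesis
      unfolding w_def F_def by (auto simp: sol_of_real_10 sol_of_real_01 Reg P_def[symmetric] Q_def[symmetric])
  qed
  show ?thesis
  proof (cases "k = 0")
    case True
    have "has_bochner_integral lborel (\<lambda>x. Re (F (of_real x)) + 1 / (1 + x\<^sup>2)) (0 + pi)"
      by (intro has_bochner_integral_add hb has_bochner_integral_inverse_1_plus_square)
    thus ?thesis unfolding ReF using True by simp
  next
    case False
    thus ?thesis unfolding ReF using hb by simp
  qed
qed

section \<open>Orthogonal polynomials and the spectral measure\<close>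

primrec opoly :: "(nat \<Rightarrow> real) \<Rightarrow> (nat \<Rightarrow> real) \<Rightarrow> nat \<Rightarrow> real poly \<times> real poly" where
  "opoly a b 0 = (1, 0)"
| "opoly a b (Suc n) = (smult (1 / a (Suc n)) ([:- b (Suc n), 1:] * fst (opoly a b n) - snd (opoly a b n)),
      smult (a (Suc n)) (fst (opoly a b n)))"

lemma poly_opoly:
  "poly (fst (opoly a b n)) x = fst (sol a b x (1, 0) n) \<and> poly (snd (opoly a b n)) x = snd (sol a b x (1, 0) n)"
  by (induction n) (auto simp: algebra_simps add_divide_distrib diff_divide_distrib)

text \<open>The clause on the second component is what keeps the leading coefficient from cancelling
  in the recurrence. Coefficients are used instead of \<open>degree\<close> so that the zero
  polynomial at \<open>n = 0\<close> is no exception.\<close>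

lemma coeff_opoly:
  assumes "\<And>i. 1 \<le> i \<Longrightarrow> a i \<noteq> 0"
  shows "coeff (fst (opoly a b n)) n \<noteq> 0 \<and> (\<forall>j>n. coeff (fst (opoly a b n)) j = 0) \<and> (\<forall>j\<ge>n. coeff (snd (opoly a b n)) j = 0)"
proof (induction n)
  case (Suc n)
  have "a (Suc n) \<noteq> 0" using assms by auto
  thus ?case using Suc by (auto simp: coeff_pCons split: nat.splits)
qed (auto simp: coeff_1)

lemma degree_opoly:
  assumes "\<And>i. 1 \<le> i \<Longrightarrow> a i \<noteq> 0"
  shows "degree (fst (opoly a b n)) = n"
  using coeff_opoly[OF assms, where b = b and n = n]
  by (intro antisym degree_le le_degree) auto

lemma poly_zero_fun: "poly (0 :: 'a::comm_semiring_0 poly) = (\<lambda>x. 0)"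
  by (simp add: fun_eq_iff)

text \<open>The vector r(J) delta_1 of the polynomial functional calculus, given entry by entry as a
  finite sum.\<close>

definition jvec :: "(nat \<Rightarrow> real) \<Rightarrow> (nat \<Rightarrow> real) \<Rightarrow> real poly \<Rightarrow> nat \<Rightarrow> complex" where
  "jvec a b r i = (\<Sum>k\<le>degree r. of_real (coeff r k) * (jacobi a b ^^ k) delta1 i)"

lemma jvec_bound:
  assumes "degree r \<le> N"
  shows "jvec a b r i = (\<Sum>k\<le>N. of_real (coeff r k) * (jacobi a b ^^ k) delta1 i)"
  unfolding jvec_def using assms by (intro sum.mono_neutral_left) (auto simp: coeff_eq_0)

lemma jvec_diff: "jvec a b (r - s) i = jvec a b r i - jvec a b s i"
  using jvec_bound[OF degree_diff_le_max[of r s], of a b i] jvec_bound[of r "max (degree r) (degree s)" a b i]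
    jvec_bound[of s "max (degree r) (degree s)" a b i]
  by (simp add: sum_subtractf algebra_simps)

lemma jvec_smult: "jvec a b (smult c r) i = of_real c * jvec a b r i"
  using jvec_bound[OF degree_smult_le[of c r], of a b i] jvec_bound[of r "degree r" a b i]
  by (simp add: sum_distrib_left algebra_simps)

lemma jacobi_sum:
  "jacobi a b (\<lambda>i. \<Sum>k\<in>A. c k * u k i) i = (\<Sum>k\<in>A. c k * jacobi a b (u k) i)"
  unfolding jacobi_def
  by (auto simp: sum_distrib_left sum.distrib algebra_simps)

lemma jvec_pCons: "jvec a b (pCons c r) i = of_real c * delta1 i + jacobi a b (jvec a b r) i"
proof -
  have "jvec a b (pCons c r) i = (\<Sum>k\<le>Suc (degree r). of_real (coeff (pCons c r) k) * (jacobi a b ^^ k) delta1 i)"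
    by (rule jvec_bound[OF degree_pCons_le])
  also have "\<dots> = of_real c * delta1 i + (\<Sum>k\<le>degree r. of_real (coeff r k) * jacobi a b ((jacobi a b ^^ k) delta1) i)"
    by (subst sum.atMost_Suc_shift) simp
  also have "(\<Sum>k\<le>degree r. of_real (coeff r k) * jacobi a b ((jacobi a b ^^ k) delta1) i) = jacobi a b (jvec a b r) i"
    unfolding jvec_def[abs_def] by (rule jacobi_sum[symmetric])
  finally show ?thesis .
qed

lemma jacobi_unit: "jacobi a b (\<lambda>i. if i = Suc n then 1 else 0) i =
    (if i = n \<and> n \<noteq> 0 then of_real (a n) else 0) + (if i = Suc n then of_real (b (Suc n)) else 0)
    + (if i = Suc (Suc n) then of_real (a (Suc n)) else 0)"
  unfolding jacobi_def by (cases i; cases n) auto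

text \<open>The recurrence of \<open>opoly\<close> is the action of J on a unit vector, solved for
  the next unit vector. Thus the n-th polynomial of J sends \<open>delta1\<close> to the unit vector
  at \<open>Suc n\<close>, the shift by one coming from the constant polynomial at
  \<open>n = 0\<close>.\<close>

lemma jvec_opoly:
  assumes "\<And>i. 1 \<le> i \<Longrightarrow> a i \<noteq> 0"
  shows "jvec a b (fst (opoly a b n)) = (\<lambda>i. if i = Suc n then 1 else 0) \<and>
    jvec a b (snd (opoly a b n)) = (\<lambda>i. if i = n \<and> n \<noteq> 0 then of_real (a n) else 0)"
proof (induction n)
  case 0
  show ?case by (auto simp: jvec_def delta1_def fun_eq_iff)
next
  case (Suc n)
  have nz: "a (Suc n) \<noteq> 0" using assms by auto
  have "jvec a b ([:- b (Suc n), 1:] * fst (opoly a b n)) i =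
      jacobi a b (\<lambda>i. if i = Suc n then 1 else 0) i - (if i = Suc n then of_real (b (Suc n)) else 0)" for i
  proof -
    have "[:- b (Suc n), 1:] * fst (opoly a b n) = pCons 0 (fst (opoly a b n)) - smult (b (Suc n)) (fst (opoly a b n))"
      by simp
    hence "jvec a b ([:- b (Suc n), 1:] * fst (opoly a b n)) i =
        jvec a b (pCons 0 (fst (opoly a b n))) i - of_real (b (Suc n)) * jvec a b (fst (opoly a b n)) i"
      by (simp only: jvec_diff jvec_smult)
    thus ?thesis by (simp only: jvec_pCons Suc) simp
  qed
  hence "jvec a b (fst (opoly a b (Suc n))) i = (if i = Suc (Suc n) then 1 else 0)" for i
    using nz unfolding opoly.simps fst_conv jvec_smult jvec_diff jacobi_unit conjunct2[OF Suc] by simp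
  moreover have "jvec a b (snd (opoly a b (Suc n))) i = (if i = Suc n then of_real (a (Suc n)) else 0)" for i
    unfolding opoly.simps snd_conv jvec_smult conjunct1[OF Suc] by simp
  ultimately show ?case by auto
qed

lemma ell2_inner_delta1: "ell2_inner {1..} delta1 u = u 1"
proof -
  have "ell2_inner {1..} delta1 u = (\<Sum>\<^sub>\<infinity>n\<in>{1}. cnj (delta1 n) * u n)"
    unfolding ell2_inner_def by (rule infsum_cong_neutral) (auto simp: delta1_def)
  thus ?thesis by (simp add: delta1_def)
qed

text \<open>A row of J has at most three entries, each bounded by \<open>M\<close>, so the supremum
  norm grows by a factor of at most \<open>3 * M\<close>. The crude rate serves to confine the
  spectral measure to a bounded interval.\<close>

lemma jacobi_power_bound:
  assumes "coeff_box l M a b" "0 < l"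
  shows "cmod ((jacobi a b ^^ n) delta1 i) \<le> (3 * M) ^ n"
proof (induction n arbitrary: i)
  case 0
  show ?case by (simp add: delta1_def)
next
  case (Suc n)
  let ?u = "(jacobi a b ^^ n) delta1"
  have a: "0 < a i" "a i \<le> M" "\<bar>b i\<bar> \<le> M" if "1 \<le> i" for i
    using assms that by (force simp: coeff_box_def)+
  have M: "0 < M" using a(1,2)[of 1] by simp
  have "cmod (jacobi a b ?u i) \<le> M * (3 * M) ^ n + M * (3 * M) ^ n + M * (3 * M) ^ n"
  proof (cases "i = 0")
    case True
    thus ?thesis using M by (simp add: jacobi_def)
  next
    case False
    have 1: "cmod (if i = 1 then 0 else of_real (a (i - 1)) * ?u (i - 1)) \<le> M * (3 * M) ^ n"
    proof (cases "i = 1")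
      case False
      hence "1 \<le> i - 1" using \<open>i \<noteq> 0\<close> by simp
      thus ?thesis using Suc[of "i - 1"] a(1,2)[of "i - 1"] M False by (auto simp: norm_mult intro!: mult_mono)
    qed (use M in simp)
    have 2: "cmod (of_real (b i) * ?u i) \<le> M * (3 * M) ^ n"
      using Suc[of i] a(3)[of i] M False by (auto simp: norm_mult intro!: mult_mono)
    have 3: "cmod (of_real (a i) * ?u (i + 1)) \<le> M * (3 * M) ^ n"
      using Suc[of "i + 1"] a(1,2)[of i] M False by (auto simp: norm_mult intro!: mult_mono)
    have "jacobi a b ?u i = (if i = 1 then 0 else of_real (a (i - 1)) * ?u (i - 1)) + of_real (b i) * ?u i + of_real (a i) * ?u (i + 1)"
      using False by (simp only: jacobi_def[of a b ?u i] if_False)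
    thus ?thesis by (simp only:) (intro norm_triangle_le add_mono 1 2 3)
  qed
  thus ?case by (simp add: algebra_simps)
qed

section \<open>Orthonormality, support and quadrature for the spectral measure\<close>

context
  fixes a b :: "nat \<Rightarrow> real" and l M :: real and \<mu> :: "real measure"
  assumes l: "0 < l" and bx: "coeff_box l M a b" and csm: "canonical_spectral_measure a b \<mu>"
begin

lemma csm_sets: "sets \<mu> = sets borel" using csm by (simp add: canonical_spectral_measure_def)

lemma csm_space: "space \<mu> = UNIV" using sets_eq_imp_space_eq[OF csm_sets] by simp

lemma csm_moment: "complex_of_real (\<integral>x. x ^ n \<partial>\<mu>) = (jacobi a b ^^ n) delta1 1"
  using csm by (simp add: canonical_spectral_measure_def ell2_inner_delta1 del: One_nat_def)

lemma csm_integrable_poly: "integrable \<mu> (poly r)"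
  using csm unfolding poly_altdef canonical_spectral_measure_def
  by (intro Bochner_Integration.integrable_sum integrable_mult_right) auto

lemma csm_integral_add: "(\<integral>x. poly (r + s) x \<partial>\<mu>) = (\<integral>x. poly r x \<partial>\<mu>) + (\<integral>x. poly s x \<partial>\<mu>)"
proof -
  have "(\<integral>x. poly (r + s) x \<partial>\<mu>) = (\<integral>x. poly r x + poly s x \<partial>\<mu>)"
    by (rule Bochner_Integration.integral_cong) auto
  also have "\<dots> = (\<integral>x. poly r x \<partial>\<mu>) + (\<integral>x. poly s x \<partial>\<mu>)"
    by (rule Bochner_Integration.integral_add) (rule csm_integrable_poly)+
  finally show ?thesis .
qed

lemma csm_integral_smult: "(\<integral>x. poly (smult c r) x \<partial>\<mu>) = c * (\<integral>x. poly r x \<partial>\<mu>)"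
proof -
  have "(\<integral>x. poly (smult c r) x \<partial>\<mu>) = (\<integral>x. c * poly r x \<partial>\<mu>)"
    by (rule Bochner_Integration.integral_cong) auto
  thus ?thesis by simp
qed

lemma csm_integral_poly: "complex_of_real (\<integral>x. poly r x \<partial>\<mu>) = jvec a b r 1"
proof -
  have "(\<integral>x. poly r x \<partial>\<mu>) = (\<Sum>k\<le>degree r. coeff r k * (\<integral>x. x ^ k \<partial>\<mu>))"
    using csm unfolding poly_altdef canonical_spectral_measure_def
    by (subst Bochner_Integration.integral_sum) (auto intro!: integrable_mult_right)
  thus ?thesis by (simp add: jvec_def csm_moment)
qed

lemma coeff_nonzero: "1 \<le> i \<Longrightarrow> a i \<noteq> 0" using bx l by (force simp: coeff_box_def)

lemma csm_integral_opoly: "(\<integral>x. poly (fst (opoly a b n)) x \<partial>\<mu>) = (if n = 0 then 1 else 0)"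
proof -
  have "complex_of_real (\<integral>x. poly (fst (opoly a b n)) x \<partial>\<mu>) = (if n = 0 then 1 else 0)"
    using jvec_opoly[of a b n] coeff_nonzero by (simp add: csm_integral_poly)
  thus ?thesis by (auto split: if_splits)
qed

lemma csm_finite: "finite_measure \<mu>" and csm_measure: "measure \<mu> UNIV = 1"
proof -
  have "poly (1 :: real poly) = (\<lambda>x. 1)" by (simp add: fun_eq_iff)
  hence "integrable \<mu> (\<lambda>x. 1::real)" using csm_integrable_poly[of 1] by simp
  thus f: "finite_measure \<mu>" by (intro finite_measureI) (auto simp: integrable_iff_bounded top_unique less_top)
  show "measure \<mu> UNIV = 1" using csm_integral_opoly[of 0] csm_space by simp
qed

text \<open>The moments give the integral of each single polynomial, which is the case
  \<open>j = 0\<close>. Multiplication by x is symmetric, so expanding x times the product of the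
  i-th and j-th polynomials by either recurrence expresses the integrals with index
  \<open>Suc j\<close> through those with \<open>j\<close> and \<open>j - 1\<close>. This needs the
  induction hypothesis for all \<open>i\<close> and for all indices up to \<open>j\<close>.\<close>

lemma csm_orthonormal:
  "(\<integral>x. poly (fst (opoly a b i)) x * poly (fst (opoly a b j)) x \<partial>\<mu>) = (if i = j then 1 else 0)"
proof -
  define P where "P = (\<lambda>i. fst (opoly a b i))"
  define Q where "Q = (\<lambda>i. snd (opoly a b i))"
  define L where "L = (\<lambda>r. \<integral>x. poly r x \<partial>\<mu>)"
  have Ladd: "L (r + s) = L r + L s" for r s
    unfolding L_def by (rule csm_integral_add)
  have Lsm: "L (smult c r) = c * L r" for c r unfolding L_def by (rule csm_integral_smult)
  have rec: "pCons 0 (P i) = smult (a (Suc i)) (P (Suc i)) + smult (b (Suc i)) (P i) + Q i" for i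
    using coeff_nonzero[of "Suc i"] by (simp add: P_def Q_def)
  have "\<forall>j'\<le>j. \<forall>i. L (P i * P j') = (if i = j' then 1 else 0)"
  proof (induction j)
    case 0
    show ?case using csm_integral_opoly by (auto simp: L_def P_def)
  next
    case (Suc j)
    have "L (P i * P (Suc j)) = (if i = Suc j then 1 else 0)" for i
    proof -
      have Qi: "L (Q i * P j) = (if i = Suc j then a i else 0)"
      proof (cases i)
        case 0 thus ?thesis by (simp add: Q_def L_def poly_zero_fun)
      next
        case (Suc i')
        hence "L (Q i * P j) = a i * L (P i' * P j)" by (simp add: Q_def P_def Lsm)
        thus ?thesis using Suc.IH Suc by simp
      qed
      have Qj: "L (P i * Q j) = (if j = Suc i then a j else 0)"
      proof (cases j)
        case 0 thus ?thesis by (simp add: Q_def L_def poly_zero_fun)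
      next
        case (Suc j')
        hence "L (P i * Q j) = a j * L (P i * P j')" by (simp add: Q_def P_def Lsm)
        thus ?thesis using Suc.IH Suc by simp
      qed
      have "pCons 0 (P i) * P j = P i * pCons 0 (P j)" by simp
      hence "L (pCons 0 (P i) * P j) = L (P i * pCons 0 (P j))" by simp
      hence "a (Suc i) * L (P (Suc i) * P j) + b (Suc i) * L (P i * P j) + L (Q i * P j)
           = a (Suc j) * L (P i * P (Suc j)) + b (Suc j) * L (P i * P j) + L (P i * Q j)"
        unfolding rec by (simp add: distrib_left distrib_right Ladd Lsm)
      moreover have "L (P (Suc i) * P j) = (if Suc i = j then 1 else 0)" "L (P i * P j) = (if i = j then 1 else 0)"
        using Suc.IH by auto
      ultimately have eq: "a (Suc i) * (if Suc i = j then 1 else 0) + b (Suc i) * (if i = j then 1 else 0) + (if i = Suc j then a i else 0)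
           = a (Suc j) * L (P i * P (Suc j)) + b (Suc j) * (if i = j then 1 else 0) + (if j = Suc i then a j else 0)"
        unfolding Qi Qj by (simp only:)
      consider "i = j" | "i = Suc j" | "j = Suc i" | "i \<noteq> j" "i \<noteq> Suc j" "j \<noteq> Suc i" by blast
      hence "a (Suc j) * L (P i * P (Suc j)) = a (Suc j) * (if i = Suc j then 1 else 0)"
        using eq by cases (simp_all split del: if_split)
      thus ?thesis using coeff_nonzero[of "Suc j"] by simp
    qed
    thus ?case using Suc by (auto simp: le_Suc_eq)
  qed
  hence "L (P i * P j) = (if i = j then 1 else 0)" by blast
  moreover have "(\<lambda>x. poly (P i) x * poly (P j) x) = poly (P i * P j)" by (simp add: fun_eq_iff)
  ultimately show ?thesis by (simp only: L_def P_def)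
qed

text \<open>Chebyshev's inequality with even moments of growing order; the added 1 keeps the ratio
  of \<open>3 * M\<close> to the radius below one, so that its powers tend to 0.\<close>

lemma csm_support: "AE x in \<mu>. \<bar>x\<bar> \<le> 3 * M + 1"
proof -
  interpret finite_measure \<mu> by (rule csm_finite)
  have M0: "0 < M" using bx l by (force simp: coeff_box_def)
  define R where "R = 3 * M + 1"
  have R: "0 < R" "3 * M < R" using M0 by (auto simp: R_def)
  define A where "A = {x::real. R < \<bar>x\<bar>}"
  have [measurable]: "A \<in> sets \<mu>" unfolding A_def csm_sets by measurable
  have ind: "integrable \<mu> (indicat_real A)" by (auto simp: emeasure_finite less_top[symmetric])
  have "measure \<mu> A \<le> ((3 * M / R)\<^sup>2) ^ k" for k :: nat
  proof -
    have "R ^ (2 * k) * measure \<mu> A = (\<integral>x. R ^ (2 * k) * indicator A x \<partial>\<mu>)" using ind by simp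
    also have "\<dots> \<le> (\<integral>x. x ^ (2 * k) \<partial>\<mu>)"
    proof (rule integral_mono)
      show "integrable \<mu> (\<lambda>x. x ^ (2 * k))" using csm by (simp add: canonical_spectral_measure_def)
      fix x
      show "R ^ (2 * k) * indicator A x \<le> x ^ (2 * k)"
        using R power_mono[of R "\<bar>x\<bar>" "2 * k"] by (auto simp: indicator_def A_def power_even_abs)
    qed (use ind in auto)
    also have "\<dots> \<le> cmod (complex_of_real (\<integral>x. x ^ (2 * k) \<partial>\<mu>))" by simp
    also have "\<dots> \<le> (3 * M) ^ (2 * k)" unfolding csm_moment by (rule jacobi_power_bound[OF bx l])
    finally have "measure \<mu> A \<le> (3 * M) ^ (2 * k) / R ^ (2 * k)" using R by (simp add: field_simps)
    thus ?thesis by (simp add: power_mult power_divide)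
  qed
  moreover have "(\<lambda>k. ((3 * M / R)\<^sup>2) ^ k) \<longlonglongrightarrow> 0"
    by (rule LIMSEQ_realpow_zero) (use R M0 in \<open>auto simp: power_less_one_iff abs_square_less_1\<close>)
  ultimately have "measure \<mu> A \<le> 0" by (intro LIMSEQ_le_const) auto
  hence "measure \<mu> A = 0" using measure_nonneg by (rule antisym)
  hence "emeasure \<mu> A = 0" by (simp add: emeasure_eq_measure)
  hence "A \<in> null_sets \<mu>" by auto
  hence "AE x in \<mu>. x \<notin> A" by (rule AE_not_in)
  thus ?thesis by eventually_elim (auto simp: A_def R_def)
qed

text \<open>Orthonormal polynomials of index below \<open>n\<close> have the right integral by
  \<open>bernstein_szego\<close>, and since their degrees are exact they span all polynomials of
  degree below \<open>n\<close>. The induction removes the leading term.\<close>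

lemma bernstein_szego_poly:
  assumes "degree r < n"
  shows "has_bochner_integral lborel (\<lambda>x. poly r x / ((fst (sol a b x (1, 0) n))\<^sup>2 + (snd (sol a b x (1, 0) n))\<^sup>2))
    (pi * (\<integral>x. poly r x \<partial>\<mu>))"
  using assms
proof (induction "degree r" arbitrary: r rule: less_induct)
  case less
  let ?w = "\<lambda>x. (fst (sol a b x (1, 0) n))\<^sup>2 + (snd (sol a b x (1, 0) n))\<^sup>2"
  define d where "d = degree r"
  define P where "P = fst (opoly a b d)"
  define c where "c = lead_coeff r / lead_coeff P"
  define s where "s = r - smult c P"
  have dP: "degree P = d" unfolding P_def by (rule degree_opoly) (rule coeff_nonzero)
  have lP: "lead_coeff P \<noteq> 0" using coeff_opoly[of a b d] coeff_nonzero dP by (auto simp: P_def)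
  have P: "has_bochner_integral lborel (\<lambda>x. poly P x / ?w x) (pi * (\<integral>x. poly P x \<partial>\<mu>))"
    using bernstein_szego[OF l bx, of d n] less.prems csm_integral_opoly[of d]
    by (auto simp: P_def poly_opoly d_def)
  have rs: "r = s + smult c P" by (simp add: s_def)
  have S: "has_bochner_integral lborel (\<lambda>x. poly s x / ?w x) (pi * (\<integral>x. poly s x \<partial>\<mu>))"
  proof (cases "s = 0")
    case True thus ?thesis by (simp add: poly_zero_fun has_bochner_integral_zero)
  next
    case False
    have "degree s \<le> d" unfolding s_def by (rule degree_diff_le) (use dP in \<open>auto simp: d_def\<close>)
    moreover have "coeff s d = 0" using lP dP by (simp add: s_def c_def d_def)
    ultimately have "degree s < d" using False by (metis le_neq_implies_less leading_coeff_0_iff)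
    thus ?thesis using less.hyps[of s] less.prems by (simp add: d_def)
  qed
  have "has_bochner_integral lborel (\<lambda>x. poly s x / ?w x + c * (poly P x / ?w x)) (pi * (\<integral>x. poly s x \<partial>\<mu>) + c * (pi * (\<integral>x. poly P x \<partial>\<mu>)))"
    by (intro has_bochner_integral_add S has_bochner_integral_mult_right P)
  moreover have "poly s x / ?w x + c * (poly P x / ?w x) = poly r x / ?w x" for x
    by (subst rs) (simp add: add_divide_distrib)
  moreover have "(\<integral>x. poly r x \<partial>\<mu>) = (\<integral>x. poly s x \<partial>\<mu>) + c * (\<integral>x. poly P x \<partial>\<mu>)"
    by (subst rs) (simp only: csm_integral_add csm_integral_smult)
  ultimately show ?case by (simp add: algebra_simps)
qed

end

section \<open>The bands of a periodic matrix lie in its spectrum\<close>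

definition mono_trace :: "(nat \<Rightarrow> real) \<Rightarrow> (nat \<Rightarrow> real) \<Rightarrow> nat \<Rightarrow> 'k::real_normed_field \<Rightarrow> 'k" where
  "mono_trace a b q z = fst (sol a b z (1, 0) q) + snd (sol a b z (0, 1) q)"

lemma transfer_product_nth:
  fixes z :: "'k::real_normed_field"
  defines "\<alpha> \<equiv> \<lambda>a' i. a' (int i)"
  shows "transfer_product n a b z $ 1 $ 1 = fst (sol (\<alpha> a) (\<alpha> b) z (1, 0) n) \<and>
    transfer_product n a b z $ 2 $ 1 = snd (sol (\<alpha> a) (\<alpha> b) z (1, 0) n) \<and>
    transfer_product n a b z $ 1 $ 2 = fst (sol (\<alpha> a) (\<alpha> b) z (0, 1) n) \<and>
    transfer_product n a b z $ 2 $ 2 = snd (sol (\<alpha> a) (\<alpha> b) z (0, 1) n)"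
proof (induction n)
  case 0
  show ?case by (simp add: mat_def)
next
  case (Suc n)
  have "transfer_matrix (a (int (Suc n))) (b (int (Suc n))) z $ 1 $ 1 = (z - of_real (b (int (Suc n)))) / of_real (a (int (Suc n)))"
    "transfer_matrix (a (int (Suc n))) (b (int (Suc n))) z $ 1 $ 2 = - (1 / of_real (a (int (Suc n))))"
    "transfer_matrix (a (int (Suc n))) (b (int (Suc n))) z $ 2 $ 1 = of_real (a (int (Suc n)))"
    "transfer_matrix (a (int (Suc n))) (b (int (Suc n))) z $ 2 $ 2 = 0"
    by (simp_all add: transfer_matrix_def)
  thus ?case using Suc
    by (simp add: matrix_matrix_mult_def sum_2 \<alpha>_def diff_divide_distrib left_diff_distrib del: of_nat_Suc)
qed

lemma discriminant_eq: "discriminant q a b z = mono_trace (\<lambda>i. a (int i)) (\<lambda>i. b (int i)) q z"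
  using transfer_product_nth[of q a b z] by (simp add: discriminant_def mono_trace_def trace_def sum_2)

lemma eigenvector_2x2:
  fixes t11 t12 t21 t22 l :: complex
  assumes "(t11 - l) * (t22 - l) = t12 * t21"
  obtains u1 u2 where "(u1, u2) \<noteq> (0, 0)" "t11 * u1 + t12 * u2 = l * u1" "t21 * u1 + t22 * u2 = l * u2"
proof (cases "t21 = 0")
  case False
  show ?thesis by (rule that[of "l - t22" t21]) (use False assms in \<open>auto simp: algebra_simps\<close>)
next
  case t21: True
  show ?thesis
  proof (cases "t12 = 0")
    case False
    show ?thesis by (rule that[of t12 "l - t11"]) (use False t21 assms in \<open>auto simp: algebra_simps\<close>)
  next
    case True
    hence "l = t11 \<or> l = t22" using assms t21 by auto
    thus ?thesis using that[of 1 0] that[of 0 1] True t21 by auto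
  qed
qed

lemma unimodular_eigenvalue:
  fixes \<tau> :: real
  assumes "\<bar>\<tau>\<bar> \<le> 2"
  obtains l :: complex where "cmod l = 1" "l\<^sup>2 - of_real \<tau> * l + 1 = 0"
proof (rule that)
  define s where "s = sqrt (4 - \<tau>\<^sup>2)"
  have "\<tau>\<^sup>2 \<le> 2\<^sup>2" using assms abs_le_square_iff[of \<tau> 2] by simp
  hence s: "s\<^sup>2 = 4 - \<tau>\<^sup>2" by (simp add: s_def)
  show "cmod (Complex (\<tau> / 2) (s / 2)) = 1"
    using s by (simp add: cmod_def power_divide diff_divide_distrib)
  show "(Complex (\<tau> / 2) (s / 2))\<^sup>2 - of_real \<tau> * Complex (\<tau> / 2) (s / 2) + 1 = 0"
    using s by (simp add: complex_eq_iff power2_eq_square field_simps)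
qed

lemma ell2_norm_finite_support:
  assumes "finite F" "\<And>n. n \<notin> F \<Longrightarrow> u n = 0"
  shows "u \<in> ell2" "ell2_norm u = sqrt (\<Sum>n\<in>F. (cmod (u n))\<^sup>2)"
proof -
  have "(\<lambda>n. (cmod (u n))\<^sup>2) summable_on F" using assms(1) by simp
  thus "u \<in> ell2" unfolding ell2_def
    by (subst (asm) summable_on_cong_neutral[of UNIV F _ "\<lambda>n. (cmod (u n))\<^sup>2"]) (use assms in auto)
  have "(\<Sum>\<^sub>\<infinity>n. (cmod (u n))\<^sup>2) = (\<Sum>\<^sub>\<infinity>n\<in>F. (cmod (u n))\<^sup>2)"
    by (rule infsum_cong_neutral) (use assms in auto)
  thus "ell2_norm u = sqrt (\<Sum>n\<in>F. (cmod (u n))\<^sup>2)" using assms(1) by (simp add: ell2_norm_def)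
qed

text \<open>A Bloch solution with multiplier of modulus one has a modulus that is periodic. Cut off
  to N periods, its norm grows like the square root of N, while the residual sits at the cuts and
  stays bounded. No bounded inverse can exist.\<close>

lemma spectrum_contains_bands:
  assumes q: "1 \<le> q" and per: "periodic_coeffs q a b"
    and bd: "\<And>n. 0 < a n" "\<And>n. a n \<le> M" "\<And>n. \<bar>b n\<bar> \<le> M"
    and disc: "\<bar>discriminant q a b x\<bar> \<le> (2::real)"
  shows "x \<in> jacobi2_spectrum a b"
proof -
  define \<alpha> where "\<alpha> = (\<lambda>i::nat. a (int i))"
  define \<beta> where "\<beta> = (\<lambda>i::nat. b (int i))"
  have nz: "\<alpha> i \<noteq> 0" for i using bd(1)[of "int i"] by (simp add: \<alpha>_def)
  have M0: "0 < M" using bd(1,2)[of 0] by linarith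
  have shift_per: "shift q \<alpha> = \<alpha>" "shift q \<beta> = \<beta>"
    using per by (auto simp: shift_def \<alpha>_def \<beta>_def periodic_coeffs_def fun_eq_iff add.commute)
  let ?z = "complex_of_real x"
  define t11 t12 t21 t22 where t: "t11 = fst (sol \<alpha> \<beta> ?z (1, 0) q)" "t12 = fst (sol \<alpha> \<beta> ?z (0, 1) q)"
    "t21 = snd (sol \<alpha> \<beta> ?z (1, 0) q)" "t22 = snd (sol \<alpha> \<beta> ?z (0, 1) q)"
  define \<tau> where "\<tau> = discriminant q a b x"
  have tau: "complex_of_real \<tau> = t11 + t22"
    by (simp add: \<tau>_def discriminant_eq mono_trace_def t sol_of_real_10 sol_of_real_01 \<alpha>_def[symmetric] \<beta>_def[symmetric])
  have det: "t11 * t22 - t21 * t12 = 1"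
    using sol_wronskian[of q \<alpha> \<beta> ?z "(1,0)" "(0,1)"] nz by (simp add: t)
  obtain l where l: "cmod l = 1" "l\<^sup>2 - of_real \<tau> * l + 1 = 0"
    using unimodular_eigenvalue[of \<tau>] disc by (auto simp: \<tau>_def)
  have "(t11 - l) * (t22 - l) = t12 * t21"
    using det l(2) unfolding tau power2_eq_square by algebra
  then obtain u1 u2 where u: "(u1, u2) \<noteq> (0, 0)" "t11 * u1 + t12 * u2 = l * u1" "t21 * u1 + t22 * u2 = l * u2"
    by (rule eigenvector_2x2)
  have lin: "sol \<alpha> \<beta> ?z (c * v1, c * v2) n = (c * fst (sol \<alpha> \<beta> ?z (v1, v2) n), c * snd (sol \<alpha> \<beta> ?z (v1, v2) n))" for c v1 v2 n
    by (induction n) (auto simp: field_simps nz)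
  have uq: "sol \<alpha> \<beta> ?z (u1, u2) q = (l * u1, l * u2)"
    using sol_linear[of \<alpha> \<beta> ?z "(u1, u2)" q] u by (intro prod_eqI) (auto simp: t algebra_simps)
  define p where "p = (\<lambda>n. fst (sol \<alpha> \<beta> ?z (u1, u2) n))"
  have pq: "p (q + n) = l * p n" for n
    unfolding p_def sol_add[of \<alpha> \<beta> ?z _ q n] uq shift_per lin by simp
  have pkq: "cmod (p (k * q + j)) = cmod (p j)" for k j
  proof (induction k)
    case (Suc k)
    have "p (Suc k * q + j) = l * p (k * q + j)" using pq[of "k * q + j"] by (simp add: algebra_simps)
    thus ?case using Suc l by (simp add: norm_mult)
  qed auto
  define C where "C = Max ((\<lambda>j. cmod (p j)) ` {..<q})"
  have C: "cmod (p n) \<le> C" for n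
  proof -
    have "cmod (p n) = cmod (p (n mod q))" using pkq[of "n div q" "n mod q"] by simp
    also have "\<dots> \<le> C" unfolding C_def using q by (intro Max_ge) auto
    finally show ?thesis .
  qed
  have C0: "0 \<le> C" using C[of 0] norm_ge_zero order_trans by blast
  define c where "c = (\<Sum>j<q. (cmod (p j))\<^sup>2)"
  \<comment> \<open>If \<open>p\<close> vanished on a whole period, the initial vector would vanish:
    \<open>u1\<close> is \<open>p 0\<close>, and the Floquet relation at \<open>q\<close> recovers
    \<open>u2\<close> from the last entry of the period.\<close>
  have c: "0 < c"
  proof (rule ccontr)
    assume "\<not> 0 < c"
    moreover have "0 \<le> c" unfolding c_def by (intro sum_nonneg) auto
    ultimately have "c = 0" by simp
    hence "\<forall>j\<in>{..<q}. (cmod (p j))\<^sup>2 = 0" unfolding c_def by (subst (asm) sum_nonneg_eq_0_iff) auto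
    hence z: "p j = 0" if "j < q" for j using that by simp
    have "u1 = 0" using z[of 0] q by (simp add: p_def)
    obtain q' where q': "q = Suc q'" using q by (cases q) auto
    have "l * u2 = of_real (\<alpha> q) * p q'" using uq by (simp add: q' p_def)
    hence "u2 = 0" using z[of q'] l(1) q' by auto
    thus False using u(1) \<open>u1 = 0\<close> by simp
  qed
  have csum: "(\<Sum>j<N * q. (cmod (p j))\<^sup>2) = real N * c" for N
  proof -
    have "(\<Sum>j<N * q. (cmod (p j))\<^sup>2) = (\<Sum>k<N. \<Sum>j=k*q..<k*q+q. (cmod (p j))\<^sup>2)"
      using sum.nat_group[of "\<lambda>j. (cmod (p j))\<^sup>2" q N] by simp
    also have "\<dots> = (\<Sum>k<N. c)"
    proof (rule sum.cong)
      fix k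
      have "(\<Sum>j=k*q..<k*q+q. (cmod (p j))\<^sup>2) = (\<Sum>j=0..<q. (cmod (p (j + k * q)))\<^sup>2)"
        using sum.shift_bounds_nat_ivl[of "\<lambda>j. (cmod (p j))\<^sup>2" 0 "k * q" q] by (simp add: add.commute)
      also have "\<dots> = c" using pkq[of k] by (simp add: c_def add.commute atLeast0LessThan)
      finally show "(\<Sum>j=k*q..<k*q+q. (cmod (p j))\<^sup>2) = c" .
    qed simp
    finally show ?thesis by simp
  qed
  have rec: "of_real (a (int n + 1)) * p (Suc n) + of_real (b (int n + 1)) * p n +
      (if n = 0 then 0 else of_real (a (int n)) * p (n - 1)) = ?z * p n" if "1 \<le> n" for n
  proof -
    obtain m where m: "n = Suc m" using \<open>1 \<le> n\<close> by (cases n) auto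
    have "of_real (\<alpha> (Suc n)) * p (Suc n) = (?z - of_real (\<beta> (Suc n))) * p n - snd (sol \<alpha> \<beta> ?z (u1, u2) n)"
      using nz[of "Suc n"] by (simp add: p_def)
    moreover have "snd (sol \<alpha> \<beta> ?z (u1, u2) n) = of_real (\<alpha> n) * p m" by (simp add: m p_def)
    ultimately have "of_real (\<alpha> (Suc n)) * p (Suc n) = (?z - of_real (\<beta> (Suc n))) * p n - of_real (\<alpha> n) * p m"
      by (simp only:)
    thus ?thesis by (simp add: m \<alpha>_def \<beta>_def algebra_simps)
  qed
  have "\<not> (\<forall>u\<in>ell2. ell2_norm u \<le> K * ell2_norm (\<lambda>n. jacobi2 a b u n - ?z * u n))" for K
  proof
    assume K: "\<forall>u\<in>ell2. ell2_norm u \<le> K * ell2_norm (\<lambda>n. jacobi2 a b u n - ?z * u n)"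
    define D where "D = (3 * M + \<bar>x\<bar>) * C"
    have D0: "0 \<le> D" using C0 M0 by (simp add: D_def)
    have main: "sqrt (real N * c) \<le> \<bar>K\<bar> * sqrt (4 * D\<^sup>2)" if N: "1 \<le> N" for N
    proof -
      define k where "k = N * q"
      have k1: "1 \<le> k" unfolding k_def using N q by (simp add: Suc_le_eq)
      \<comment> \<open>Site n carries \<open>p (n - 1)\<close>, because the solution starts with
        \<open>p 0\<close> at site 1. The eigenvalue equation then fails at most at the two sites
        around each end, which are the four sites in \<open>g0\<close>.\<close>
      define u where "u = (\<lambda>n::int. if 1 \<le> n \<and> n \<le> int k then p (nat (n - 1)) else 0)"
      define g where "g = (\<lambda>n. jacobi2 a b u n - ?z * u n)"
      have uC: "cmod (u n) \<le> C" for n using C C0 by (auto simp: u_def)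
      have "cmod (g n) \<le> D" for n
      proof -
        have "cmod (g n) \<le> cmod (of_real (a (n - 1)) * u (n - 1)) + cmod (of_real (b n) * u n) + cmod (of_real (a n) * u (n + 1)) + cmod (?z * u n)"
          unfolding g_def jacobi2_def by (intro norm_triangle_le norm_triangle_le_diff add_mono order_refl)
        also have "\<dots> \<le> M * C + M * C + M * C + \<bar>x\<bar> * C"
          unfolding norm_mult norm_of_real using bd(1)[THEN less_imp_le] bd(2,3) uC M0
          by (intro add_mono mult_mono) auto
        finally show ?thesis by (simp add: D_def algebra_simps)
      qed
      moreover have g0: "g n = 0" if "n \<notin> {0, 1, int k, int k + 1}" for n
      proof (cases "1 < n \<and> n < int k")
        case True
        define m where "m = nat (n - 1)"
        have m: "n = int m + 1" "1 \<le> m" using True by (auto simp: m_def)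
        have "u n = p m" "u (n + 1) = p (Suc m)" "u (n - 1) = p (m - 1)"
          using True by (auto simp: u_def m nat_diff_distrib intro!: arg_cong[of _ _ p])
        thus ?thesis using rec[of m] m unfolding g_def jacobi2_def by (simp add: algebra_simps)
      next
        case False
        hence "n < 0 \<or> n > int k + 1" using that by auto
        thus ?thesis by (auto simp: g_def jacobi2_def u_def)
      qed
      ultimately have gn: "ell2_norm g \<le> sqrt (4 * D\<^sup>2)"
      proof -
        have "ell2_norm g = sqrt (\<Sum>n\<in>{0, 1, int k, int k + 1}. (cmod (g n))\<^sup>2)"
          by (rule ell2_norm_finite_support) (use g0 in auto)
        also have "(\<Sum>n\<in>{0, 1, int k, int k + 1}. (cmod (g n))\<^sup>2) \<le> (\<Sum>n\<in>{0, 1, int k, int k + 1}. D\<^sup>2)"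
          using \<open>\<And>n. cmod (g n) \<le> D\<close> by (intro sum_mono power_mono) auto
        also have "\<dots> = real (card {0, 1, int k, int k + 1}) * D\<^sup>2" by simp
        also have "card {0, 1, int k, int k + 1} \<le> 4"
          using card_length[of "[0, 1, int k, int k + 1]"] by simp
        hence "real (card {0, 1, int k, int k + 1}) * D\<^sup>2 \<le> 4 * D\<^sup>2" by (intro mult_right_mono) auto
        finally show ?thesis by simp
      qed
      have us: "u n = 0" if "n \<notin> {1..int k}" for n using that by (auto simp: u_def)
      have u2: "u \<in> ell2" "ell2_norm u = sqrt (\<Sum>n\<in>{1..int k}. (cmod (u n))\<^sup>2)"
        using ell2_norm_finite_support[of "{1..int k}" u, OF _ us] by simp_all
      have "(\<Sum>n\<in>{1..int k}. (cmod (u n))\<^sup>2) = (\<Sum>j<k. (cmod (p j))\<^sup>2)"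
        by (rule sum.reindex_bij_witness[of _ "\<lambda>j. int j + 1" "\<lambda>n. nat (n - 1)"]) (auto simp: u_def)
      hence "sqrt (real N * c) = ell2_norm u" unfolding u2(2) k_def csum by simp
      also have "\<dots> \<le> K * ell2_norm g" using K u2(1) by (simp add: g_def)
      also have "\<dots> \<le> \<bar>K\<bar> * ell2_norm g" by (intro mult_right_mono) (auto simp: ell2_norm_def infsum_nonneg)
      also have "\<dots> \<le> \<bar>K\<bar> * sqrt (4 * D\<^sup>2)" using gn by (intro mult_left_mono) auto
      finally show ?thesis .
    qed
    obtain N :: nat where N: "(K\<^sup>2 * (4 * D\<^sup>2)) / c < real N" using reals_Archimedean2 by blast
    have "0 \<le> (K\<^sup>2 * (4 * D\<^sup>2)) / c" using c by simp
    hence N1: "1 \<le> N" using N by (cases N) auto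
    have "(sqrt (real N * c))\<^sup>2 \<le> (\<bar>K\<bar> * sqrt (4 * D\<^sup>2))\<^sup>2"
      by (intro power_mono main N1) (use c in auto)
    hence "real N * c \<le> K\<^sup>2 * (4 * D\<^sup>2)" using c by (simp add: power_mult_distrib)
    thus False using N c by (simp add: field_simps)
  qed
  thus ?thesis unfolding jacobi2_spectrum_def ell2_spectrum_def by blast
qed

section \<open>Hyperbolic stretches\<close>

abbreviation opvec :: "(nat \<Rightarrow> real) \<Rightarrow> (nat \<Rightarrow> real) \<Rightarrow> 'k::real_normed_field \<Rightarrow> nat \<Rightarrow> 'k \<times> 'k" where
  "opvec a b z \<equiv> sol a b z (1, 0)"

lemma norm_prod_bounds:
  fixes u :: "'a::real_normed_vector \<times> 'b::real_normed_vector"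
  shows "norm (fst u) \<le> norm u" "norm (snd u) \<le> norm u" "norm u \<le> norm (fst u) + norm (snd u)"
  using norm_fst_le[of "fst u" "snd u"] norm_snd_le[of "snd u" "fst u"] norm_Pair_le[of "fst u" "snd u"] by auto

lemma nn_integral_le_of_decomposition:
  assumes dec: "lebesgue_decomposition \<mu> f \<mu>s" and sets: "sets \<mu> = sets borel"
    and g [measurable]: "g \<in> borel_measurable borel"
  shows "(\<integral>\<^sup>+x. ennreal (f x) * g x \<partial>lborel) \<le> (\<integral>\<^sup>+x. g x \<partial>\<mu>)"
proof -
  have f [measurable]: "f \<in> borel_measurable borel" using dec by (simp add: lebesgue_decomposition_def)
  let ?\<nu> = "density lborel (\<lambda>x. ennreal (f x))"
  have "(\<integral>\<^sup>+x. ennreal (f x) * g x \<partial>lborel) = (\<integral>\<^sup>+x. g x \<partial>?\<nu>)"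
    by (subst nn_integral_density) auto
  also have "\<dots> \<le> (\<integral>\<^sup>+x. g x \<partial>\<mu>)"
  proof (rule nn_integral_mono_measure)
    show "sets ?\<nu> = sets \<mu>" by (simp add: sets)
    show "?\<nu> \<le> \<mu>"
    proof (rule le_measure[THEN iffD2])
      show "sets ?\<nu> = sets \<mu>" by (simp add: sets)
      show "\<forall>A\<in>sets ?\<nu>. emeasure ?\<nu> A \<le> emeasure \<mu> A"
      proof
        fix A assume "A \<in> sets ?\<nu>"
        hence A: "A \<in> sets borel" by simp
        hence "emeasure \<mu> A = (\<integral>\<^sup>+x\<in>A. ennreal (f x) \<partial>lborel) + emeasure \<mu>s A"
          using dec by (simp add: lebesgue_decomposition_def)
        thus "emeasure ?\<nu> A \<le> emeasure \<mu> A" using A by (simp add: emeasure_density)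
      qed
    qed
  qed
  finally show ?thesis .
qed

text \<open>Nothing is known about the monotonicity of \<open>y\<close> at the centre. Folding the
  sequence about \<open>L\<close> removes the question: the sum of the two branches has first
  increment at least \<open>h * y L\<close>, and convexity passes this lower bound on to all later
  increments. The resulting linear gain in \<open>L\<close> is enough, as \<open>L\<close> will tend
  to infinity.\<close>

lemma discrete_convexity:
  fixes y :: "nat \<Rightarrow> real"
  assumes y: "\<And>i. 0 \<le> y i" and h: "0 \<le> h"
    and conv: "\<And>i. i < 2 * L - 1 \<Longrightarrow> (2 + h) * y (i + 1) \<le> y i + y (i + 2)"
  shows "(2 + real L * h) * y L \<le> y 0 + y (2 * L)"
proof (cases "L = 0")
  case True
  thus ?thesis by simp
next
  case L: False
  define s where "s = (\<lambda>j. y (L + j) + y (L - j))"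
  have s0: "s 0 = 2 * y L" by (simp add: s_def)
  have s1: "s 1 \<ge> s 0 + h * y L" using conv[of "L - 1"] L by (simp add: s_def algebra_simps)
  have incr: "s (Suc j) - s j \<ge> h * y L" if "j < L" for j
    using that
  proof (induction j)
    case 0
    thus ?case using s1 by simp
  next
    case (Suc j)
    have "L - Suc (Suc j) + 1 = L - Suc j" "L - Suc (Suc j) + 2 = L - j" using Suc.prems by auto
    hence 1: "(2 + h) * y (L - Suc j) \<le> y (L - Suc (Suc j)) + y (L - j)"
      using conv[of "L - Suc (Suc j)"] Suc.prems by auto
    have 2: "(2 + h) * y (L + Suc j) \<le> y (L + j) + y (L + Suc (Suc j))"
      using conv[of "L + j"] Suc.prems by simp
    have "0 \<le> h * y (L - Suc j)" "0 \<le> h * y (L + Suc j)" using h y by auto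
    thus ?case using 1 2 Suc unfolding s_def by (simp add: algebra_simps)
  qed
  have "s j \<ge> (2 + real j * h) * y L" if "j \<le> L" for j
    using that
  proof (induction j)
    case (Suc j)
    thus ?case using incr[of j] by (simp add: algebra_simps)
  qed (simp add: s0)
  from this[of L] show ?thesis by (simp add: s_def mult_2)
qed

section \<open>Coefficients whose variation over a period is square summable\<close>

locale square_summable_variation =
  fixes a b :: "nat \<Rightarrow> real" and q :: nat and l M :: real
  assumes l_pos: "0 < l" and bx: "coeff_box l M a b" and q_pos: "1 \<le> q"
    and sum_a: "(\<lambda>n. \<bar>a (n + q) - a n\<bar>\<^sup>2) summable_on {1..}"
    and sum_b: "(\<lambda>n. \<bar>b (n + q) - b n\<bar>\<^sup>2) summable_on {1..}"
begin

lemma a_nonzero: "1 \<le> i \<Longrightarrow> a i \<noteq> 0" using bx l_pos by (force simp: coeff_box_def)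

lemma shift_nz: "1 \<le> i \<Longrightarrow> shift n a i \<noteq> 0" using a_nonzero[of "n + i"] by (simp add: shift_def)

text \<open>Up to a constant, this bounds the change of the transfer matrix from one period to the
  next, uniformly for bounded spectral parameters.\<close>

definition period_dist :: "nat \<Rightarrow> real" where
  "period_dist n = coeff_dist q (shift n a) (shift n b) (shift (n + q) a) (shift (n + q) b)"

lemma period_dist_nonneg: "0 \<le> period_dist n" unfolding period_dist_def by (rule coeff_dist_nonneg)

lemma variation_summable:
  "summable (\<lambda>n. (a (Suc n + q) - a (Suc n))\<^sup>2)" "summable (\<lambda>n. (b (Suc n + q) - b (Suc n))\<^sup>2)"
proof -
  have inj: "inj_on Suc UNIV" and img: "Suc ` UNIV = {1..}" by (auto simp: image_iff Suc_le_eq gr0_conv_Suc)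
  have "(\<lambda>n. \<bar>a (n + q) - a n\<bar>\<^sup>2) summable_on Suc ` UNIV" "(\<lambda>n. \<bar>b (n + q) - b n\<bar>\<^sup>2) summable_on Suc ` UNIV"
    using sum_a sum_b img by simp_all
  hence "((\<lambda>n. \<bar>a (n + q) - a n\<bar>\<^sup>2) \<circ> Suc) summable_on UNIV" "((\<lambda>n. \<bar>b (n + q) - b n\<bar>\<^sup>2) \<circ> Suc) summable_on UNIV"
    using summable_on_reindex[OF inj] by blast+
  thus "summable (\<lambda>n. (a (Suc n + q) - a (Suc n))\<^sup>2)" "summable (\<lambda>n. (b (Suc n + q) - b (Suc n))\<^sup>2)"
    by (auto dest!: summable_on_UNIV_nonneg_real_iff[THEN iffD1, rotated] simp: o_def)
qed

lemma variation_tendsto: "(\<lambda>n. a (n + q) - a n) \<longlonglongrightarrow> 0" "(\<lambda>n. b (n + q) - b n) \<longlonglongrightarrow> 0"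
proof -
  have "(\<lambda>n. (a (Suc n + q) - a (Suc n))\<^sup>2) \<longlonglongrightarrow> 0" "(\<lambda>n. (b (Suc n + q) - b (Suc n))\<^sup>2) \<longlonglongrightarrow> 0"
    by (intro summable_LIMSEQ_zero variation_summable)+
  from tendsto_real_sqrt[OF this(1)] tendsto_real_sqrt[OF this(2)]
  have "(\<lambda>n. a (Suc n + q) - a (Suc n)) \<longlonglongrightarrow> 0" "(\<lambda>n. b (Suc n + q) - b (Suc n)) \<longlonglongrightarrow> 0"
    by (simp_all add: tendsto_rabs_zero_iff)
  thus "(\<lambda>n. a (n + q) - a n) \<longlonglongrightarrow> 0" "(\<lambda>n. b (n + q) - b n) \<longlonglongrightarrow> 0"
    by (auto intro: LIMSEQ_imp_Suc)
qed

lemma period_dist_tendsto: "period_dist \<longlonglongrightarrow> 0"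
proof -
  have "(\<lambda>n. \<Sum>i=1..q. \<bar>a (n + i + q) - a (n + i)\<bar> + \<bar>b (n + i + q) - b (n + i)\<bar>) \<longlonglongrightarrow> (\<Sum>i=1..q. 0 + 0)"
    by (intro tendsto_sum tendsto_add tendsto_rabs_zero LIMSEQ_ignore_initial_segment[OF variation_tendsto(1)]
      LIMSEQ_ignore_initial_segment[OF variation_tendsto(2)])
  thus ?thesis unfolding period_dist_def[abs_def] coeff_dist_def shift_def by (simp add: abs_minus_commute add_ac)
qed

lemma shift_box: "coeff_box l M (shift n a) (shift n b)" by (rule coeff_box_shift[OF bx])

text \<open>The columns of the matrix \<open>T\<^sub>n\<close>, that is, the images of the two unit
  vectors under the \<open>q\<close> steps following \<open>n\<close>.\<close>

abbreviation "col1 n z \<equiv> sol (shift n a) (shift n b) z (1, 0) q"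
abbreviation "col2 n z \<equiv> sol (shift n a) (shift n b) z (0, 1) q"

definition tr :: "nat \<Rightarrow> 'k::real_normed_field \<Rightarrow> 'k" where
  "tr n z = fst (col1 n z) + snd (col2 n z)"

lemma monodromy_det: "fst (col1 n z) * snd (col2 n z) - snd (col1 n z) * fst (col2 n z) = 1"
  using sol_wronskian[of q "shift n a" "shift n b" z "(1, 0)" "(0, 1)"] shift_nz by simp

lemma opvec_step:
  "fst (opvec a b z (n + q)) = fst (col1 n z) * fst (opvec a b z n) + fst (col2 n z) * snd (opvec a b z n)"
  "snd (opvec a b z (n + q)) = snd (col1 n z) * fst (opvec a b z n) + snd (col2 n z) * snd (opvec a b z n)"
  unfolding sol_add[of a b z _ n q] using sol_linear[of "shift n a" "shift n b" z "opvec a b z n" q]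
  by (auto simp: mult_ac)

lemma monodromy_lipschitz:
  obtains C where "0 \<le> C"
    "\<And>m n z z'. norm (z :: 'k::real_normed_field) \<le> R \<Longrightarrow> norm z' \<le> R \<Longrightarrow>
      (let d = C * (coeff_dist q (shift m a) (shift m b) (shift n a) (shift n b) + norm (z - z')) in
      norm (fst (col1 m z) - fst (col1 n z')) \<le> d \<and> norm (snd (col1 m z) - snd (col1 n z')) \<le> d \<and>
      norm (fst (col2 m z) - fst (col2 n z')) \<le> d \<and> norm (snd (col2 m z) - snd (col2 n z')) \<le> d)"
proof -
  from sol_lipschitz[OF l_pos, where 'k = 'k, of M R "(1, 0)" q] obtain C1 where C1: "C1 \<ge> 0"
    "\<And>a b a' b' (z::'k) z'. coeff_box l M a b \<Longrightarrow> coeff_box l M a' b' \<Longrightarrow> norm z \<le> R \<Longrightarrow> norm z' \<le> R \<Longrightarrow>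
    norm (fst (sol a b z (1, 0) q) - fst (sol a' b' z' (1, 0) q)) \<le> C1 * (coeff_dist q a b a' b' + norm (z - z')) \<and>
    norm (snd (sol a b z (1, 0) q) - snd (sol a' b' z' (1, 0) q)) \<le> C1 * (coeff_dist q a b a' b' + norm (z - z'))" by meson
  from sol_lipschitz[OF l_pos, where 'k = 'k, of M R "(0, 1)" q] obtain C2 where C2: "C2 \<ge> 0"
    "\<And>a b a' b' (z::'k) z'. coeff_box l M a b \<Longrightarrow> coeff_box l M a' b' \<Longrightarrow> norm z \<le> R \<Longrightarrow> norm z' \<le> R \<Longrightarrow>
    norm (fst (sol a b z (0, 1) q) - fst (sol a' b' z' (0, 1) q)) \<le> C2 * (coeff_dist q a b a' b' + norm (z - z')) \<and>
    norm (snd (sol a b z (0, 1) q) - snd (sol a' b' z' (0, 1) q)) \<le> C2 * (coeff_dist q a b a' b' + norm (z - z'))" by meson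
  show ?thesis
  proof (rule that[of "max C1 C2"])
    fix m n and z z' :: 'k
    assume z: "norm z \<le> R" "norm z' \<le> R"
    let ?d = "coeff_dist q (shift m a) (shift m b) (shift n a) (shift n b) + norm (z - z')"
    have d: "0 \<le> ?d" by (intro add_nonneg_nonneg coeff_dist_nonneg norm_ge_zero)
    have "C1 * ?d \<le> max C1 C2 * ?d" "C2 * ?d \<le> max C1 C2 * ?d" using d by (intro mult_right_mono; simp)+
    thus "let d = max C1 C2 * ?d in
      norm (fst (col1 m z) - fst (col1 n z')) \<le> d \<and> norm (snd (col1 m z) - snd (col1 n z')) \<le> d \<and>
      norm (fst (col2 m z) - fst (col2 n z')) \<le> d \<and> norm (snd (col2 m z) - snd (col2 n z')) \<le> d"
      using C1(2)[OF shift_box[of m] shift_box[of n] z] C2(2)[OF shift_box[of m] shift_box[of n] z]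
      unfolding Let_def by linarith
  qed (use C1(1) in auto)
qed

lemma tr_lipschitz:
  obtains C where "0 \<le> C"
    "\<And>n x y :: real. \<bar>x\<bar> \<le> R \<Longrightarrow> \<bar>y\<bar> \<le> R \<Longrightarrow> \<bar>tr n x - tr n y\<bar> \<le> C * \<bar>x - y\<bar>"
proof -
  obtain C where C: "0 \<le> C"
    "\<And>m n z z'. norm (z :: real) \<le> R \<Longrightarrow> norm z' \<le> R \<Longrightarrow>
      (let d = C * (coeff_dist q (shift m a) (shift m b) (shift n a) (shift n b) + norm (z - z')) in
      norm (fst (col1 m z) - fst (col1 n z')) \<le> d \<and> norm (snd (col1 m z) - snd (col1 n z')) \<le> d \<and>
      norm (fst (col2 m z) - fst (col2 n z')) \<le> d \<and> norm (snd (col2 m z) - snd (col2 n z')) \<le> d)"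
    using monodromy_lipschitz[where 'k = real and R = R] by blast
  show ?thesis
  proof (rule that[of "2 * C"])
    fix n and x y :: real assume "\<bar>x\<bar> \<le> R" "\<bar>y\<bar> \<le> R"
    hence "\<bar>fst (col1 n x) - fst (col1 n y)\<bar> \<le> C * \<bar>x - y\<bar>" "\<bar>snd (col2 n x) - snd (col2 n y)\<bar> \<le> C * \<bar>x - y\<bar>"
      using C(2)[of x y n n] unfolding Let_def by simp_all
    thus "\<bar>tr n x - tr n y\<bar> \<le> 2 * C * \<bar>x - y\<bar>" unfolding tr_def by linarith
  qed (use C in auto)
qed

text \<open>A unimodular \<open>T\<close> satisfies \<open>T + inverse T = tr T\<close>, so three consecutive vectors along a
  period almost satisfy a scalar three-term recurrence.\<close>

lemma three_term:
  obtains C where "0 \<le> C"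
    "\<And>n x :: real. \<bar>x\<bar> \<le> R \<Longrightarrow> \<bar>tr (n + q) x - tr n x\<bar> \<le> C * period_dist n"
    "\<And>n x :: real. \<bar>x\<bar> \<le> R \<Longrightarrow> (\<bar>tr (n + q) x\<bar> - C * period_dist n) * norm (opvec a b x (n + q)) \<le>
      norm (opvec a b x n) + norm (opvec a b x (n + 2 * q))"
proof -
  obtain C where C: "0 \<le> C"
    "\<And>m n z z'. norm (z :: real) \<le> R \<Longrightarrow> norm z' \<le> R \<Longrightarrow>
      (let d = C * (coeff_dist q (shift m a) (shift m b) (shift n a) (shift n b) + norm (z - z')) in
      norm (fst (col1 m z) - fst (col1 n z')) \<le> d \<and> norm (snd (col1 m z) - snd (col1 n z')) \<le> d \<and>
      norm (fst (col2 m z) - fst (col2 n z')) \<le> d \<and> norm (snd (col2 m z) - snd (col2 n z')) \<le> d)"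
    using monodromy_lipschitz[where 'k = real and R = R] by blast
  have D: "\<bar>fst (col1 n x) - fst (col1 (n + q) x)\<bar> \<le> C * period_dist n \<and> \<bar>snd (col1 n x) - snd (col1 (n + q) x)\<bar> \<le> C * period_dist n \<and>
      \<bar>fst (col2 n x) - fst (col2 (n + q) x)\<bar> \<le> C * period_dist n \<and> \<bar>snd (col2 n x) - snd (col2 (n + q) x)\<bar> \<le> C * period_dist n"
    if "\<bar>x\<bar> \<le> R" for n x
    using C(2)[of x x n "n + q"] that unfolding Let_def period_dist_def by simp
  show ?thesis
  proof (rule that[of "4 * C"])
    fix n and x :: real assume x: "\<bar>x\<bar> \<le> R"
    have Cd: "0 \<le> C * period_dist n" using C(1) period_dist_nonneg by simp
    show "\<bar>tr (n + q) x - tr n x\<bar> \<le> 4 * C * period_dist n"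
      using D[OF x, of n] Cd unfolding tr_def by linarith
    define P where "P = fst (opvec a b x (n + q))"
    define Q where "Q = snd (opvec a b x (n + q))"
    define t11 t12 t21 t22 where t: "t11 = fst (col1 n x)" "t12 = fst (col2 n x)" "t21 = snd (col1 n x)" "t22 = snd (col2 n x)"
    define s11 s12 s21 s22 where s: "s11 = fst (col1 (n + q) x)" "s12 = fst (col2 (n + q) x)" "s21 = snd (col1 (n + q) x)" "s22 = snd (col2 (n + q) x)"
    have det: "t11 * t22 - t21 * t12 = 1" unfolding t by (rule monodromy_det)
    define p0 q0 where pq: "p0 = fst (opvec a b x n)" "q0 = snd (opvec a b x n)"
    have PQ: "P = t11 * p0 + t12 * q0" "Q = t21 * p0 + t22 * q0"
      unfolding P_def Q_def t pq by (rule opvec_step)+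
    have "t22 * P - t12 * Q = (t11 * t22 - t21 * t12) * p0" "t11 * Q - t21 * P = (t11 * t22 - t21 * t12) * q0"
      unfolding PQ by (simp_all add: algebra_simps)
    \<comment> \<open>The inverse of a unimodular matrix is its adjugate. Going back therefore uses
      entries of \<open>T\<^sub>n\<close>, going forward entries of the next period matrix; their
      mismatch is collected in \<open>e\<close> below.\<close>
    hence inv: "p0 = t22 * P - t12 * Q" "q0 = t11 * Q - t21 * P" unfolding det by simp_all
    have v2: "opvec a b x (n + 2 * q) = (s11 * P + s12 * Q, s21 * P + s22 * Q)"
      using opvec_step[of x "n + q"] by (intro prod_eqI) (simp_all add: s P_def Q_def mult_2 add.assoc)
    define e where "e = ((t22 - s22) * P + (s12 - t12) * Q, (s21 - t21) * P + (t11 - s11) * Q)"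
    have vn: "opvec a b x n = (p0, q0)" unfolding pq by simp
    have vnq: "opvec a b x (n + q) = (P, Q)" unfolding P_def Q_def by simp
    have "opvec a b x n + opvec a b x (n + 2 * q) = tr (n + q) x *\<^sub>R opvec a b x (n + q) + e"
      unfolding v2 vn vnq inv e_def tr_def s[symmetric] by (simp add: algebra_simps)
    hence "norm (tr (n + q) x *\<^sub>R opvec a b x (n + q)) \<le> norm (opvec a b x n) + norm (opvec a b x (n + 2 * q)) + norm e"
      using norm_triangle_ineq4[of "opvec a b x n + opvec a b x (n + 2 * q)" e]
        norm_triangle_ineq[of "opvec a b x n" "opvec a b x (n + 2 * q)"] by (simp del: norm_scaleR)
    moreover have "norm e \<le> 4 * C * period_dist n * norm (opvec a b x (n + q))"
    proof -
      have pb: "\<bar>P\<bar> \<le> norm (opvec a b x (n + q))" "\<bar>Q\<bar> \<le> norm (opvec a b x (n + q))"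
        using norm_prod_bounds(1,2)[of "opvec a b x (n + q)"] by (auto simp: P_def Q_def)
      have m: "\<bar>c * w\<bar> \<le> C * period_dist n * norm (opvec a b x (n + q))"
        if "\<bar>c\<bar> \<le> C * period_dist n" "\<bar>w\<bar> \<le> norm (opvec a b x (n + q))" for c w
        unfolding abs_mult using that Cd by (intro mult_mono) auto
      have "norm e \<le> \<bar>(t22 - s22) * P + (s12 - t12) * Q\<bar> + \<bar>(s21 - t21) * P + (t11 - s11) * Q\<bar>"
        using norm_prod_bounds(3)[of e] by (simp add: e_def)
      also have "\<dots> \<le> \<bar>(t22 - s22) * P\<bar> + \<bar>(s12 - t12) * Q\<bar> + (\<bar>(s21 - t21) * P\<bar> + \<bar>(t11 - s11) * Q\<bar>)"
        by (intro add_mono abs_triangle_ineq)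
      also have "\<dots> \<le> 4 * (C * period_dist n * norm (opvec a b x (n + q)))"
        using m[of "t22 - s22" P] m[of "s12 - t12" Q] m[of "s21 - t21" P] m[of "t11 - s11" Q] pb D[OF x, of n]
        unfolding s t by (auto simp: abs_minus_commute)
      finally show ?thesis by simp
    qed
    ultimately show "(\<bar>tr (n + q) x\<bar> - 4 * C * period_dist n) * norm (opvec a b x (n + q)) \<le>
      norm (opvec a b x n) + norm (opvec a b x (n + 2 * q))"
      by (simp add: algebra_simps)
  qed (use C in auto)
qed

end

lemma norm_prod_sq: "(norm (u :: real \<times> real))\<^sup>2 = (fst u)\<^sup>2 + (snd u)\<^sup>2"
  by (simp add: norm_prod_def)

context square_summable_variation
begin

lemma opvec_norm_pos: "0 < (norm (opvec a b (x::real) n))\<^sup>2"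
  unfolding norm_prod_sq by (rule sol_norm_pos) (rule a_nonzero)

lemma opvec_norm_measurable [measurable]:
  "(\<lambda>x::real. (norm (opvec a b x n))\<^sup>2) \<in> borel_measurable borel"
  unfolding norm_prod_sq
  by (intro borel_measurable_continuous_onI continuous_intros a_nonzero)

lemma nn_integral_inverse_norm:
  assumes "1 \<le> n"
  shows "(\<integral>\<^sup>+x. ennreal (1 / (norm (opvec a b (x::real) n))\<^sup>2) \<partial>lborel) = ennreal pi"
proof -
  have "has_bochner_integral lborel (\<lambda>x::real. 1 / (norm (opvec a b x n))\<^sup>2) pi"
    using bernstein_szego[OF l_pos bx, of 0 n] assms by (simp add: norm_prod_sq)
  thus ?thesis
    by (subst nn_integral_eq_integral) (auto simp: has_bochner_integral_iff)
qed

lemma nn_integral_opvec_norm: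
  assumes csm: "canonical_spectral_measure a b \<mu>"
  shows "(\<integral>\<^sup>+x. ennreal ((norm (opvec a b x n))\<^sup>2) \<partial>\<mu>) \<le> ennreal (1 + M\<^sup>2)"
proof -
  let ?P = "\<lambda>n. fst (opoly a b n)"
  have P2: "integrable \<mu> (\<lambda>x. (poly (?P k) x)\<^sup>2)" "(\<integral>x. (poly (?P k) x)\<^sup>2 \<partial>\<mu>) = 1" for k
  proof -
    have "poly (?P k * ?P k) = (\<lambda>x. (poly (?P k) x)\<^sup>2)" by (simp add: fun_eq_iff power2_eq_square)
    thus "integrable \<mu> (\<lambda>x. (poly (?P k) x)\<^sup>2)" using csm_integrable_poly[OF l_pos bx csm, of "?P k * ?P k"] by simp
    show "(\<integral>x. (poly (?P k) x)\<^sup>2 \<partial>\<mu>) = 1" using csm_orthonormal[OF l_pos bx csm, of k k] by (simp add: power2_eq_square)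
  qed
  \<comment> \<open>At \<open>n = 0\<close> the second entry of the vector is 0, whatever
    \<open>a 0\<close> is, and \<open>n - 1\<close> is again 0. The zero coefficient makes
    \<open>eq\<close> hold there too.\<close>
  define c where "c = (if n = 0 then 0 else (a n)\<^sup>2)"
  have aM: "0 \<le> a n \<and> a n \<le> M" if "n \<noteq> 0"
  proof -
    have "l \<le> a n" "a n \<le> M" using that bx by (auto simp: coeff_box_def)
    thus ?thesis using l_pos by simp
  qed
  have c: "0 \<le> c" "c \<le> M\<^sup>2" unfolding c_def using aM by (auto intro: power_mono)
  have eq: "(norm (opvec a b x n))\<^sup>2 = (poly (?P n) x)\<^sup>2 + c * (poly (?P (n - 1)) x)\<^sup>2" for x
    by (cases n) (auto simp: norm_prod_sq poly_opoly c_def power_mult_distrib simp del: opoly.simps)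
  have "(\<integral>\<^sup>+x. ennreal ((norm (opvec a b x n))\<^sup>2) \<partial>\<mu>) = ennreal (\<integral>x. (poly (?P n) x)\<^sup>2 + c * (poly (?P (n - 1)) x)\<^sup>2 \<partial>\<mu>)"
    unfolding eq using P2(1) c by (intro nn_integral_eq_integral Bochner_Integration.integrable_add integrable_mult_right) auto
  also have "(\<integral>x. (poly (?P n) x)\<^sup>2 + c * (poly (?P (n - 1)) x)\<^sup>2 \<partial>\<mu>) = 1 + c"
    using P2 by (subst Bochner_Integration.integral_add) auto
  finally show ?thesis using c by (simp add: ennreal_leI)
qed

text \<open>On \<open>{f > \<epsilon>}\<close> the squared norm \<open>W n\<close> is much smaller than its neighbours, whose
  \<open>\<mu>\<close>-integrals are bounded, while the integral of \<open>1 / W n\<close> is \<open>\<pi>\<close>. Both are compared by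
  \<open>2 \<le> s W n + 1 / (s W n)\<close> with \<open>s = 2 + L h\<close>.\<close>

lemma density_zero_of_hyperbolic:
  assumes csm: "canonical_spectral_measure a b \<mu>" and dec: "lebesgue_decomposition \<mu> f \<mu>s"
    and \<eta>: "0 < \<eta>" and hyp: "\<And>N. \<exists>n\<ge>N. \<forall>x\<in>{\<alpha>..\<beta>}. 2 + \<eta> \<le> \<bar>tr n x\<bar>"
  shows "AE x in lborel. x \<in> {\<alpha>..\<beta>} \<longrightarrow> \<not> 0 < f x"
proof -
  define R where "R = max \<bar>\<alpha>\<bar> \<bar>\<beta>\<bar>"
  define h where "h = \<eta> / 2"
  have h: "0 < h" using \<eta> by (simp add: h_def)
  have f [measurable]: "f \<in> borel_measurable borel" using dec by (simp add: lebesgue_decomposition_def)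
  have f0: "0 \<le> f x" for x using dec by (simp add: lebesgue_decomposition_def)
  define W where "W = (\<lambda>n (x::real). (norm (opvec a b x n))\<^sup>2)"
  have W [measurable]: "W n \<in> borel_measurable borel" for n unfolding W_def by measurable
  have W0: "0 < W n x" for n x unfolding W_def by (rule opvec_norm_pos)
  obtain C where C: "0 \<le> C"
    "\<And>n x :: real. \<bar>x\<bar> \<le> R \<Longrightarrow> \<bar>tr (n + q) x - tr n x\<bar> \<le> C * period_dist n"
    "\<And>n x :: real. \<bar>x\<bar> \<le> R \<Longrightarrow> (\<bar>tr (n + q) x\<bar> - C * period_dist n) * norm (opvec a b x (n + q)) \<le>
      norm (opvec a b x n) + norm (opvec a b x (n + 2 * q))" using three_term[where R = R] by blast
  have key: "\<exists>n\<ge>1. \<exists>m m'. \<forall>x\<in>{\<alpha>..\<beta>}. (2 + real L * h)\<^sup>2 * W n x \<le> 2 * (W m x + W m' x)" for L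
  proof -
    define c where "c = real L + 1"
    have c: "0 < c" by (simp add: c_def)
    \<comment> \<open>The trace may drift by \<open>e\<close> per period over at most
      \<open>L\<close> periods on either side of \<open>n\<close>, and the error in
      \<open>three_term\<close> costs another \<open>e\<close>. In total this is
      \<open>(L + 1) * e = \<eta> / 2\<close>, which leaves the convexity constant
      \<open>h\<close>.\<close>
    define e where "e = \<eta> / (2 * c)"
    have e: "0 < e" using \<eta> c by (simp add: e_def)
    have "(\<lambda>n. C * period_dist n) \<longlonglongrightarrow> C * 0" by (intro tendsto_intros period_dist_tendsto)
    hence "\<forall>\<^sub>F n in sequentially. C * period_dist n < e" using e by (auto dest: order_tendstoD(2))
    then obtain N1 where N1: "\<And>n. n \<ge> N1 \<Longrightarrow> C * period_dist n < e" by (auto simp: eventually_sequentially)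
    obtain n where n: "n \<ge> N1 + L * q + 1" "\<And>x. x \<in> {\<alpha>..\<beta>} \<Longrightarrow> 2 + \<eta> \<le> \<bar>tr n x\<bar>" using hyp by blast
    define m where "m = n - L * q"
    have m: "m \<ge> N1" "n = m + L * q" using n(1) by (auto simp: m_def)
    have "(2 + real L * h)\<^sup>2 * W n x \<le> 2 * (W m x + W (m + 2 * L * q) x)" if x: "x \<in> {\<alpha>..\<beta>}" for x
    proof -
      have xR: "\<bar>x\<bar> \<le> R" using x by (auto simp: R_def)
      have tel: "\<bar>tr (m + (j + k) * q) x - tr (m + j * q) x\<bar> \<le> real k * e" for j k
      proof (induction k)
        case (Suc k)
        have "\<bar>tr (m + (j + k) * q + q) x - tr (m + (j + k) * q) x\<bar> \<le> C * period_dist (m + (j + k) * q)" by (rule C(2)[OF xR])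
        also have "\<dots> \<le> e" using N1[of "m + (j + k) * q"] m(1) by simp
        finally have "\<bar>tr (m + (j + Suc k) * q) x - tr (m + (j + k) * q) x\<bar> \<le> e" by (simp add: algebra_simps)
        moreover have "real (Suc k) * e = real k * e + e" by (simp add: algebra_simps)
        ultimately show ?case using Suc by linarith
      qed simp
      have tn: "2 + \<eta> - real L * e \<le> \<bar>tr (m + i * q) x\<bar>" if i: "i \<le> 2 * L" for i
      proof (cases "i \<le> L")
        case True
        have "\<bar>tr n x - tr (m + i * q) x\<bar> \<le> real (L - i) * e" using tel[of i "L - i"] True m(2) by simp
        also have "\<dots> \<le> real L * e" using e by (intro mult_right_mono) auto
        finally show ?thesis using n(2)[OF x] by linarith
      next
        case False
        have "\<bar>tr (m + i * q) x - tr n x\<bar> \<le> real (i - L) * e" using tel[of L "i - L"] False m(2) by simp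
        also have "\<dots> \<le> real L * e" using e i by (intro mult_right_mono) auto
        finally show ?thesis using n(2)[OF x] by linarith
      qed
      have "c * e = h" using c by (simp add: e_def h_def)
      hence Le: "real L * e + e = h" by (simp add: c_def distrib_right)
      define y where "y = (\<lambda>i. norm (opvec a b x (m + i * q)))"
      have "(2 + real L * h) * y L \<le> y 0 + y (2 * L)"
      proof (rule discrete_convexity)
        fix i assume i: "i < 2 * L - 1"
        have d: "C * period_dist (m + i * q) < e" using N1[of "m + i * q"] m(1) by simp
        have "2 + h \<le> \<bar>tr (m + (i + 1) * q) x\<bar> - C * period_dist (m + i * q)"
          using tn[of "i + 1"] i d Le h_def by linarith
        hence "(2 + h) * y (i + 1) \<le> (\<bar>tr (m + (i + 1) * q) x\<bar> - C * period_dist (m + i * q)) * y (i + 1)"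
          by (intro mult_right_mono) (auto simp: y_def)
        also have "\<dots> \<le> y i + y (i + 2)"
        proof -
          have "m + i * q + q = m + (i + 1) * q" "m + i * q + 2 * q = m + (i + 2) * q" by (simp_all add: algebra_simps)
          thus ?thesis using C(3)[OF xR, of "m + i * q"] unfolding y_def by (simp only:)
        qed
        finally show "(2 + h) * y (i + 1) \<le> y i + y (i + 2)" .
      qed (use h in \<open>auto simp: y_def\<close>)
      hence "((2 + real L * h) * y L)\<^sup>2 \<le> (y 0 + y (2 * L))\<^sup>2"
        using h by (intro power_mono) (auto simp: y_def)
      also have "\<dots> \<le> 2 * ((y 0)\<^sup>2 + (y (2 * L))\<^sup>2)"
        using zero_le_power2[of "y 0 - y (2 * L)"] by (simp add: power2_eq_square algebra_simps)
      finally show ?thesis by (simp add: y_def W_def m(2) power_mult_distrib mult.assoc)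
    qed
    moreover have "n \<ge> 1" using n(1) by simp
    ultimately show ?thesis by (intro exI[of _ n] exI[of _ m] exI[of _ "m + 2 * L * q"] conjI ballI)
  qed
  have null: "emeasure lborel {x \<in> {\<alpha>..\<beta>}. \<epsilon> < f x} = 0" if \<epsilon>: "0 < \<epsilon>" for \<epsilon>
  proof -
    define F where "F = {x \<in> {\<alpha>..\<beta>}. \<epsilon> < f x}"
    have F [measurable]: "F \<in> sets borel" unfolding F_def by measurable
    define K where "K = 4 * (1 + M\<^sup>2) / \<epsilon> + pi"
    have bound: "2 * emeasure lborel F \<le> ennreal (K / (2 + real L * h))" for L
    proof -
      define s where "s = 2 + real L * h"
      have s: "0 < s" using h by (simp add: s_def add_pos_nonneg)
      obtain n m m' where n: "n \<ge> 1" and nm: "\<And>x. x \<in> {\<alpha>..\<beta>} \<Longrightarrow> s\<^sup>2 * W n x \<le> 2 * (W m x + W m' x)"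
        using key[of L] unfolding s_def by blast
      define c where "c = 2 / (\<epsilon> * s)"
      have c: "0 < c" using \<epsilon> s by (simp add: c_def)
      have pt: "ennreal 2 * indicator F x \<le> ennreal c * (ennreal (f x) * (ennreal (W m x) + ennreal (W m' x))) + ennreal (1 / s) * ennreal (1 / W n x)" for x
      proof (cases "x \<in> F")
        case True
        hence x: "x \<in> {\<alpha>..\<beta>}" "\<epsilon> \<le> f x" by (auto simp: F_def)
        have "0 \<le> (s * W n x - 1)\<^sup>2 / (s * W n x)" using s W0[of n x] by simp
        also have "\<dots> = s * W n x + (1 / s) * (1 / W n x) - 2"
          using s W0[of n x] by (simp add: power2_eq_square field_simps)
        finally have "2 \<le> s * W n x + (1 / s) * (1 / W n x)" by simp
        also have "s * W n x \<le> c * (f x * (W m x + W m' x))"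
        proof -
          have "s * W n x = (s\<^sup>2 * W n x) / s" using s by (simp add: power2_eq_square)
          also have "\<dots> \<le> 2 * (W m x + W m' x) / s" using nm[OF x(1)] s by (intro divide_right_mono) auto
          also have "\<dots> = c * (\<epsilon> * (W m x + W m' x))" using \<epsilon> by (simp add: c_def)
          also have "\<dots> \<le> c * (f x * (W m x + W m' x))"
            using c x(2) W0[of m x] W0[of m' x] by (intro mult_left_mono mult_right_mono) auto
          finally show ?thesis .
        qed
        finally have "ennreal 2 \<le> ennreal (c * (f x * (W m x + W m' x)) + (1 / s) * (1 / W n x))"
          by (intro ennreal_leI) simp
        also have "\<dots> = ennreal c * (ennreal (f x) * (ennreal (W m x) + ennreal (W m' x))) + ennreal (1 / s) * ennreal (1 / W n x)"
          using c s f0[of x] W0[of m x] W0[of m' x] W0[of n x]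
          by (simp add: ennreal_plus[symmetric] ennreal_mult[symmetric] less_imp_le del: ennreal_plus)
        finally show ?thesis using True by simp
      qed auto
      have "2 * emeasure lborel F = (\<integral>\<^sup>+x. ennreal 2 * indicator F x \<partial>lborel)"
        by (subst nn_integral_cmult_indicator) auto
      also have "\<dots> \<le> (\<integral>\<^sup>+x. ennreal c * (ennreal (f x) * (ennreal (W m x) + ennreal (W m' x))) + ennreal (1 / s) * ennreal (1 / W n x) \<partial>lborel)"
        by (intro nn_integral_mono pt)
      also have "\<dots> = ennreal c * (\<integral>\<^sup>+x. ennreal (f x) * (ennreal (W m x) + ennreal (W m' x)) \<partial>lborel) + ennreal (1 / s) * (\<integral>\<^sup>+x. ennreal (1 / W n x) \<partial>lborel)"
        by (subst nn_integral_add) (auto simp: nn_integral_cmult)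
      also have "(\<integral>\<^sup>+x. ennreal (1 / W n x) \<partial>lborel) = ennreal pi" unfolding W_def by (rule nn_integral_inverse_norm[OF n])
      also have "(\<integral>\<^sup>+x. ennreal (f x) * (ennreal (W m x) + ennreal (W m' x)) \<partial>lborel) \<le> (\<integral>\<^sup>+x. ennreal (W m x) + ennreal (W m' x) \<partial>\<mu>)"
        by (rule nn_integral_le_of_decomposition[OF dec csm_sets[OF l_pos bx csm]]) auto
      also have "\<dots> = (\<integral>\<^sup>+x. ennreal (W m x) \<partial>\<mu>) + (\<integral>\<^sup>+x. ennreal (W m' x) \<partial>\<mu>)"
        using W csm_sets[OF l_pos bx csm] by (intro nn_integral_add) (auto cong: measurable_cong_sets)
      also have "\<dots> \<le> ennreal (1 + M\<^sup>2) + ennreal (1 + M\<^sup>2)"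
        unfolding W_def by (intro add_mono nn_integral_opvec_norm[OF csm])
      also have "ennreal c * (ennreal (1 + M\<^sup>2) + ennreal (1 + M\<^sup>2)) + ennreal (1 / s) * ennreal pi = ennreal (c * (2 * (1 + M\<^sup>2)) + (1 / s) * pi)"
        using c s by (simp add: ennreal_plus[symmetric] ennreal_mult[symmetric] del: ennreal_plus)
      also have "c * (2 * (1 + M\<^sup>2)) + (1 / s) * pi = K / s" using s \<epsilon> by (simp add: c_def K_def field_simps)
      finally show ?thesis unfolding s_def by (simp add: mult_left_mono add_right_mono)
    qed
    have "filterlim (\<lambda>L. 2 + real L * h) at_top sequentially"
      using h by (intro filterlim_tendsto_add_at_top[OF tendsto_const] filterlim_at_top_mult_tendsto_pos[OF tendsto_const] filterlim_real_sequentially) auto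
    hence "(\<lambda>L. K / (2 + real L * h)) \<longlonglongrightarrow> 0" by (intro tendsto_divide_0[OF tendsto_const] filterlim_at_top_imp_at_infinity)
    hence "(\<lambda>L. ennreal (K / (2 + real L * h))) \<longlonglongrightarrow> ennreal 0" by (intro tendsto_ennrealI)
    hence "2 * emeasure lborel F \<le> ennreal 0" using bound by (intro LIMSEQ_le_const) auto
    thus ?thesis by (simp add: F_def)
  qed
  have "AE x in lborel. \<forall>k::nat. \<not> (x \<in> {\<alpha>..\<beta>} \<and> 1 / real (Suc k) < f x)"
    unfolding AE_all_countable
  proof
    fix k
    have "{x \<in> {\<alpha>..\<beta>}. 1 / real (Suc k) < f x} \<in> null_sets lborel"
      using null[of "1 / real (Suc k)"] by (intro null_setsI) auto
    from AE_not_in[OF this] show "AE x in lborel. \<not> (x \<in> {\<alpha>..\<beta>} \<and> 1 / real (Suc k) < f x)" by simp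
  qed
  thus ?thesis
  proof eventually_elim
    case (elim x)
    thus ?case using reals_Archimedean[of "f x"] by (auto simp: inverse_eq_divide)
  qed
qed

end

section \<open>Elliptic stretches\<close>

text \<open>Squaring the recursion and telescoping bounds the sum of
  \<open>s * (r k)\<^sup>2\<close> by a multiple of \<open>1 / s\<close>; Young's inequality with
  weight \<open>s\<close> then treats the mixed sum. In the application \<open>s\<close> is
  proportional to \<open>Im z\<close>, and a single power of \<open>1 / s\<close> is what a weight
  with simple zeros can absorb.\<close>

lemma weighted_sum_bound:
  fixes r e :: "nat \<Rightarrow> real"
  assumes r: "\<And>k. 0 \<le> r k" "r 0 \<le> C" and e: "\<And>n. (\<Sum>k<n. (e k)\<^sup>2) \<le> S"
    and s: "0 < s" "s \<le> 1" and step: "\<And>k. r (Suc k) \<le> (1 - s) * r k + A * e k"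
  shows "(\<Sum>k<n. e k * r k) \<le> (S + C\<^sup>2 + A\<^sup>2 * S) / s"
proof -
  have S: "0 \<le> S" using e[of 0] by simp
  have 1: "s * (r k)\<^sup>2 \<le> (r k)\<^sup>2 - (r (Suc k))\<^sup>2 + A\<^sup>2 * (e k)\<^sup>2 / s" for k
  proof -
    define u where "u = A * e k"
    have "(r (Suc k))\<^sup>2 \<le> ((1 - s) * r k + u)\<^sup>2"
      using step[of k] r(1)[of "Suc k"] unfolding u_def by (intro power_mono) auto
    \<comment> \<open>Convexity of the square at the points \<open>r k\<close> and
      \<open>u / s\<close> with weights \<open>1 - s\<close> and \<open>s\<close>; the subtracted
      term is the exact defect.\<close>
    also have "\<dots> = (1 - s) * (r k)\<^sup>2 + u\<^sup>2 / s - (1 - s) * ((s * r k - u)\<^sup>2 / s)"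
      using s by (simp add: power2_eq_square field_simps)
    also have "\<dots> \<le> (1 - s) * (r k)\<^sup>2 + u\<^sup>2 / s" using s by simp
    finally show ?thesis by (simp add: u_def power_mult_distrib algebra_simps)
  qed
  have 2: "(\<Sum>k<n. s * (r k)\<^sup>2) \<le> (C\<^sup>2 + A\<^sup>2 * S) / s"
  proof -
    have "(\<Sum>k<n. s * (r k)\<^sup>2) \<le> (\<Sum>k<n. ((r k)\<^sup>2 - (r (Suc k))\<^sup>2) + A\<^sup>2 / s * (e k)\<^sup>2)"
      using 1 by (intro sum_mono) simp
    also have "\<dots> = (r 0)\<^sup>2 - (r n)\<^sup>2 + A\<^sup>2 / s * (\<Sum>k<n. (e k)\<^sup>2)"
      using sum_lessThan_telescope'[of "\<lambda>k. (r k)\<^sup>2" n] by (simp add: sum.distrib sum_distrib_left)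
    also have "\<dots> \<le> C\<^sup>2 - 0 + A\<^sup>2 / s * S"
      using r s e by (intro add_mono diff_mono power_mono mult_left_mono) auto
    also have "C\<^sup>2 - 0 \<le> C\<^sup>2 / s"
      using s by (simp add: pos_le_divide_eq mult_left_le)
    finally show ?thesis by (simp add: add_divide_distrib)
  qed
  have "e k * r k \<le> (e k)\<^sup>2 / s + s * (r k)\<^sup>2" for k
  proof -
    have "0 \<le> (e k - s * r k)\<^sup>2 / s" using s by simp
    also have "\<dots> = (e k)\<^sup>2 / s + s * (r k)\<^sup>2 - 2 * (e k * r k)" using s by (simp add: power2_eq_square field_simps)
    finally have "2 * (e k * r k) \<le> (e k)\<^sup>2 / s + s * (r k)\<^sup>2" by simp
    moreover have "0 \<le> (e k)\<^sup>2 / s + s * (r k)\<^sup>2" using s by simp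
    ultimately show ?thesis by linarith
  qed
  hence "(\<Sum>k<n. e k * r k) \<le> (\<Sum>k<n. (e k)\<^sup>2 / s + s * (r k)\<^sup>2)" by (rule sum_mono)
  also have "\<dots> = (\<Sum>k<n. (e k)\<^sup>2) / s + (\<Sum>k<n. s * (r k)\<^sup>2)" by (simp add: sum.distrib sum_divide_distrib)
  also have "\<dots> \<le> S / s + (C\<^sup>2 + A\<^sup>2 * S) / s" using 2 e[of n] s by (intro add_mono divide_right_mono) auto
  finally show ?thesis by (simp add: add_divide_distrib)
qed

text \<open>Cauchy's theorem on a triangle over \<open>[c, d]\<close>: on the slanted sides the weight is
  \<open>O(Im z)\<close>, which compensates the blow-up of the bound on \<open>S\<close>.\<close>

lemma weighted_integral_bound:
  assumes cd: "c < d" and r: "0 < r" and C: "0 \<le> C"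
    and cont: "continuous_on (cbox (Complex c 0) (Complex d r)) S"
    and hol: "S holomorphic_on box (Complex c 0) (Complex d r)"
    and bound: "\<And>z. z \<in> cbox (Complex c 0) (Complex d r) \<Longrightarrow> 0 < Im z \<Longrightarrow> cmod (S z) \<le> C / Im z"
  shows "\<bar>integral {c..d} (\<lambda>x. (x - c) * (d - x) * Re (S (of_real x)))\<bar> \<le> 2 * C * (d - c + r) ^ 3 / r"
proof -
  let ?D = "cbox (Complex c 0) (Complex d r)"
  define p where "p = Complex ((c + d) / 2) r"
  define f where "f = (\<lambda>z. (z - of_real c) * (of_real d - z) * S z)"
  have inD: "of_real c \<in> ?D" "of_real d \<in> ?D" "p \<in> ?D" using cd r by (auto simp: in_cbox_complex_iff p_def)
  have hull: "convex hull {of_real c, of_real d, p} \<subseteq> ?D" by (rule hull_minimal) (use inD in auto)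
  hence int: "interior (convex hull {of_real c, of_real d, p}) \<subseteq> box (Complex c 0) (Complex d r)"
    using interior_mono by (metis interior_cbox)
  have contf: "continuous_on ?D f" unfolding f_def by (intro continuous_intros cont)
  have "(f has_contour_integral 0) (linepath (of_real c) (of_real d) +++ linepath (of_real d) p +++ linepath p (of_real c))"
  proof (rule Cauchy_theorem_triangle_interior)
    show "continuous_on (convex hull {of_real c, of_real d, p}) f" by (rule continuous_on_subset[OF contf hull])
    show "f holomorphic_on interior (convex hull {of_real c, of_real d, p})"
      unfolding f_def by (intro holomorphic_intros holomorphic_on_subset[OF hol int])
  qed
  moreover have seg: "closed_segment x y \<subseteq> ?D" if "x \<in> ?D" "y \<in> ?D" for x y
    using that convex_box(1) closed_segment_subset by blast
  have ci: "f contour_integrable_on linepath x y" if "x \<in> ?D" "y \<in> ?D" for x y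
    by (intro contour_integrable_continuous_linepath continuous_on_subset[OF contf] seg that)
  ultimately have sum0: "contour_integral (linepath (of_real c) (of_real d)) f + (contour_integral (linepath (of_real d) p) f + contour_integral (linepath p (of_real c)) f) = 0"
    using inD by (auto simp: contour_integral_unique[symmetric] dest!: contour_integral_unique)
  have pc: "cmod (p - of_real c) \<le> d - c + r" "cmod (p - of_real d) \<le> d - c + r"
    using cmod_le[of "p - of_real c"] cmod_le[of "p - of_real d"] cd r by (auto simp: p_def field_simps abs_if)
  have zc: "cmod (z - of_real c) \<le> d - c + r" "cmod (of_real d - z) \<le> d - c + r" if "z \<in> ?D" for z
    using cmod_le[of "z - of_real c"] cmod_le[of "of_real d - z"] that by (auto simp: in_cbox_complex_iff)
  \<comment> \<open>At the point with parameter \<open>t\<close> of a slanted side the weight is at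
    most \<open>t * (d - c + r)\<^sup>2\<close> and the bound on \<open>S\<close> is
    \<open>C / (t * r)\<close>, so \<open>t\<close> cancels. At \<open>t = 0\<close>, where that
    bound is void, the weight vanishes.\<close>
  define K where "K = (d - c + r)\<^sup>2 * C / r"
  have K: "0 \<le> K" using C r by (simp add: K_def)
  have fK: "cmod (f z) \<le> K" if z: "z \<in> closed_segment e p" and e: "e = of_real c \<or> e = of_real d" for z e
  proof -
    obtain t where t: "0 \<le> t" "t \<le> 1" "z = (1 - t) *\<^sub>R e + t *\<^sub>R p" using z by (auto simp: closed_segment_def)
    have zD: "z \<in> ?D" using seg[OF _ inD(3), of e] inD e z by auto
    have ze: "z - e = t *\<^sub>R (p - e)" unfolding t(3) by (simp add: algebra_simps)
    have Imz: "Im z = t * r" unfolding t(3) using e by (auto simp: p_def)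
    have "cmod (z - of_real c) * cmod (of_real d - z) \<le> (d - c + r) * (t * (d - c + r))"
    proof -
      have te: "cmod (z - e) \<le> t * (d - c + r)" unfolding ze using e pc t by (auto intro!: mult_left_mono)
      from e show ?thesis
      proof
        assume "e = of_real c"
        hence "cmod (of_real d - z) * cmod (z - of_real c) \<le> (d - c + r) * (t * (d - c + r))"
          using te zc[OF zD] cd r by (intro mult_mono) auto
        thus ?thesis by (simp add: mult.commute)
      next
        assume "e = of_real d"
        thus ?thesis using te zc[OF zD] cd r by (intro mult_mono) (auto simp: norm_minus_commute)
      qed
    qed
    hence fz: "cmod (f z) \<le> (d - c + r) * (t * (d - c + r)) * cmod (S z)"
      unfolding f_def norm_mult by (rule mult_right_mono) simp
    show ?thesis
    proof (cases "t = 0")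
      case True
      thus ?thesis using fz K by simp
    next
      case False
      hence "cmod (S z) \<le> C / (t * r)" using bound[OF zD] Imz t r by simp
      hence "(d - c + r) * (t * (d - c + r)) * cmod (S z) \<le> (d - c + r) * (t * (d - c + r)) * (C / (t * r))"
        using cd r t by (intro mult_left_mono) auto
      also have "\<dots> = K" using False r by (simp add: K_def power2_eq_square field_simps)
      finally show ?thesis using fz by simp
    qed
  qed
  have b1: "cmod (contour_integral (linepath (of_real d) p) f) \<le> K * (d - c + r)"
  proof -
    have "cmod (contour_integral (linepath (of_real d) p) f) \<le> K * cmod (p - of_real d)"
      by (rule contour_integral_bound_linepath) (use ci inD K fK in auto)
    also have "\<dots> \<le> K * (d - c + r)" using pc K by (intro mult_left_mono) auto
    finally show ?thesis .
  qed
  have b2: "cmod (contour_integral (linepath p (of_real c)) f) \<le> K * (d - c + r)"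
  proof -
    have "cmod (contour_integral (linepath p (of_real c)) f) \<le> K * cmod (of_real c - p)"
      by (rule contour_integral_bound_linepath) (use ci inD K fK in \<open>auto simp: closed_segment_commute[of p]\<close>)
    also have "\<dots> \<le> K * (d - c + r)" using pc K by (intro mult_left_mono) (auto simp: norm_minus_commute)
    finally show ?thesis .
  qed
  have I: "contour_integral (linepath (of_real c) (of_real d)) f = integral {c..d} (\<lambda>x. f (of_real x))"
    by (subst contour_integral_linepath_Reals_eq) (use cd in auto)
  have "contour_integral (linepath (of_real c) (of_real d)) f = - (contour_integral (linepath (of_real d) p) f + contour_integral (linepath p (of_real c)) f)"
    using sum0 by (simp only: eq_neg_iff_add_eq_0)
  hence "cmod (contour_integral (linepath (of_real c) (of_real d)) f) \<le> 2 * (K * (d - c + r))"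
    using b1 b2 norm_triangle_ineq[of "contour_integral (linepath (of_real d) p) f" "contour_integral (linepath p (of_real c)) f"]
    by (simp only: norm_minus_cancel)
  moreover have "2 * (E\<^sup>2 * C / r * E) = 2 * C * E ^ 3 / r" for E
    by (simp add: power2_eq_square power3_eq_cube)
  ultimately have le: "cmod (integral {c..d} (\<lambda>x. f (of_real x))) \<le> 2 * C * (d - c + r) ^ 3 / r"
    unfolding I K_def by (simp only:)
  have "(\<lambda>x. f (of_real x)) integrable_on {c..d}"
    by (intro integrable_continuous_real continuous_on_compose2[OF contf] continuous_intros) (auto simp: in_cbox_complex_iff r less_imp_le)
  hence "Re (integral {c..d} (\<lambda>x. f (of_real x))) = integral {c..d} (\<lambda>x. Re (f (of_real x)))"
    using integral_linear[OF _ bounded_linear_Re, of "\<lambda>x. f (of_real x)" "{c..d}"] by (simp add: o_def)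
  also have "(\<lambda>x. Re (f (of_real x))) = (\<lambda>x. (x - c) * (d - x) * Re (S (of_real x)))"
  proof
    fix x
    have "f (of_real x) = of_real ((x - c) * (d - x)) * S (of_real x)" by (simp add: f_def)
    thus "Re (f (of_real x)) = (x - c) * (d - x) * Re (S (of_real x))" by (simp only: Re_complex_of_real Im_complex_of_real times_complex.sel)
  qed
  finally show ?thesis using abs_Re_le_cmod[of "integral {c..d} (\<lambda>x. f (of_real x))"] le by simp
qed

text \<open>\<open>mfix (\<plusminus>1)\<close> are the fixed points of the Moebius map of a unimodular matrix. Dividing by
  \<open>(2 t\<^sub>2\<^sub>1)\<^sup>2\<close> under the root makes the radicand positive inside the bands, so the principal branch
  puts \<open>mfix 1\<close> into the upper half-plane whatever the sign of \<open>t\<^sub>2\<^sub>1\<close>.\<close>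

definition mdisc :: "complex \<Rightarrow> complex \<Rightarrow> complex \<Rightarrow> complex" where
  "mdisc t11 t21 t22 = (4 - (t11 + t22)\<^sup>2) * (inverse (2 * t21))\<^sup>2"

definition mfix :: "complex \<Rightarrow> complex \<Rightarrow> complex \<Rightarrow> complex \<Rightarrow> complex" where
  "mfix \<sigma> t11 t21 t22 = (t11 - t22) * inverse (2 * t21) + \<sigma> * \<i> * csqrt (mdisc t11 t21 t22)"

lemma mfix_fixed_point:
  assumes "t21 \<noteq> 0" "t11 * t22 - t21 * t12 = 1" "\<sigma>\<^sup>2 = 1"
  defines "m \<equiv> mfix \<sigma> t11 t21 t22"
  shows "t11 * m + t12 = (t21 * m + t22) * m"
proof -
  define w where "w = inverse (2 * t21)"
  define s where "s = csqrt (mdisc t11 t21 t22)"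
  have w: "2 * t21 * w = 1" using assms(1) by (simp add: w_def)
  have s: "s\<^sup>2 = (4 - (t11 + t22)\<^sup>2) * w\<^sup>2" by (simp add: s_def mdisc_def w_def)
  have m: "m = (t11 - t22) * w + \<sigma> * \<i> * s" by (simp add: m_def mfix_def w_def s_def)
  have "4 * t21 * ((t21 * m + t22) * m - (t11 * m + t12)) = (2 * t21 * m - (t11 - t22))\<^sup>2 - (t11 - t22)\<^sup>2 - 4 * t12 * t21"
    by (simp add: power2_eq_square algebra_simps)
  also have "2 * t21 * m - (t11 - t22) = 2 * t21 * (\<sigma> * \<i> * s)"
    using w unfolding m by algebra
  also have "(2 * t21 * (\<sigma> * \<i> * s))\<^sup>2 = - ((2 * t21 * w)\<^sup>2 * (4 - (t11 + t22)\<^sup>2))"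
    using assms(3) s by (simp add: power_mult_distrib)
  also have "- ((2 * t21 * w)\<^sup>2 * (4 - (t11 + t22)\<^sup>2)) - (t11 - t22)\<^sup>2 - 4 * t12 * t21 = 0"
    unfolding w power_one mult_1_left using assms(2) by algebra
  finally show ?thesis using assms(1) by simp
qed

text \<open>For a fixed point \<open>m\<close>, the factor \<open>t21 * m + t22\<close> is the
  eigenvalue that belongs to the eigenvector \<open>(m, 1)\<close>. The two identities are therefore
  trace and determinant.\<close>

lemma mfix_sum_prod:
  assumes "t21 \<noteq> 0" "t11 * t22 - t21 * t12 = 1"
  defines "m \<equiv> mfix 1 t11 t21 t22" and "m' \<equiv> mfix (-1) t11 t21 t22"
  shows "(t21 * m + t22) + (t21 * m' + t22) = t11 + t22" "(t21 * m + t22) * (t21 * m' + t22) = 1"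
proof -
  have "m + m' = (t11 - t22) * inverse t21" by (simp add: m_def m'_def mfix_def)
  hence sum: "t21 * (m + m') = t11 - t22" using assms(1) by simp
  thus 1: "(t21 * m + t22) + (t21 * m' + t22) = t11 + t22" by (simp add: algebra_simps)
  have "t11 * m + t12 = (t21 * m + t22) * m" unfolding m_def by (rule mfix_fixed_point) (use assms in auto)
  thus "(t21 * m + t22) * (t21 * m' + t22) = 1" using sum assms(2) by algebra
qed

text \<open>Both principal roots have real parts bounded below, so the second factor in the
  factorisation of \<open>x - y\<close> cannot become small by cancellation.\<close>

lemma csqrt_diff_bound:
  assumes "0 < g" "g \<le> Re x" "g \<le> Re y"
  shows "cmod (csqrt x - csqrt y) \<le> cmod (x - y) / sqrt g"
proof -
  have re: "sqrt g / 2 \<le> Re (csqrt w)" if "g \<le> Re w" for w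
  proof -
    have "g \<le> cmod w" using that complex_Re_le_cmod[of w] by linarith
    hence "g \<le> (cmod w + Re w) / 2" using that by simp
    hence "sqrt g \<le> sqrt ((cmod w + Re w) / 2)" by simp
    moreover have "0 \<le> sqrt g" using assms by simp
    moreover have "Re (csqrt w) = sqrt ((cmod w + Re w) / 2)" by simp
    ultimately show ?thesis by linarith
  qed
  have "sqrt g \<le> Re (csqrt x + csqrt y)" using re[OF assms(2)] re[OF assms(3)] by simp
  also have "\<dots> \<le> cmod (csqrt x + csqrt y)" by (rule complex_Re_le_cmod)
  finally have s: "sqrt g \<le> cmod (csqrt x + csqrt y)" .
  have sg: "0 < sqrt g" using assms by simp
  have "x - y = (csqrt x - csqrt y) * (csqrt x + csqrt y)"
    by (simp add: algebra_simps power2_eq_square[symmetric])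
  hence "cmod (x - y) = cmod (csqrt x - csqrt y) * cmod (csqrt x + csqrt y)" by (metis norm_mult)
  hence "cmod (csqrt x - csqrt y) * sqrt g \<le> cmod (x - y)" using s by (simp add: mult_left_mono)
  thus ?thesis using sg by (simp add: pos_le_divide_eq)
qed

lemma mdisc_lipschitz:
  assumes B: "1 \<le> B" and c: "0 < c"
  obtains L where "0 \<le> L"
    "\<And>t11 t21 t22 s11 s21 s22. cmod t11 \<le> B \<Longrightarrow> cmod t22 \<le> B \<Longrightarrow> cmod s11 \<le> B \<Longrightarrow> cmod s22 \<le> B \<Longrightarrow>
      c \<le> cmod t21 \<Longrightarrow> c \<le> cmod s21 \<Longrightarrow>
      cmod (mdisc t11 t21 t22 - mdisc s11 s21 s22) \<le> L * (cmod (t11 - s11) + cmod (t21 - s21) + cmod (t22 - s22)) \<and>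
      cmod ((t11 - t22) * inverse (2 * t21) - (s11 - s22) * inverse (2 * s21)) \<le> L * (cmod (t11 - s11) + cmod (t21 - s21) + cmod (t22 - s22))"
proof -
  define W where "W = inverse (2 * c)"
  define L1 where "L1 = 1 / (2 * c\<^sup>2)"
  define L where "L = (4 + (2 * B)\<^sup>2) * (2 * W * L1) + W\<^sup>2 * (4 * B) + 2 * B * L1 + W"
  have pos: "0 \<le> W" "0 \<le> L1" using c by (auto simp: W_def L1_def)
  show ?thesis
  proof (rule that[of L])
    show "0 \<le> L" unfolding L_def using pos B by simp
    fix t11 t21 t22 s11 s21 s22 :: complex
    assume b: "cmod t11 \<le> B" "cmod t22 \<le> B" "cmod s11 \<le> B" "cmod s22 \<le> B" and t21: "c \<le> cmod t21" and s21: "c \<le> cmod s21"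
    define D where "D = cmod (t11 - s11) + cmod (t21 - s21) + cmod (t22 - s22)"
    have D: "cmod (t11 - s11) \<le> D" "cmod (t21 - s21) \<le> D" "cmod (t11 - s11) + cmod (t22 - s22) \<le> D" "0 \<le> D"
      by (auto simp: D_def)
    define w where "w = inverse (2 * t21)"
    define v where "v = inverse (2 * s21)"
    have wv: "cmod w \<le> W" "cmod v \<le> W" unfolding w_def v_def W_def using c t21 s21
      by (auto simp: norm_inverse norm_mult intro!: le_imp_inverse_le)
    have "cmod (w - v) \<le> cmod (2 * t21 - 2 * s21) / (2 * c)\<^sup>2" unfolding w_def v_def
      by (rule inverse_diff_bound) (use c t21 s21 in \<open>auto simp: norm_mult\<close>)
    also have "cmod (2 * t21 - 2 * s21) = 2 * cmod (t21 - s21)" by (metis norm_mult norm_numeral right_diff_distrib)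
    also have "2 * cmod (t21 - s21) / (2 * c)\<^sup>2 = L1 * cmod (t21 - s21)" by (simp add: L1_def power2_eq_square field_simps)
    also have "\<dots> \<le> L1 * D" using D pos by (intro mult_left_mono) auto
    finally have wvd: "cmod (w - v) \<le> L1 * D" .
    have w2: "cmod (w\<^sup>2 - v\<^sup>2) \<le> 2 * W * (L1 * D)"
    proof -
      have "cmod (w * w - v * v) \<le> W * cmod (w - v) + W * cmod (w - v)" by (rule mult_diff_bound) (use wv in auto)
      also have "\<dots> \<le> W * (L1 * D) + W * (L1 * D)" using wvd pos by (intro add_mono mult_left_mono) auto
      finally show ?thesis by (simp add: power2_eq_square mult_ac)
    qed
    have tau: "cmod (t11 + t22) \<le> 2 * B" "cmod (s11 + s22) \<le> 2 * B" "cmod (s11 - s22) \<le> 2 * B" "cmod (t11 - t22) \<le> 2 * B"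
      using b norm_triangle_ineq[of t11 t22] norm_triangle_ineq[of s11 s22] norm_triangle_ineq4[of s11 s22] norm_triangle_ineq4[of t11 t22] by auto
    have td: "cmod ((t11 + t22) - (s11 + s22)) \<le> D" "cmod ((t11 - t22) - (s11 - s22)) \<le> D"
    proof -
      have e: "(t11 + t22) - (s11 + s22) = (t11 - s11) + (t22 - s22)" "(t11 - t22) - (s11 - s22) = (t11 - s11) - (t22 - s22)"
        by simp_all
      show "cmod ((t11 + t22) - (s11 + s22)) \<le> D" "cmod ((t11 - t22) - (s11 - s22)) \<le> D"
        unfolding e using D(3) norm_triangle_ineq[of "t11 - s11" "t22 - s22"] norm_triangle_ineq4[of "t11 - s11" "t22 - s22"] by linarith+
    qed
    have "cmod ((t11 + t22) * (t11 + t22) - (s11 + s22) * (s11 + s22)) \<le> 2 * B * cmod ((t11 + t22) - (s11 + s22)) + 2 * B * cmod ((t11 + t22) - (s11 + s22))"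
      by (rule mult_diff_bound) (use tau in auto)
    also have "\<dots> \<le> 2 * B * D + 2 * B * D" using td B by (intro add_mono mult_left_mono) auto
    finally have t2: "cmod ((t11 + t22)\<^sup>2 - (s11 + s22)\<^sup>2) \<le> 4 * B * D" by (simp add: power2_eq_square)
    have "cmod ((t11 + t22)\<^sup>2) \<le> (2 * B)\<^sup>2" unfolding norm_power using tau by (intro power_mono) auto
    hence n4: "cmod (4 - (t11 + t22)\<^sup>2) \<le> 4 + (2 * B)\<^sup>2" using norm_triangle_ineq4[of 4 "(t11 + t22)\<^sup>2"] by simp
    have d4: "cmod ((4 - (t11 + t22)\<^sup>2) - (4 - (s11 + s22)\<^sup>2)) \<le> 4 * B * D" using t2 by (simp add: norm_minus_commute)
    have v2: "cmod (v\<^sup>2) \<le> W\<^sup>2" unfolding norm_power using wv by (intro power_mono) auto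
    have "cmod ((4 - (t11 + t22)\<^sup>2) * w\<^sup>2 - (4 - (s11 + s22)\<^sup>2) * v\<^sup>2) \<le>
        (4 + (2 * B)\<^sup>2) * cmod (w\<^sup>2 - v\<^sup>2) + W\<^sup>2 * cmod ((4 - (t11 + t22)\<^sup>2) - (4 - (s11 + s22)\<^sup>2))"
      by (rule mult_diff_bound[OF n4 v2])
    also have "\<dots> \<le> (4 + (2 * B)\<^sup>2) * (2 * W * (L1 * D)) + W\<^sup>2 * (4 * B * D)"
      using w2 d4 by (intro add_mono mult_left_mono) auto
    finally have 1: "cmod (mdisc t11 t21 t22 - mdisc s11 s21 s22) \<le> ((4 + (2 * B)\<^sup>2) * (2 * W * L1) + W\<^sup>2 * (4 * B)) * D"
      by (simp add: mdisc_def w_def v_def algebra_simps)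
    have "cmod ((t11 - t22) * w - (s11 - s22) * v) \<le> 2 * B * cmod (w - v) + W * cmod ((t11 - t22) - (s11 - s22))"
      by (rule mult_diff_bound) (use tau wv in auto)
    also have "\<dots> \<le> 2 * B * (L1 * D) + W * D" using wvd td pos B by (intro add_mono mult_left_mono) auto
    finally have 2: "cmod ((t11 - t22) * w - (s11 - s22) * v) \<le> (2 * B * L1 + W) * D" by (simp add: algebra_simps)
    have n: "0 \<le> (4 + (2 * B)\<^sup>2) * (2 * W * L1) + W\<^sup>2 * (4 * B)" "0 \<le> 2 * B * L1 + W" using pos B by auto
    have "((4 + (2 * B)\<^sup>2) * (2 * W * L1) + W\<^sup>2 * (4 * B)) * D \<le> L * D" "(2 * B * L1 + W) * D \<le> L * D"
      unfolding L_def using n D(4) by (auto intro!: mult_right_mono)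
    thus "cmod (mdisc t11 t21 t22 - mdisc s11 s21 s22) \<le> L * (cmod (t11 - s11) + cmod (t21 - s21) + cmod (t22 - s22)) \<and>
      cmod ((t11 - t22) * inverse (2 * t21) - (s11 - s22) * inverse (2 * s21)) \<le> L * (cmod (t11 - s11) + cmod (t21 - s21) + cmod (t22 - s22))"
      using 1 2 unfolding D_def w_def v_def by linarith
  qed
qed

section \<open>Fixed points of the period maps near a band\<close>

context square_summable_variation
begin

text \<open>For \<open>\<sigma>\<close> equal to 1 or -1, the fixed points of the Moebius map of
  \<open>T\<^sub>n\<close>; up to normalisation, the two Weyl functions of the periodic matrix that
  repeats this period.\<close>

definition weyl :: "complex \<Rightarrow> nat \<Rightarrow> complex \<Rightarrow> complex" where
  "weyl \<sigma> n z = mfix \<sigma> (fst (col1 n z)) (snd (col1 n z)) (snd (col2 n z))"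

definition disc :: "nat \<Rightarrow> complex \<Rightarrow> complex" where
  "disc n z = mdisc (fst (col1 n z)) (snd (col1 n z)) (snd (col2 n z))"

text \<open>On the real interval the bounds come explicitly from the gap \<open>\<eta>\<close>.
  Lipschitz dependence carries them, with half the constants, into a rectangle above it; since the
  coefficients stay in one box, a single height \<open>r\<close> serves for all large
  \<open>n\<close>.\<close>

lemma weyl_uniform:
  assumes cd: "c < d" and \<eta>: "0 < \<eta>" and tr: "\<And>n x. N \<le> n \<Longrightarrow> x \<in> {c..d} \<Longrightarrow> \<bar>tr n x\<bar> \<le> 2 - \<eta>"
  obtains r h B L where "0 < r" "0 < h" "0 \<le> B" "0 \<le> L"
    "\<And>n z. N \<le> n \<Longrightarrow> z \<in> cbox (Complex c 0) (Complex d r) \<Longrightarrow> snd (col1 n z) \<noteq> 0 \<and> 0 < Re (disc n z)"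
    "\<And>n z. N \<le> n \<Longrightarrow> z \<in> cbox (Complex c 0) (Complex d r) \<Longrightarrow> h \<le> Im (weyl 1 n z) \<and> Im (weyl (-1) n z) \<le> - h"
    "\<And>n z \<sigma>. N \<le> n \<Longrightarrow> z \<in> cbox (Complex c 0) (Complex d r) \<Longrightarrow> cmod \<sigma> = 1 \<Longrightarrow> cmod (weyl \<sigma> n z) \<le> B"
    "\<And>n z \<sigma>. N \<le> n \<Longrightarrow> z \<in> cbox (Complex c 0) (Complex d r) \<Longrightarrow> cmod \<sigma> = 1 \<Longrightarrow> cmod (weyl \<sigma> (n + q) z - weyl \<sigma> n z) \<le> L * period_dist n"
proof -
  define R where "R = \<bar>c\<bar> + \<bar>d\<bar> + 1"
  have zR: "cmod z \<le> R" if "z \<in> cbox (Complex c 0) (Complex d r)" "r \<le> 1" for z r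
    using cmod_le[of z] that by (auto simp: in_cbox_complex_iff R_def)
  have \<eta>2: "\<eta> \<le> 2" using tr[of N c] cd abs_ge_zero[of "tr N c"] by force
  obtain B1 where B1: "B1 \<ge> 0" "\<And>a b (z::complex). coeff_box l M a b \<Longrightarrow> norm z \<le> R \<Longrightarrow>
    norm (fst (sol a b z (1, 0) q)) \<le> B1 \<and> norm (snd (sol a b z (1, 0) q)) \<le> B1"
    using sol_bound[OF l_pos, of M R "(1, 0)" q] by blast
  obtain B2 where B2: "B2 \<ge> 0" "\<And>a b (z::complex). coeff_box l M a b \<Longrightarrow> norm z \<le> R \<Longrightarrow>
    norm (fst (sol a b z (0, 1) q)) \<le> B2 \<and> norm (snd (sol a b z (0, 1) q)) \<le> B2"
    using sol_bound[OF l_pos, of M R "(0, 1)" q] by blast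
  define B where "B = max 1 (max B1 B2)"
  have B: "1 \<le> B" by (simp add: B_def)
  have colB: "cmod (fst (col1 n z)) \<le> B" "cmod (snd (col1 n z)) \<le> B" "cmod (fst (col2 n z)) \<le> B" "cmod (snd (col2 n z)) \<le> B"
    if "cmod z \<le> R" for n z
    using B1(2)[OF shift_box[of n] that] B2(2)[OF shift_box[of n] that] by (auto simp: B_def)
  obtain C where C: "0 \<le> C"
    "\<And>m n z z'. norm (z :: complex) \<le> R \<Longrightarrow> norm z' \<le> R \<Longrightarrow>
      (let d = C * (coeff_dist q (shift m a) (shift m b) (shift n a) (shift n b) + norm (z - z')) in
      norm (fst (col1 m z) - fst (col1 n z')) \<le> d \<and> norm (snd (col1 m z) - snd (col1 n z')) \<le> d \<and>
      norm (fst (col2 m z) - fst (col2 n z')) \<le> d \<and> norm (snd (col2 m z) - snd (col2 n z')) \<le> d)"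
    using monodromy_lipschitz[where 'k = complex and R = R] by blast
  \<comment> \<open>On the real interval unimodularity gives \<open>(t11 - t22)\<^sup>2 + 4 * (t12 *
    t21) = (t11 + t22)\<^sup>2 - 4\<close>, which is at most \<open>- 2 * \<eta>\<close>. Hence
    \<open>t12 * t21\<close> has modulus at least \<open>\<eta> / 2\<close>, and \<open>t21\<close>
    at least \<open>2 * c0\<close>. Dividing by \<open>(2 * t21)\<^sup>2\<close> makes the radicand
    at least \<open>2 * g0\<close>.\<close>
  define c0 where "c0 = \<eta> / (4 * B)"
  have c0: "0 < c0" using \<eta> B by (simp add: c0_def)
  define g0 where "g0 = \<eta> / (4 * B\<^sup>2)"
  have g0: "0 < g0" using \<eta> B by (simp add: g0_def)
  obtain K where K: "0 \<le> K"
    "\<And>t11 t21 t22 s11 s21 s22. cmod t11 \<le> B \<Longrightarrow> cmod t22 \<le> B \<Longrightarrow> cmod s11 \<le> B \<Longrightarrow> cmod s22 \<le> B \<Longrightarrow>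
      c0 \<le> cmod t21 \<Longrightarrow> c0 \<le> cmod s21 \<Longrightarrow>
      cmod (mdisc t11 t21 t22 - mdisc s11 s21 s22) \<le> K * (cmod (t11 - s11) + cmod (t21 - s21) + cmod (t22 - s22)) \<and>
      cmod ((t11 - t22) * inverse (2 * t21) - (s11 - s22) * inverse (2 * s21)) \<le> K * (cmod (t11 - s11) + cmod (t21 - s21) + cmod (t22 - s22))"
    using mdisc_lipschitz[OF B c0] by blast
  define L0 where "L0 = K + K / sqrt g0"
  have L0: "0 \<le> L0" using K g0 by (simp add: L0_def)
  define h where "h = sqrt (2 * g0) / 2"
  have h: "0 < h" using g0 by (simp add: h_def)
  \<comment> \<open>Moving up by at most \<open>r\<close> changes \<open>t21\<close>, the radicand
    and the fixed points by at most \<open>c0\<close>, \<open>g0\<close> and \<open>h\<close>, which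
    is half of their lower bounds on the real axis. The added ones avoid division by zero.\<close>
  define r where "r = min 1 (min (c0 / (C + 1)) (min (g0 / (3 * K * C + 1)) (h / (3 * L0 * C + 1))))"
  have r: "0 < r" "r \<le> 1" unfolding r_def using c0 g0 h K C L0 by (auto simp: add_nonneg_pos)
  have rle: "C * r \<le> c0" "3 * K * C * r \<le> g0" "3 * L0 * C * r \<le> h"
  proof -
    have *: "u * r \<le> v" if "r \<le> v / (u + 1)" "0 \<le> u" for u v :: real
    proof -
      have "(u + 1) * r \<le> v" using that by (simp add: field_simps)
      thus ?thesis using r by (simp add: algebra_simps)
    qed
    show "C * r \<le> c0" "3 * K * C * r \<le> g0" "3 * L0 * C * r \<le> h"
      by (rule *; use C K L0 in \<open>simp add: r_def\<close>)+
  qed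
  define D where "D = cbox (Complex c 0) (Complex d r)"
  have DR: "cmod z \<le> R" if "z \<in> D" for z using zR[of z r] that r by (auto simp: D_def)
  have reD: "of_real (Re z) \<in> D" "Re z \<in> {c..d}" "0 \<le> Im z" "Im z \<le> r" "cmod (z - of_real (Re z)) = Im z" if "z \<in> D" for z
    using that r by (auto simp: D_def in_cbox_complex_iff cmod_eq_Im)
  have real: "2 * c0 \<le> cmod (snd (col1 n (of_real x))) \<and> Im (fst (col1 n (of_real x :: complex))) = 0 \<and>
      (\<exists>g. disc n (of_real x) = of_real g \<and> 2 * g0 \<le> g) \<and>
      Im ((fst (col1 n (of_real x)) - snd (col2 n (of_real x))) * inverse (2 * snd (col1 n (of_real x :: complex)))) = 0"
    if n: "N \<le> n" and x: "x \<in> {c..d}" for n x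
  proof -
    define t11 t12 t21 t22 where t: "t11 = fst (col1 n x)" "t12 = fst (col2 n x)" "t21 = snd (col1 n x)" "t22 = snd (col2 n x)"
    have xR: "cmod (of_real x) \<le> R" using x by (auto simp: R_def)
    have ct: "fst (col1 n (of_real x :: complex)) = of_real t11" "fst (col2 n (of_real x :: complex)) = of_real t12"
      "snd (col1 n (of_real x :: complex)) = of_real t21" "snd (col2 n (of_real x :: complex)) = of_real t22"
      by (simp_all add: t sol_of_real_10 sol_of_real_01)
    have tB: "\<bar>t12\<bar> \<le> B" "\<bar>t21\<bar> \<le> B" using colB[OF xR, of n] unfolding ct by simp_all
    have det: "t11 * t22 - t21 * t12 = 1" unfolding t by (rule monodromy_det)
    have tau: "\<bar>t11 + t22\<bar> \<le> 2 - \<eta>" using tr[OF n x] by (simp add: tr_def t)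
    have "(t11 + t22)\<^sup>2 \<le> (2 - \<eta>)\<^sup>2" using tau \<eta>2 by (metis abs_ge_zero abs_le_square_iff abs_of_nonneg diff_ge_0_iff_ge)
    also have "\<dots> = 4 - 2 * \<eta> - \<eta> * (2 - \<eta>)" by (simp add: power2_eq_square algebra_simps)
    also have "\<dots> \<le> 4 - 2 * \<eta>" using \<eta> \<eta>2 by simp
    finally have t4: "2 * \<eta> \<le> 4 - (t11 + t22)\<^sup>2" by simp
    have "(t11 - t22)\<^sup>2 + 4 * (t12 * t21) = (t11 + t22)\<^sup>2 - 4"
      using det by algebra
    hence "4 * (t12 * t21) \<le> - (2 * \<eta>)" using t4 zero_le_power2[of "t11 - t22"] by linarith
    hence "\<eta> / 2 \<le> \<bar>t12 * t21\<bar>" by linarith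
    also have "\<dots> \<le> B * \<bar>t21\<bar>" unfolding abs_mult using tB by (intro mult_right_mono) auto
    finally have t21: "2 * c0 \<le> \<bar>t21\<bar>" using B by (simp add: c0_def field_simps)
    hence nz: "t21 \<noteq> 0" using c0 by auto
    have "disc n (of_real x) = of_real ((4 - (t11 + t22)\<^sup>2) * (inverse (2 * t21))\<^sup>2)"
      unfolding disc_def mdisc_def ct by simp
    moreover have "2 * g0 \<le> (4 - (t11 + t22)\<^sup>2) * (inverse (2 * t21))\<^sup>2"
    proof -
      have "(2 * t21)\<^sup>2 \<le> (2 * B)\<^sup>2" using tB by (subst abs_le_square_iff[symmetric]) auto
      hence "inverse ((2 * B)\<^sup>2) \<le> (inverse (2 * t21))\<^sup>2" using nz
        by (subst power_inverse) (intro le_imp_inverse_le, auto)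
      hence "2 * \<eta> * inverse ((2 * B)\<^sup>2) \<le> (4 - (t11 + t22)\<^sup>2) * (inverse (2 * t21))\<^sup>2"
        using t4 \<eta> by (intro mult_mono) auto
      moreover have "2 * \<eta> * inverse ((2 * B)\<^sup>2) = 2 * g0" using B by (simp add: g0_def field_simps)
      ultimately show ?thesis by linarith
    qed
    moreover have "(of_real t11 - of_real t22) * inverse (2 * of_real t21 :: complex) = of_real ((t11 - t22) * inverse (2 * t21))" by simp
    ultimately show ?thesis using t21 unfolding ct by (metis Im_complex_of_real norm_of_real)
  qed
  have dz: "cmod (fst (col1 n z) - fst (col1 n (of_real (Re z)))) \<le> C * Im z \<and> cmod (snd (col1 n z) - snd (col1 n (of_real (Re z)))) \<le> C * Im z
      \<and> cmod (snd (col2 n z) - snd (col2 n (of_real (Re z)))) \<le> C * Im z" if "z \<in> D" for n z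
    using C(2)[OF DR[OF that] DR[OF reD(1)[OF that]], of n n] reD(5)[OF that] by (simp add: Let_def)
  have t21: "c0 \<le> cmod (snd (col1 n z))" if n: "N \<le> n" and z: "z \<in> D" for n z
  proof -
    have "C * Im z \<le> C * r" using C(1) reD[OF z] by (intro mult_left_mono) auto
    hence "cmod (snd (col1 n z) - snd (col1 n (of_real (Re z)))) \<le> c0" using dz[OF z, of n] rle(1) by linarith
    moreover have "2 * c0 \<le> cmod (snd (col1 n (of_real (Re z))))" using real[OF n reD(2)[OF z]] by blast
    ultimately show ?thesis using norm_triangle_ineq2[of "snd (col1 n (of_real (Re z)))" "snd (col1 n z)"]
      by (simp add: norm_minus_commute)
  qed
  have Cz: "cmod (fst (col1 n z) - fst (col1 n (of_real (Re z)))) + cmod (snd (col1 n z) - snd (col1 n (of_real (Re z))))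
      + cmod (snd (col2 n z) - snd (col2 n (of_real (Re z)))) \<le> 3 * C * r" if "z \<in> D" for n z
  proof -
    have "C * Im z \<le> C * r" using C(1) reD[OF that] by (intro mult_left_mono) auto
    thus ?thesis using dz[OF that, of n] by linarith
  qed
  have Kd: "cmod (disc m z - disc n z') \<le> K * S \<and> cmod ((fst (col1 m z) - snd (col2 m z)) * inverse (2 * snd (col1 m z)) -
      (fst (col1 n z') - snd (col2 n z')) * inverse (2 * snd (col1 n z'))) \<le> K * S"
    if "N \<le> m" "N \<le> n" "z \<in> D" "z' \<in> D"
      "cmod (fst (col1 m z) - fst (col1 n z')) + cmod (snd (col1 m z) - snd (col1 n z')) + cmod (snd (col2 m z) - snd (col2 n z')) \<le> S" for m n z z' S
  proof -
    let ?S = "cmod (fst (col1 m z) - fst (col1 n z')) + cmod (snd (col1 m z) - snd (col1 n z')) + cmod (snd (col2 m z) - snd (col2 n z'))"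
    have "K * ?S \<le> K * S" using that(5) K(1) by (rule mult_left_mono)
    thus ?thesis
      using K(2)[OF colB(1)[OF DR[OF that(3)], of m] colB(4)[OF DR[OF that(3)], of m] colB(1)[OF DR[OF that(4)], of n] colB(4)[OF DR[OF that(4)], of n]
        t21[OF that(1,3)] t21[OF that(2,4)]] unfolding disc_def by linarith
  qed
  have Redisc: "g0 \<le> Re (disc n z)" if n: "N \<le> n" and z: "z \<in> D" for n z
  proof -
    obtain g where g: "disc n (of_real (Re z)) = of_real g" "2 * g0 \<le> g" using real[OF n reD(2)[OF z]] by blast
    have "cmod (disc n z - disc n (of_real (Re z))) \<le> K * (3 * C * r)"
      using Kd[OF n n z reD(1)[OF z] Cz[OF z]] by blast
    also have "\<dots> \<le> g0" using rle(2) by (simp add: mult_ac)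
    finally have "\<bar>Re (disc n z - disc n (of_real (Re z)))\<bar> \<le> g0" using abs_Re_le_cmod order_trans by blast
    thus ?thesis using g by simp
  qed
  have weyl_lip: "cmod (weyl \<sigma> m z - weyl \<sigma> n z') \<le> L0 * S"
    if "N \<le> m" "N \<le> n" "z \<in> D" "z' \<in> D" "cmod \<sigma> = 1"
      "cmod (fst (col1 m z) - fst (col1 n z')) + cmod (snd (col1 m z) - snd (col1 n z')) + cmod (snd (col2 m z) - snd (col2 n z')) \<le> S" for m n z z' S \<sigma>
  proof -
    note k = Kd[OF that(1-4) that(6)]
    have "cmod (csqrt (disc m z) - csqrt (disc n z')) \<le> cmod (disc m z - disc n z') / sqrt g0"
      by (rule csqrt_diff_bound[OF g0 Redisc[OF that(1,3)] Redisc[OF that(2,4)]])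
    also have "\<dots> \<le> K * S / sqrt g0" using k g0 by (intro divide_right_mono) auto
    finally have s: "cmod (csqrt (disc m z) - csqrt (disc n z')) \<le> K * S / sqrt g0" .
    have "weyl \<sigma> m z - weyl \<sigma> n z' = ((fst (col1 m z) - snd (col2 m z)) * inverse (2 * snd (col1 m z)) -
      (fst (col1 n z') - snd (col2 n z')) * inverse (2 * snd (col1 n z'))) + \<sigma> * \<i> * (csqrt (disc m z) - csqrt (disc n z'))"
      by (simp add: weyl_def mfix_def disc_def algebra_simps)
    also have "cmod \<dots> \<le> K * S + K * S / sqrt g0"
      using k s that(5) by (intro norm_triangle_le add_mono) (auto simp: norm_mult)
    finally show ?thesis by (simp add: L0_def algebra_simps)
  qed
  have Im_real: "sqrt (2 * g0) \<le> Im (weyl 1 n (of_real x)) \<and> Im (weyl (-1) n (of_real x)) \<le> - sqrt (2 * g0)"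
    if "N \<le> n" "x \<in> {c..d}" for n x
  proof -
    note rr = real[OF that]
    then obtain g where g: "disc n (of_real x) = of_real g" "2 * g0 \<le> g" by blast
    have "csqrt (disc n (of_real x)) = of_real (sqrt g)" using g g0 by simp
    hence "Im (weyl \<sigma> n (of_real x)) = Re \<sigma> * sqrt g" for \<sigma>
      using conjunct2[OF conjunct2[OF conjunct2[OF rr]]] unfolding weyl_def mfix_def disc_def by simp
    thus ?thesis using g by (simp add: real_sqrt_le_mono)
  qed
  have Im_z: "h \<le> Im (weyl 1 n z) \<and> Im (weyl (-1) n z) \<le> - h" if n: "N \<le> n" and z: "z \<in> D" for n z
  proof -
    have i: "\<bar>Im (weyl \<sigma> n z) - Im (weyl \<sigma> n (of_real (Re z)))\<bar> \<le> h" if "cmod \<sigma> = 1" for \<sigma>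
    proof -
      have "cmod (weyl \<sigma> n z - weyl \<sigma> n (of_real (Re z))) \<le> L0 * (3 * C * r)"
        by (rule weyl_lip[OF n n z reD(1)[OF z] that Cz[OF z]])
      also have "\<dots> \<le> h" using rle(3) by (simp add: mult_ac)
      finally show ?thesis using abs_Im_le_cmod[of "weyl \<sigma> n z - weyl \<sigma> n (of_real (Re z))"] by simp
    qed
    have "sqrt (2 * g0) = 2 * h" by (simp add: h_def)
    thus ?thesis using i[of 1] i[of "-1"] Im_real[OF n reD(2)[OF z]] by auto
  qed
  define BB where "BB = 2 * B * inverse (2 * c0) + (1 + (4 + (2 * B)\<^sup>2) * (inverse (2 * c0))\<^sup>2)"
  have wB: "cmod (weyl \<sigma> n z) \<le> BB" if n: "N \<le> n" and z: "z \<in> D" and "cmod \<sigma> = 1" for n z \<sigma>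
  proof -
    note cb = colB[OF DR[OF z], of n]
    have inv: "cmod (inverse (2 * snd (col1 n z))) \<le> inverse (2 * c0)"
      using t21[OF n z] c0 by (auto simp: norm_inverse norm_mult intro!: le_imp_inverse_le)
    have a1: "cmod (fst (col1 n z) - snd (col2 n z)) \<le> 2 * B" "cmod (fst (col1 n z) + snd (col2 n z)) \<le> 2 * B"
      using cb norm_triangle_ineq4[of "fst (col1 n z)" "snd (col2 n z)"] norm_triangle_ineq[of "fst (col1 n z)" "snd (col2 n z)"] by auto
    have "cmod ((fst (col1 n z) + snd (col2 n z))\<^sup>2) \<le> (2 * B)\<^sup>2" unfolding norm_power using a1 by (intro power_mono) auto
    hence a2: "cmod (4 - (fst (col1 n z) + snd (col2 n z))\<^sup>2) \<le> 4 + (2 * B)\<^sup>2"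
      using norm_triangle_ineq4[of 4 "(fst (col1 n z) + snd (col2 n z))\<^sup>2"] by simp
    have "cmod (disc n z) \<le> (4 + (2 * B)\<^sup>2) * (inverse (2 * c0))\<^sup>2"
      unfolding disc_def mdisc_def norm_mult norm_power using a2 inv by (intro mult_mono power_mono) auto
    moreover have "cmod (csqrt (disc n z)) \<le> 1 + cmod (disc n z)"
    proof -
      have "cmod (csqrt (disc n z)) = sqrt (cmod (disc n z))" by simp
      also have "\<dots> \<le> 1 + cmod (disc n z)" by (rule real_le_lsqrt) (auto simp: power2_eq_square algebra_simps)
      finally show ?thesis .
    qed
    ultimately have s: "cmod (csqrt (disc n z)) \<le> 1 + (4 + (2 * B)\<^sup>2) * (inverse (2 * c0))\<^sup>2" by simp
    have "cmod (weyl \<sigma> n z) \<le> cmod ((fst (col1 n z) - snd (col2 n z)) * inverse (2 * snd (col1 n z))) + cmod (\<sigma> * \<i> * csqrt (disc n z))"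
      unfolding weyl_def mfix_def disc_def[symmetric] by (rule norm_triangle_ineq)
    also have "\<dots> \<le> BB" unfolding BB_def
    proof (intro add_mono)
      show "cmod ((fst (col1 n z) - snd (col2 n z)) * inverse (2 * snd (col1 n z))) \<le> 2 * B * inverse (2 * c0)"
        unfolding norm_mult[of "fst (col1 n z) - snd (col2 n z)"] using a1(1) inv B by (intro mult_mono) auto
      show "cmod (\<sigma> * \<i> * csqrt (disc n z)) \<le> 1 + (4 + (2 * B)\<^sup>2) * (inverse (2 * c0))\<^sup>2"
        unfolding norm_mult using s that(3) by simp
    qed
    finally show ?thesis .
  qed
  have BB0: "0 \<le> BB" unfolding BB_def using B c0 by simp
  show ?thesis
  proof (rule that[OF r(1) h BB0, of "L0 * (3 * C)"])
    show "0 \<le> L0 * (3 * C)" using L0 C by simp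
    fix n z assume n: "N \<le> n" and z: "z \<in> cbox (Complex c 0) (Complex d r)"
    hence zD: "z \<in> D" by (simp add: D_def)
    show "snd (col1 n z) \<noteq> 0 \<and> 0 < Re (disc n z)" using t21[OF n zD] Redisc[OF n zD] c0 g0 by auto
    show "h \<le> Im (weyl 1 n z) \<and> Im (weyl (-1) n z) \<le> - h" by (rule Im_z[OF n zD])
    fix \<sigma> :: complex assume \<sigma>: "cmod \<sigma> = 1"
    show "cmod (weyl \<sigma> n z) \<le> BB" by (rule wB[OF n zD \<sigma>])
    have dd: "coeff_dist q (shift (n + q) a) (shift (n + q) b) (shift n a) (shift n b) = period_dist n"
      by (simp add: period_dist_def coeff_dist_def abs_minus_commute)
    have "cmod (weyl \<sigma> (n + q) z - weyl \<sigma> n z) \<le> L0 * (3 * C * period_dist n)"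
      by (rule weyl_lip[OF _ n zD zD \<sigma>]) (use n C(2)[OF DR[OF zD] DR[OF zD], of "n + q" n] in \<open>auto simp: Let_def dd\<close>)
    thus "cmod (weyl \<sigma> (n + q) z - weyl \<sigma> n z) \<le> L0 * (3 * C) * period_dist n" by (simp add: mult.assoc)
  qed
qed

end

text \<open>One period in the Floquet coordinates \<open>X\<close>, \<open>Y\<close>. The error \<open>em\<close> is split off as an explicit factor
  because it is merely square summable; only \<open>om\<close> will be summed, and it carries the small ratio
  \<open>Y / X\<close>.\<close>

lemma ratio_step:
  fixes t11 t12 t21 t22 mp mm mp' mm' P Q :: complex
  assumes det: "t21 \<noteq> 0" "t11 * t22 - t21 * t12 = 1"
    and mp: "mp = mfix 1 t11 t21 t22" and mm: "mm = mfix (-1) t11 t21 t22"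
  defines "lm \<equiv> t21 * mm + t22" and "X \<equiv> P - mm * Q" and "Y \<equiv> P - mp * Q"
    and "P' \<equiv> t11 * P + t12 * Q" and "Q' \<equiv> t21 * P + t22 * Q"
    and "ep \<equiv> (mp' - mp) / (mp - mm)" and "em \<equiv> (mm' - mm) / (mp - mm)"
  defines "X' \<equiv> P' - mm' * Q'" and "Y' \<equiv> P' - mp' * Q'"
    and "om \<equiv> em / (1 - em) * (lm\<^sup>2 * (Y / X))"
  assumes X: "X \<noteq> 0" and Y: "cmod Y \<le> C * cmod X" and C: "1 \<le> C" and lm1: "cmod lm \<le> 1"
    and mpm: "mp \<noteq> mm" and small: "cmod ep \<le> \<delta>" "cmod em \<le> \<delta>" "8 * C * \<delta> \<le> 1"
  shows "X' = (t21 * mp + t22) * X * (1 - em) * (1 + om)"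
    and "cmod om \<le> 2 * \<delta> * cmod (Y / X)" and "cmod om \<le> 1 / 4"
    and "cmod (Y' / X') \<le> (cmod lm)\<^sup>2 * cmod (Y / X) + 4 * (1 + C)\<^sup>2 * \<delta>"
proof -
  define lp where "lp = t21 * mp + t22"
  have lplm: "lp * lm = 1" "lp + lm = t11 + t22"
    using mfix_sum_prod[OF det] by (simp_all add: lp_def lm_def mp mm)
  have fp: "t11 * mp + t12 = lp * mp" "t11 * mm + t12 = lm * mm"
    unfolding mp mm lp_def lm_def by (rule mfix_fixed_point; use det in simp)+
  \<comment> \<open>\<open>(1, - mm)\<close> is a left eigenvector of the period matrix, with
    eigenvalue \<open>lp\<close>; in \<open>B\<close> the roles of the fixed points and eigenvalues
    are exchanged.\<close>
  have A: "P' - mm * Q' = lp * X"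
  proof -
    have "t11 - mm * t21 = lp" using lplm(2) by (simp add: lm_def algebra_simps)
    moreover have "t12 - mm * t22 = - (lp * mm)" using fp(2) lplm(2) by (simp add: lm_def algebra_simps) algebra
    moreover have "P' - mm * Q' = (t11 - mm * t21) * P + (t12 - mm * t22) * Q" by (simp add: P'_def Q'_def algebra_simps)
    ultimately have "P' - mm * Q' = lp * P + - (lp * mm) * Q" by (simp only:)
    thus ?thesis by (simp add: X_def algebra_simps)
  qed
  have B: "P' - mp * Q' = lm * Y"
  proof -
    have "t11 - mp * t21 = lm" using lplm(2) by (simp add: lp_def algebra_simps)
    moreover have "t12 - mp * t22 = - (lm * mp)" using fp(1) lplm(2) by (simp add: lp_def algebra_simps) algebra
    moreover have "P' - mp * Q' = (t11 - mp * t21) * P + (t12 - mp * t22) * Q" by (simp add: P'_def Q'_def algebra_simps)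
    ultimately have "P' - mp * Q' = lm * P + - (lm * mp) * Q" by (simp only:)
    thus ?thesis by (simp add: Y_def algebra_simps)
  qed
  \<comment> \<open>The ratio after the period if the fixed points did not move:
    \<open>lm / lp\<close> equals \<open>lm\<^sup>2\<close> because \<open>lp * lm = 1\<close>.
    Everything else in the new ratio is due to \<open>ep\<close> and \<open>em\<close>.\<close>
  define v where "v = lm\<^sup>2 * (Y / X)"
  have lp0: "lp \<noteq> 0" using lplm by auto
  have lmY: "lm * Y = lp * X * v"
  proof -
    have "lp * X * v = (lp * lm) * (lm * (X * (Y / X)))" by (simp add: v_def power2_eq_square)
    thus ?thesis using lplm X by simp
  qed
  have QQ: "(mp - mm) * Q' = lp * X - lm * Y" using A B by (simp add: algebra_simps)
  have e: "em * (mp - mm) = mm' - mm" "ep * (mp - mm) = mp' - mp" using mpm by (auto simp: em_def ep_def)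
  have "X' = (P' - mm * Q') - (mm' - mm) * Q'" by (simp add: X'_def algebra_simps)
  also have "\<dots> = lp * X - em * ((mp - mm) * Q')" unfolding A e(1)[symmetric] by simp
  also have "\<dots> = lp * X * ((1 - em) + em * v)" unfolding QQ lmY by (simp add: algebra_simps)
  finally have X': "X' = lp * X * ((1 - em) + em * v)" .
  have "Y' = (P' - mp * Q') - (mp' - mp) * Q'" by (simp add: Y'_def algebra_simps)
  also have "\<dots> = lm * Y - ep * ((mp - mm) * Q')" unfolding B e(2)[symmetric] by simp
  also have "\<dots> = lp * X * (v + ep * v - ep)" unfolding QQ lmY by (simp add: algebra_simps)
  finally have Y': "Y' = lp * X * (v + ep * v - ep)" .
  have \<delta>0: "0 \<le> \<delta>" using small(1) norm_ge_zero order_trans by blast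
  have "8 * \<delta> \<le> 8 * C * \<delta>" using C \<delta>0 by (simp add: mult_right_mono)
  hence \<delta>8: "8 * \<delta> \<le> 1" using small(3) by linarith
  have em1: "1 / 2 \<le> cmod (1 - em)" using norm_triangle_ineq2[of 1 em] small(2) \<delta>8 by simp
  hence em0: "1 - em \<noteq> 0" by auto
  have rho: "cmod (Y / X) \<le> C" using X Y by (simp add: norm_divide pos_divide_le_eq)
  have lm2: "(cmod lm)\<^sup>2 \<le> 1" using lm1 by (simp add: power_le_one)
  have vr: "cmod v \<le> cmod (Y / X)" unfolding v_def norm_mult norm_power using lm2 by (intro mult_left_le_one_le) auto
  hence vC: "cmod v \<le> C" using rho by linarith
  have omv: "om = em / (1 - em) * v" by (simp add: om_def v_def)
  show "X' = (t21 * mp + t22) * X * (1 - em) * (1 + om)"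
    unfolding X' omv lp_def[symmetric] using em0 by (simp add: field_simps)
  have "cmod (em / (1 - em)) \<le> \<delta> / (1 / 2)" unfolding norm_divide using small(2) em1 \<delta>0 by (intro frac_le) auto
  hence "cmod om \<le> 2 * \<delta> * cmod v" unfolding omv norm_mult by (intro mult_right_mono) auto
  moreover have "2 * \<delta> * cmod v \<le> 2 * \<delta> * cmod (Y / X)" using vr \<delta>0 by (intro mult_left_mono) auto
  moreover have "2 * \<delta> * cmod v \<le> 2 * \<delta> * C" using vC \<delta>0 by (intro mult_left_mono) auto
  ultimately show om1: "cmod om \<le> 2 * \<delta> * cmod (Y / X)" "cmod om \<le> 1 / 4" using small(3) by (simp_all add: mult_ac)
  define D where "D = (1 - em) + em * v"
  have "D = (1 - em) * (1 + om)" using em0 by (simp add: D_def omv field_simps)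
  hence "cmod D = cmod (1 - em) * cmod (1 + om)" by (simp add: norm_mult)
  moreover have "1 / 2 \<le> cmod (1 + om)" using norm_triangle_ineq2[of 1 "- om"] om1(2) by simp
  ultimately have D4: "1 / 4 \<le> cmod D" using em1 mult_mono[of "1/2" "cmod (1 - em)" "1/2" "cmod (1 + om)"] by simp
  hence D0: "D \<noteq> 0" by auto
  have "Y' / X' = (v + ep * v - ep) / D" unfolding X' Y' D_def[symmetric] using lp0 X by simp
  also have "\<dots> = v + (ep * v - ep + em * v - em * v\<^sup>2) / D"
    using D0 by (simp add: field_simps) (simp add: D_def power2_eq_square algebra_simps)
  finally have "cmod (Y' / X') \<le> cmod v + cmod ((ep * v - ep + em * v - em * v\<^sup>2) / D)" by (metis norm_triangle_ineq)
  also have "cmod ((ep * v - ep + em * v - em * v\<^sup>2) / D) \<le> (1 + C)\<^sup>2 * \<delta> / (1 / 4)"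
    unfolding norm_divide
  proof (intro frac_le D4)
    have "cmod (ep * v - ep + em * v - em * v\<^sup>2) \<le> cmod (ep * v) + cmod ep + cmod (em * v) + cmod (em * v\<^sup>2)"
      by (intro norm_triangle_le_diff norm_triangle_le add_mono order_refl norm_triangle_ineq4)
    also have "\<dots> \<le> \<delta> * C + \<delta> + \<delta> * C + \<delta> * C\<^sup>2"
      unfolding norm_mult norm_power using small vC \<delta>0 C by (intro add_mono mult_mono power_mono) auto
    also have "\<dots> = (1 + C)\<^sup>2 * \<delta>" by (simp add: power2_eq_square algebra_simps)
    finally show "cmod (ep * v - ep + em * v - em * v\<^sup>2) \<le> (1 + C)\<^sup>2 * \<delta>" .
  qed (use \<delta>0 in auto)
  finally show "cmod (Y' / X') \<le> (cmod lm)\<^sup>2 * cmod (Y / X) + 4 * (1 + C)\<^sup>2 * \<delta>"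
    by (simp add: v_def norm_mult norm_power norm_divide mult_ac)
qed

section \<open>Square summable errors and contraction in the upper half-plane\<close>

context square_summable_variation
begin

lemma period_dist_sq_summable: "summable (\<lambda>n. (period_dist n)\<^sup>2)"
proof -
  define g where "g = (\<lambda>n. (a (n + q) - a n)\<^sup>2 + (b (n + q) - b n)\<^sup>2)"
  have "summable (\<lambda>n. g (Suc n))" unfolding g_def by (intro summable_add variation_summable)
  hence g: "summable (\<lambda>n. g (n + i))" for i by (simp add: summable_iff_shift summable_Suc_iff)
  have "(period_dist n)\<^sup>2 \<le> 2 * real q * (\<Sum>i=1..q. g (n + i))" for n
  proof -
    have "(period_dist n)\<^sup>2 \<le> (\<Sum>i=1..q. (\<bar>a (n + i) - a (n + q + i)\<bar> + \<bar>b (n + i) - b (n + q + i)\<bar>)\<^sup>2) * real (card {1..q})"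
      unfolding period_dist_def coeff_dist_def shift_def by (rule sum_squared_le_sum_of_squares)
    also have "\<dots> \<le> (\<Sum>i=1..q. 2 * g (n + i)) * real (card {1..q})"
    proof (intro mult_right_mono sum_mono)
      fix i
      have "(\<bar>u\<bar> + \<bar>v\<bar>)\<^sup>2 \<le> 2 * (u\<^sup>2 + v\<^sup>2)" for u v :: real
        using zero_le_power2[of "\<bar>u\<bar> - \<bar>v\<bar>"] by (simp add: power2_diff power2_sum)
      from this[of "a (n + i) - a (n + q + i)" "b (n + i) - b (n + q + i)"]
      show "(\<bar>a (n + i) - a (n + q + i)\<bar> + \<bar>b (n + i) - b (n + q + i)\<bar>)\<^sup>2 \<le> 2 * g (n + i)"
        by (simp add: g_def power2_commute add_ac)
    qed auto
    also have "\<dots> = 2 * real q * (\<Sum>i=1..q. g (n + i))" by (simp add: sum_distrib_left[symmetric])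
    finally show ?thesis .
  qed
  moreover have "summable (\<lambda>n. 2 * real q * (\<Sum>i=1..q. g (n + i)))"
    by (intro summable_mult summable_sum g)
  ultimately show ?thesis
    by (intro summable_comparison_test'[of "\<lambda>n. 2 * real q * (\<Sum>i=1..q. g (n + i))" 0 "\<lambda>n. (period_dist n)\<^sup>2"]) auto
qed

lemma period_dist_sq_sum_le: "(\<Sum>k<n. (period_dist (N + k * q))\<^sup>2) \<le> (\<Sum>n. (period_dist n)\<^sup>2)"
proof -
  have "inj_on (\<lambda>k. N + k * q) {..<n}" using q_pos by (auto simp: inj_on_def)
  hence "(\<Sum>k<n. (period_dist (N + k * q))\<^sup>2) = (\<Sum>m\<in>(\<lambda>k. N + k * q) ` {..<n}. (period_dist m)\<^sup>2)"
    by (simp add: sum.reindex)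
  also have "\<dots> \<le> (\<Sum>n. (period_dist n)\<^sup>2)" by (rule sum_le_suminf[OF period_dist_sq_summable]) auto
  finally show ?thesis .
qed

text \<open>For \<open>Im z > 0\<close> one period maps the closed upper half-plane strictly into itself, so its fixed point
  in the lower half-plane is repelling.\<close>

lemma contracting_eigenvalue:
  assumes nz: "snd (col1 n z) \<noteq> 0" and h: "0 < h" "Im (weyl (-1) n z) \<le> - h" and z: "0 \<le> Im z"
  shows "(cmod (snd (col1 n z) * weyl (-1) n z + snd (col2 n z)))\<^sup>2 \<le> 1 - h * Im z"
proof -
  define m where "m = weyl (-1) n z"
  define lm where "lm = snd (col1 n z) * m + snd (col2 n z)"
  have fp: "fst (col1 n z) * m + fst (col2 n z) = lm * m"
    unfolding m_def lm_def weyl_def by (rule mfix_fixed_point) (use nz monodromy_det[of n z] in auto)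
  \<comment> \<open>Green's identity is applied along the eigenvector \<open>(m, 1)\<close>: the
    start contributes \<open>Im m\<close>, the end \<open>Im m\<close> times the squared modulus of
    the eigenvalue. Of the sum, the term at 0, the squared modulus of \<open>m\<close>, is
    kept.\<close>
  define u where "u = sol (shift n a) (shift n b) z (m, 1) q"
  have u: "fst u = lm * m" "snd u = lm"
    using sol_linear[of "shift n a" "shift n b" z "(m, 1)" q] fp unfolding u_def by (auto simp: lm_def mult_ac)
  have "Im (fst u * cnj (snd u)) = Im m + Im z * (\<Sum>k<q. (cmod (fst (sol (shift n a) (shift n b) z (m, 1) k)))\<^sup>2)"
    unfolding u_def using sol_Im[of q "shift n a" "shift n b" z "(m, 1)"] shift_nz by simp
  moreover have "(cmod m)\<^sup>2 \<le> (\<Sum>k<q. (cmod (fst (sol (shift n a) (shift n b) z (m, 1) k)))\<^sup>2)"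
    using member_le_sum[of 0 "{..<q}" "\<lambda>k. (cmod (fst (sol (shift n a) (shift n b) z (m, 1) k)))\<^sup>2"] q_pos by simp
  moreover have "(Im m)\<^sup>2 \<le> (cmod m)\<^sup>2" by (simp add: cmod_power2)
  ultimately have 1: "Im m + Im z * (Im m)\<^sup>2 \<le> Im (fst u * cnj (snd u))"
    using z by (smt (verit) mult_left_mono)
  have "fst u * cnj (snd u) = m * (lm * cnj lm)" unfolding u by simp
  hence "Im (fst u * cnj (snd u)) = Im m * (cmod lm)\<^sup>2" unfolding complex_norm_square[symmetric] by simp
  with 1 have 2: "Im m + Im z * (Im m)\<^sup>2 \<le> Im m * (cmod lm)\<^sup>2" by simp
  define w where "w = - Im m"
  have w: "h \<le> w" "0 < w" using h by (auto simp: w_def m_def)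
  have "w * (cmod lm)\<^sup>2 \<le> w * (1 - Im z * w)" using 2 by (simp add: w_def power2_eq_square algebra_simps)
  hence "(cmod lm)\<^sup>2 \<le> 1 - Im z * w" using w by simp
  also have "\<dots> \<le> 1 - h * Im z" using mult_right_mono[OF w(1) z] by (simp add: mult.commute)
  finally show ?thesis by (simp add: lm_def m_def)
qed

lemma weyl_holomorphic:
  assumes "\<And>z. z \<in> A \<Longrightarrow> snd (col1 n z) \<noteq> 0 \<and> 0 < Re (disc n z)"
  shows "weyl \<sigma> n holomorphic_on A"
proof -
  have h: "(\<lambda>z. fst (col1 n z)) holomorphic_on A" "(\<lambda>z. snd (col1 n z)) holomorphic_on A"
    "(\<lambda>z. fst (col2 n z)) holomorphic_on A" "(\<lambda>z. snd (col2 n z)) holomorphic_on A"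
    using holomorphic_on_sol[of q "shift n a" "shift n b" _ A] shift_nz by blast+
  have "disc n z \<notin> \<real>\<^sub>\<le>\<^sub>0" if "z \<in> A" for z using assms[OF that] by (auto simp: complex_nonpos_Reals_iff)
  thus ?thesis
    unfolding weyl_def[abs_def] mfix_def disc_def mdisc_def using assms
    by (intro holomorphic_intros h) auto
qed

text \<open>With real entries and positive radicand the root is real, so the two fixed points are
  conjugate. So are the two eigenvalues, whose product is 1.\<close>

lemma weyl_real:
  assumes nz: "snd (col1 n (complex_of_real x)) \<noteq> 0" and disc: "0 < Re (disc n (of_real x))"
  shows "weyl (-1) n (of_real x) = cnj (weyl 1 n (of_real x))"
    and "cmod (snd (col1 n (of_real x)) * weyl 1 n (of_real x) + snd (col2 n (of_real x))) = 1"
proof -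
  define t11 t21 t22 where t: "t11 = fst (col1 n x)" "t21 = snd (col1 n x)" "t22 = snd (col2 n x)"
  have ct: "fst (col1 n (of_real x :: complex)) = of_real t11"
      "snd (col1 n (of_real x :: complex)) = of_real t21" "snd (col2 n (of_real x :: complex)) = of_real t22"
    by (simp_all add: t sol_of_real_10 sol_of_real_01)
  define g where "g = (4 - (t11 + t22)\<^sup>2) * (inverse (2 * t21))\<^sup>2"
  have dg: "disc n (of_real x) = of_real g" unfolding disc_def mdisc_def ct g_def by simp
  hence "0 \<le> g" using disc by simp
  hence s: "csqrt (disc n (of_real x)) = of_real (sqrt g)" unfolding dg by simp
  have s': "csqrt (mdisc (of_real t11) (of_real t21) (of_real t22)) = of_real (sqrt g)"
    using s unfolding disc_def ct .
  have w: "weyl \<sigma> n (of_real x) = of_real ((t11 - t22) * inverse (2 * t21)) + \<sigma> * \<i> * of_real (sqrt g)" for \<sigma>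
    unfolding weyl_def mfix_def ct s' by simp
  show c: "weyl (-1) n (of_real x) = cnj (weyl 1 n (of_real x))" unfolding w by simp
  let ?l = "snd (col1 n (of_real x)) * weyl 1 n (of_real x) + snd (col2 n (of_real x :: complex))"
  have "cnj ?l = snd (col1 n (of_real x)) * weyl (-1) n (of_real x) + snd (col2 n (of_real x))"
    unfolding c ct by simp
  hence "?l * cnj ?l = 1"
    using mfix_sum_prod(2)[OF nz, of "fst (col1 n (of_real x))" "snd (col2 n (of_real x))" "fst (col2 n (of_real x))"] monodromy_det[of n "complex_of_real x"]
    by (simp add: weyl_def)
  hence "(cmod ?l)\<^sup>2 = 1" unfolding complex_norm_square[symmetric] by (metis of_real_eq_1_iff)
  thus "cmod ?l = 1" by (simp add: power2_eq_1_iff) (smt (verit) norm_ge_zero)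
qed

end

text \<open>The factor \<open>Im m' / Im m\<close> telescopes along the orbit, which leaves an error quadratic in the
  variation.\<close>

lemma conj_ratio_bound:
  fixes m m' :: complex
  assumes h: "0 < h" "h \<le> Im m" "h \<le> Im m'" and d: "cmod (m' - m) \<le> e"
  shows "(cmod (1 - (cnj m' - cnj m) / (m - cnj m)))\<^sup>2 \<le> Im m' / Im m * exp (e\<^sup>2 / (4 * h\<^sup>2))"
proof -
  have mm: "m - cnj m = 2 * \<i> * of_real (Im m)" by (simp add: complex_eq_iff)
  have im: "0 < Im m" "0 < Im m'" using h by auto
  have nzm: "m - cnj m \<noteq> 0" unfolding mm using im by simp
  have e0: "0 \<le> e" using d norm_ge_zero order_trans by blast
  have "1 - (cnj m' - cnj m) / (m - cnj m) = (m - cnj m') / (m - cnj m)" using nzm by (simp add: field_simps)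
  hence "(cmod (1 - (cnj m' - cnj m) / (m - cnj m)))\<^sup>2 = (cmod (m - cnj m'))\<^sup>2 / (2 * Im m)\<^sup>2"
    unfolding mm using im by (simp add: norm_divide norm_mult power_divide)
  also have "(cmod (m - cnj m'))\<^sup>2 = 4 * Im m * Im m' + (cmod (m' - m))\<^sup>2"
    unfolding cmod_power2 by (simp add: power2_eq_square algebra_simps)
  also have "\<dots> \<le> 4 * Im m * Im m' + e\<^sup>2" using d by (simp add: power_mono)
  also have "e\<^sup>2 \<le> 4 * Im m * Im m' * (e\<^sup>2 / (4 * h\<^sup>2))"
  proof -
    have "h * h \<le> Im m * Im m'" using h by (intro mult_mono) auto
    hence "e\<^sup>2 * h\<^sup>2 \<le> e\<^sup>2 * (Im m * Im m')" by (intro mult_left_mono) (auto simp: power2_eq_square)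
    thus ?thesis using h by (simp add: field_simps)
  qed
  finally have "(cmod (1 - (cnj m' - cnj m) / (m - cnj m)))\<^sup>2 \<le> (4 * Im m * Im m' + 4 * Im m * Im m' * (e\<^sup>2 / (4 * h\<^sup>2))) / (2 * Im m)\<^sup>2"
    by (simp add: divide_right_mono)
  also have "\<dots> = Im m' / Im m * (1 + e\<^sup>2 / (4 * h\<^sup>2))" using im by (simp add: power2_eq_square field_simps)
  also have "\<dots> \<le> Im m' / Im m * exp (e\<^sup>2 / (4 * h\<^sup>2))" using im by (intro mult_left_mono exp_ge_add_one_self) auto
  finally show ?thesis .
qed

section \<open>The logarithmic bound on the orthonormal polynomials\<close>

context square_summable_variation
begin

lemma continuous_on_opvec_norm: "continuous_on A (\<lambda>x::real. (norm (opvec a b x n))\<^sup>2)"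
  unfolding norm_prod_sq
  using continuous_on_sol[OF continuous_on_id, of n a A b "(1, 0)"] a_nonzero
  by (intro continuous_intros) auto

text \<open>On the real line \<open>Y / X\<close> does not contract, so there is no uniform
  pointwise bound on \<open>Re (\<Phi> k)\<close>; its weighted integral is controlled from the
  upper half-plane instead. The remaining factors of \<open>X\<close> are bounded pointwise on the
  real interval, and \<open>X\<close> in turn bounds the norm of the solution.\<close>

lemma log_norm_bound:
  assumes cd: "c < d" and \<eta>: "0 < \<eta>" and tr: "\<And>n x. N \<le> n \<Longrightarrow> x \<in> {c..d} \<Longrightarrow> \<bar>tr n x\<bar> \<le> 2 - \<eta>"
  obtains C m where
    "\<And>k. integral {c..d} (\<lambda>x. (x - c) * (d - x) * ln ((norm (opvec a b x (m + k * q)))\<^sup>2)) \<le> C"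
proof -
  obtain r h B L where rh: "0 < r" "0 < h" "0 \<le> B" "0 \<le> L" and
    nz: "\<And>n z. N \<le> n \<Longrightarrow> z \<in> cbox (Complex c 0) (Complex d r) \<Longrightarrow> snd (col1 n z) \<noteq> 0 \<and> 0 < Re (disc n z)" and
    Im: "\<And>n z. N \<le> n \<Longrightarrow> z \<in> cbox (Complex c 0) (Complex d r) \<Longrightarrow> h \<le> Im (weyl 1 n z) \<and> Im (weyl (-1) n z) \<le> - h" and
    wB: "\<And>n z \<sigma>. N \<le> n \<Longrightarrow> z \<in> cbox (Complex c 0) (Complex d r) \<Longrightarrow> cmod \<sigma> = 1 \<Longrightarrow> cmod (weyl \<sigma> n z) \<le> B" and
    wL: "\<And>n z \<sigma>. N \<le> n \<Longrightarrow> z \<in> cbox (Complex c 0) (Complex d r) \<Longrightarrow> cmod \<sigma> = 1 \<Longrightarrow> cmod (weyl \<sigma> (n + q) z - weyl \<sigma> n z) \<le> L * period_dist n"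
    using weyl_uniform[OF cd \<eta> tr] by blast
  define D where "D = cbox (Complex c 0) (Complex d r)"
  \<comment> \<open>\<open>Y\<close> and \<open>X\<close> differ by \<open>(mp - mm) * Q\<close>,
    where the fixed points are at most \<open>2 * B\<close> apart and \<open>h * cmod Q\<close> is
    at most \<open>cmod X\<close>; this gives \<open>C0\<close> as a bound for the ratio. They are
    also at least \<open>2 * h\<close> apart, which gives \<open>L1\<close>. The threshold with 8 is
    the smallness required in \<open>ratio_step\<close>.\<close>
  define C0 where "C0 = 1 + 2 * B / h"
  have C0: "1 \<le> C0" using rh by (simp add: C0_def)
  define L1 where "L1 = L / (2 * h)"
  have L1: "0 \<le> L1" using rh by (simp add: L1_def)
  have "(\<lambda>n. 8 * C0 * (L1 * period_dist n)) \<longlonglongrightarrow> 8 * C0 * (L1 * 0)" by (intro tendsto_intros period_dist_tendsto)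
  hence "\<forall>\<^sub>F n in sequentially. 8 * C0 * (L1 * period_dist n) < 1" by (auto dest: order_tendstoD(2)[where a = 1])
  then obtain N2 where N2: "\<And>n. N2 \<le> n \<Longrightarrow> 8 * C0 * (L1 * period_dist n) < 1" by (auto simp: eventually_sequentially)
  define m where "m = max N N2"
  define nn where "nn = (\<lambda>k. m + k * q)"
  have nnN: "N \<le> nn k" and nnN2: "N2 \<le> nn k" and nnS: "nn (Suc k) = nn k + q" for k
    by (auto simp: nn_def m_def trans_le_add1)
  define e where "e = (\<lambda>k. period_dist (nn k))"
  have e0: "0 \<le> e k" for k by (simp add: e_def period_dist_nonneg)
  have e1: "8 * C0 * (L1 * e k) \<le> 1" for k using N2[OF nnN2[of k]] by (simp add: e_def)
  define S where "S = (\<Sum>n. (period_dist n)\<^sup>2)"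
  have eS: "(\<Sum>k<n. (e k)\<^sup>2) \<le> S" for n unfolding e_def nn_def S_def by (rule period_dist_sq_sum_le)
  have S0: "0 \<le> S" using eS[of 0] by simp
  define mp where "mp = (\<lambda>k. weyl 1 (nn k))"
  define mm where "mm = (\<lambda>k. weyl (-1) (nn k))"
  define P where "P = (\<lambda>k (z::complex). fst (opvec a b z (nn k)))"
  define Q where "Q = (\<lambda>k (z::complex). snd (opvec a b z (nn k)))"
  define X where "X = (\<lambda>k z. P k z - mm k z * Q k z)"
  define Y where "Y = (\<lambda>k z. P k z - mp k z * Q k z)"
  define lm where "lm = (\<lambda>k z. snd (col1 (nn k) z) * mm k z + snd (col2 (nn k) z))"
  define lp where "lp = (\<lambda>k z. snd (col1 (nn k) z) * mp k z + snd (col2 (nn k) z))"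
  define em where "em = (\<lambda>k z. (mm (Suc k) z - mm k z) / (mp k z - mm k z))"
  define ep where "ep = (\<lambda>k z. (mp (Suc k) z - mp k z) / (mp k z - mm k z))"
  define om where "om = (\<lambda>k z. em k z / (1 - em k z) * ((lm k z)\<^sup>2 * (Y k z / X k z)))"
  have Im0: "0 \<le> Im z" if "z \<in> D" for z using that by (auto simp: D_def in_cbox_complex_iff)
  have mB: "cmod (mp k z) \<le> B" "cmod (mm k z) \<le> B" if "z \<in> D" for k z
    using wB[OF nnN that[unfolded D_def]] by (auto simp: mp_def mm_def)
  have mI: "h \<le> Im (mp k z)" "Im (mm k z) \<le> - h" if "z \<in> D" for k z
    using Im[OF nnN that[unfolded D_def]] by (auto simp: mp_def mm_def)
  have dm: "2 * h \<le> cmod (mp k z - mm k z)" if "z \<in> D" for k z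
    using mI[OF that, of k] abs_Im_le_cmod[of "mp k z - mm k z"] by simp
  have mpm: "mp k z \<noteq> mm k z" if "z \<in> D" for k z using dm[OF that, of k] rh by auto
  have emB: "cmod (em k z) \<le> L1 * e k" "cmod (ep k z) \<le> L1 * e k" if "z \<in> D" for k z
  proof -
    have "cmod (mm (Suc k) z - mm k z) \<le> L * e k" "cmod (mp (Suc k) z - mp k z) \<le> L * e k"
      using wL[OF nnN that[unfolded D_def], of _ k] by (auto simp: mm_def mp_def nnS e_def)
    hence "cmod (em k z) \<le> L * e k / (2 * h)" "cmod (ep k z) \<le> L * e k / (2 * h)"
      unfolding em_def ep_def norm_divide using dm[OF that, of k] rh e0 by (auto intro!: frac_le)
    thus "cmod (em k z) \<le> L1 * e k" "cmod (ep k z) \<le> L1 * e k" by (simp_all add: L1_def)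
  qed
  \<comment> \<open>By Green's identity \<open>P / Q\<close> lies in the closed upper half-plane,
    whereas \<open>mm\<close> lies at depth at least \<open>h\<close> below the real axis. So
    \<open>X / Q\<close> has modulus at least \<open>h\<close>.\<close>
  have hQ: "h * cmod (Q k z) \<le> cmod (X k z)" if z: "z \<in> D" for k z
  proof (cases "Q k z = 0")
    case False
    have "0 \<le> Im (P k z * cnj (Q k z))"
      unfolding P_def Q_def using sol_Im[of "nn k" a b z "(1, 0)"] a_nonzero Im0[OF z]
      by (simp add: sum_nonneg)
    moreover have "X k z * cnj (Q k z) = P k z * cnj (Q k z) - mm k z * of_real ((cmod (Q k z))\<^sup>2)"
      unfolding complex_norm_square X_def by (simp add: algebra_simps)
    hence "Im (X k z * cnj (Q k z)) = Im (P k z * cnj (Q k z)) - Im (mm k z) * (cmod (Q k z))\<^sup>2" by simp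
    moreover have "h * (cmod (Q k z))\<^sup>2 \<le> - Im (mm k z) * (cmod (Q k z))\<^sup>2"
      using mI(2)[OF z, of k] by (intro mult_right_mono) auto
    ultimately have "h * (cmod (Q k z))\<^sup>2 \<le> Im (X k z * cnj (Q k z))" by simp
    also have "\<dots> \<le> cmod (X k z * cnj (Q k z))" using abs_Im_le_cmod abs_le_D1 by blast
    also have "\<dots> = cmod (X k z) * cmod (Q k z)" by (simp add: norm_mult)
    finally have "(h * cmod (Q k z)) * cmod (Q k z) \<le> cmod (X k z) * cmod (Q k z)" by (simp add: power2_eq_square)
    thus ?thesis using False by simp
  qed simp
  have X0: "X k z \<noteq> 0" if z: "z \<in> D" for k z
  proof
    assume "X k z = 0"
    moreover from this have "Q k z = 0" using hQ[OF z, of k] rh by (simp add: mult_le_0_iff)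
    ultimately have "P k z = 0" by (simp add: X_def)
    with \<open>Q k z = 0\<close> show False
      using sol_wronskian[of "nn k" a b z "(1, 0)" "(0, 1)"] a_nonzero by (simp add: P_def Q_def)
  qed
  have YX: "cmod (Y k z) \<le> C0 * cmod (X k z)" if z: "z \<in> D" for k z
  proof -
    have "Y k z = X k z - (mp k z - mm k z) * Q k z" by (simp add: X_def Y_def algebra_simps)
    hence "cmod (Y k z) \<le> cmod (X k z) + cmod (mp k z - mm k z) * cmod (Q k z)" by (metis norm_mult norm_triangle_ineq4)
    also have "\<dots> \<le> cmod (X k z) + (2 * B) * (cmod (X k z) / h)"
      using hQ[OF z, of k] mB[OF z, of k] rh norm_triangle_ineq4[of "mp k z" "mm k z"]
      by (intro add_left_mono mult_mono) (auto simp: field_simps)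
    finally show ?thesis by (simp add: C0_def algebra_simps)
  qed
  have lm2: "(cmod (lm k z))\<^sup>2 \<le> 1 - h * Im z" if z: "z \<in> D" for k z
    unfolding lm_def mm_def
    by (rule contracting_eigenvalue) (use nz[OF nnN z[unfolded D_def]] rh mI(2)[OF z, of k] Im0[OF z] in \<open>auto simp: mm_def\<close>)
  have lm1: "cmod (lm k z) \<le> 1" if z: "z \<in> D" for k z
  proof -
    have "(cmod (lm k z))\<^sup>2 \<le> 1" using lm2[OF z, of k] rh Im0[OF z] by (smt (verit) mult_nonneg_nonneg)
    thus ?thesis by (simp add: power2_le_iff_abs_le abs_square_le_1)
  qed
  have PQ: "P (Suc k) z = fst (col1 (nn k) z) * P k z + fst (col2 (nn k) z) * Q k z"
    "Q (Suc k) z = snd (col1 (nn k) z) * P k z + snd (col2 (nn k) z) * Q k z" for k z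
    unfolding P_def Q_def nnS by (rule opvec_step)+
  have step: "X (Suc k) z = lp k z * X k z * (1 - em k z) * (1 + om k z)"
    "cmod (om k z) \<le> 2 * (L1 * e k) * cmod (Y k z / X k z)" "cmod (om k z) \<le> 1 / 4"
    "cmod (Y (Suc k) z / X (Suc k) z) \<le> (cmod (lm k z))\<^sup>2 * cmod (Y k z / X k z) + 4 * (1 + C0)\<^sup>2 * (L1 * e k)"
    if z: "z \<in> D" for k z
  proof -
    have d: "snd (col1 (nn k) z) \<noteq> 0" using nz[OF nnN z[unfolded D_def]] by blast
    have mpe: "mp k z = mfix 1 (fst (col1 (nn k) z)) (snd (col1 (nn k) z)) (snd (col2 (nn k) z))"
      and mme: "mm k z = mfix (-1) (fst (col1 (nn k) z)) (snd (col1 (nn k) z)) (snd (col2 (nn k) z))"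
      by (simp_all add: mp_def mm_def weyl_def)
    note rs = ratio_step[where P = "P k z" and Q = "Q k z" and C = C0 and \<delta> = "L1 * e k" and mp' = "mp (Suc k) z"
        and mm' = "mm (Suc k) z", OF d monodromy_det mpe mme X0[OF z, unfolded X_def] YX[OF z, unfolded X_def Y_def] C0
        lm1[OF z, unfolded lm_def] mpm[OF z] emB(2)[OF z, unfolded ep_def] emB(1)[OF z, unfolded em_def] e1]
    show "X (Suc k) z = lp k z * X k z * (1 - em k z) * (1 + om k z)"
      unfolding om_def unfolding X_def Y_def em_def lm_def lp_def PQ by (rule rs(1))
    show "cmod (om k z) \<le> 2 * (L1 * e k) * cmod (Y k z / X k z)"
      unfolding om_def unfolding X_def Y_def em_def lm_def by (rule rs(2))
    show "cmod (om k z) \<le> 1 / 4"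
      unfolding om_def unfolding X_def Y_def em_def lm_def by (rule rs(3))
    show "cmod (Y (Suc k) z / X (Suc k) z) \<le> (cmod (lm k z))\<^sup>2 * cmod (Y k z / X k z) + 4 * (1 + C0)\<^sup>2 * (L1 * e k)"
      unfolding X_def Y_def lm_def PQ by (rule rs(4))
  qed
  \<comment> \<open>Only the factors \<open>1 + om\<close> go into the exponent. They lie within 1/4
    of 1, so the principal logarithm is analytic and of the size of \<open>om\<close>.\<close>
  define \<Phi> where "\<Phi> = (\<lambda>k z. \<Sum>j<k. Ln (1 + om j z))"
  define A where "A = 4 * (1 + C0)\<^sup>2 * L1"
  define K where "K = 4 * L1 * ((S + C0\<^sup>2 + A\<^sup>2 * S) / h)"
  have \<Phi>_bound: "cmod (\<Phi> k z) \<le> K / Im z" if z: "z \<in> D" and y: "0 < Im z" for k z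
  proof -
    define rho where "rho = (\<lambda>j. cmod (Y j z / X j z))"
    \<comment> \<open>The upper bound is read off from \<open>lm2\<close>, whose left-hand side is a
      square.\<close>
    have s: "0 < h * Im z" "h * Im z \<le> 1"
      using rh y lm2[OF z, of 0] zero_le_power2[of "cmod (lm 0 z)"] by (simp, linarith)
    have w: "(\<Sum>j<k. e j * rho j) \<le> (S + C0\<^sup>2 + A\<^sup>2 * S) / (h * Im z)"
    proof (rule weighted_sum_bound[OF _ _ eS s])
      show "0 \<le> rho j" for j by (simp add: rho_def)
      show "rho 0 \<le> C0" using YX[OF z, of 0] X0[OF z, of 0] by (simp add: rho_def norm_divide pos_divide_le_eq)
      show "rho (Suc j) \<le> (1 - h * Im z) * rho j + A * e j" for j
        using step(4)[OF z, of j] mult_right_mono[OF lm2[OF z, of j], of "rho j"] by (simp add: rho_def A_def mult.assoc)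
    qed
    have "cmod (\<Phi> k z) \<le> (\<Sum>j<k. cmod (Ln (1 + om j z)))" unfolding \<Phi>_def by (rule norm_sum)
    also have "\<dots> \<le> (\<Sum>j<k. 4 * L1 * (e j * rho j))"
    proof (rule sum_mono)
      fix j
      have "cmod (Ln (1 + om j z)) \<le> 2 * cmod (om j z)" by (rule norm_Ln_le) (use step(3)[OF z, of j] in simp)
      also have "\<dots> \<le> 4 * L1 * (e j * rho j)" using step(2)[OF z, of j] by (simp add: rho_def mult.assoc)
      finally show "cmod (Ln (1 + om j z)) \<le> 4 * L1 * (e j * rho j)" .
    qed
    also have "\<dots> = 4 * L1 * (\<Sum>j<k. e j * rho j)" by (simp add: sum_distrib_left)
    also have "\<dots> \<le> 4 * L1 * ((S + C0\<^sup>2 + A\<^sup>2 * S) / (h * Im z))" using w L1 by (intro mult_left_mono) auto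
    finally show ?thesis by (simp add: K_def)
  qed
  have K0: "0 \<le> K" unfolding K_def using L1 S0 rh by simp
  have hol: "\<Phi> k holomorphic_on D" for k
  proof -
    have hP: "P j holomorphic_on D" "Q j holomorphic_on D" for j
      unfolding P_def Q_def using holomorphic_on_sol[of "nn j" a b "(1, 0)" D] a_nonzero by auto
    have hm: "mp j holomorphic_on D" "mm j holomorphic_on D" for j
      unfolding mp_def mm_def by (rule weyl_holomorphic; use nz[OF nnN] in \<open>simp add: D_def\<close>)+
    have hc: "(\<lambda>z. snd (col1 n z)) holomorphic_on D" "(\<lambda>z. snd (col2 n z)) holomorphic_on D" for n
      using holomorphic_on_sol[of q "shift n a" "shift n b" _ D] shift_nz by blast+
    have hX: "X j holomorphic_on D" "Y j holomorphic_on D" for j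
      unfolding X_def Y_def by (intro holomorphic_intros hP hm)+
    have hl: "lm j holomorphic_on D" for j unfolding lm_def by (intro holomorphic_intros hc hm)
    have hem: "em j holomorphic_on D" for j
      unfolding em_def using mpm by (intro holomorphic_intros hm) auto
    have em1: "em j z \<noteq> 1" if "z \<in> D" for j z
    proof
      assume "em j z = 1"
      hence "1 \<le> L1 * e j" using emB(1)[OF that, of j] by simp
      moreover have "L1 * e j \<le> C0 * (L1 * e j)" using mult_right_mono[of 1 C0 "L1 * e j"] C0 L1 e0[of j] by simp
      ultimately show False using e1[of j] by linarith
    qed
    have hom: "om j holomorphic_on D" for j
      unfolding om_def using em1 X0 by (intro holomorphic_intros hem hl hX) auto
    have "1 + om j z \<notin> \<real>\<^sub>\<le>\<^sub>0" if "z \<in> D" for j z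
    proof -
      have "\<bar>Re (om j z)\<bar> \<le> 1 / 4" using step(3)[OF that, of j] abs_Re_le_cmod[of "om j z"] by linarith
      thus ?thesis by (auto simp: complex_nonpos_Reals_iff)
    qed
    thus ?thesis unfolding \<Phi>_def by (intro holomorphic_intros hom) auto
  qed
  have cont: "continuous_on D (\<Phi> k)" for k by (rule holomorphic_on_imp_continuous_on[OF hol])
  have int\<Phi>: "\<bar>integral {c..d} (\<lambda>x. (x - c) * (d - x) * Re (\<Phi> k (of_real x)))\<bar> \<le> 2 * K * (d - c + r) ^ 3 / r" for k
  proof (rule weighted_integral_bound[OF cd rh(1) K0])
    show "continuous_on (cbox (Complex c 0) (Complex d r)) (\<Phi> k)" using cont by (simp add: D_def)
    show "\<Phi> k holomorphic_on box (Complex c 0) (Complex d r)"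
      by (rule holomorphic_on_subset[OF hol]) (auto simp: D_def box_subset_cbox[THEN subsetD])
  qed (use \<Phi>_bound in \<open>auto simp: D_def\<close>)
  have xD: "complex_of_real x \<in> D" if "x \<in> {c..d}" for x using that rh by (auto simp: D_def in_cbox_complex_iff)
  define hh where "hh = (\<lambda>k x. Im (mp k (complex_of_real x)))"
  define T where "T = L\<^sup>2 / (4 * h\<^sup>2)"
  have T0: "0 \<le> T" by (simp add: T_def)
  \<comment> \<open>On the real line \<open>lp\<close> has modulus one, and
    \<open>conj_ratio_bound\<close> replaces each factor \<open>1 - em\<close> by a quotient of
    consecutive values of \<open>hh\<close>. The product of these quotients telescopes to
    \<open>hh k x / hh 0 x\<close>; the exponential of the square sum is all that remains of the
    variation.\<close>
  have Xk: "(cmod (X k (of_real x)))\<^sup>2 \<le> (cmod (X 0 (of_real x)))\<^sup>2 * (hh k x / hh 0 x) * exp (T * (\<Sum>j<k. (e j)\<^sup>2)) * exp (2 * Re (\<Phi> k (of_real x)))"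
    if x: "x \<in> {c..d}" for k x
  proof (induction k)
    case 0
    have "hh 0 x \<noteq> 0" using mI(1)[OF xD[OF x], of 0] rh by (simp add: hh_def)
    thus ?case by (simp add: \<Phi>_def)
  next
    case (Suc k)
    let ?z = "complex_of_real x"
    note z = xD[OF x]
    have hp: "0 < hh j x" for j using mI(1)[OF z, of j] rh by (simp add: hh_def)
    have cc: "mm j ?z = cnj (mp j ?z)" for j
      unfolding mm_def mp_def by (rule weyl_real(1)) (use nz[OF nnN z[unfolded D_def]] in auto)
    have lp1: "cmod (lp k ?z) = 1"
      unfolding lp_def mp_def by (rule weyl_real(2)) (use nz[OF nnN z[unfolded D_def]] in auto)
    have "cmod (mp (Suc k) ?z - mp k ?z) \<le> L * e k"
      using wL[OF nnN z[unfolded D_def], of 1 k] by (simp add: mp_def nnS e_def)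
    from conj_ratio_bound[OF rh(2) mI(1)[OF z] mI(1)[OF z] this]
    have "(cmod (1 - em k ?z))\<^sup>2 \<le> hh (Suc k) x / hh k x * exp ((L * e k)\<^sup>2 / (4 * h\<^sup>2))"
      unfolding em_def cc hh_def by simp
    also have "(L * e k)\<^sup>2 / (4 * h\<^sup>2) = T * (e k)\<^sup>2" by (simp add: T_def power_mult_distrib)
    finally have em2: "(cmod (1 - em k ?z))\<^sup>2 \<le> hh (Suc k) x / hh k x * exp (T * (e k)\<^sup>2)" .
    have "1 + om k ?z \<noteq> 0"
    proof
      assume "1 + om k ?z = 0"
      hence "om k ?z = - 1" by (simp add: eq_neg_iff_add_eq_0 add.commute)
      thus False using step(3)[OF z, of k] by simp
    qed
    hence "cmod (1 + om k ?z) = exp (Re (Ln (1 + om k ?z)))" by (metis exp_Ln norm_exp_eq_Re)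
    hence om2: "(cmod (1 + om k ?z))\<^sup>2 = exp (2 * Re (Ln (1 + om k ?z)))" by (simp add: exp_double)
    have "(cmod (X (Suc k) ?z))\<^sup>2 = (cmod (X k ?z))\<^sup>2 * (cmod (1 - em k ?z))\<^sup>2 * exp (2 * Re (Ln (1 + om k ?z)))"
      unfolding step(1)[OF z] norm_mult lp1 power_mult_distrib om2 by simp
    also have "\<dots> \<le> ((cmod (X 0 ?z))\<^sup>2 * (hh k x / hh 0 x) * exp (T * (\<Sum>j<k. (e j)\<^sup>2)) * exp (2 * Re (\<Phi> k ?z))) *
        (hh (Suc k) x / hh k x * exp (T * (e k)\<^sup>2)) * exp (2 * Re (Ln (1 + om k ?z)))"
      using Suc em2 hp[of k] hp[of 0] by (intro mult_right_mono mult_mono) auto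
    also have "\<dots> = (cmod (X 0 ?z))\<^sup>2 * (hh (Suc k) x / hh 0 x) * (exp (T * (\<Sum>j<k. (e j)\<^sup>2)) * exp (T * (e k)\<^sup>2)) *
        (exp (2 * Re (\<Phi> k ?z)) * exp (2 * Re (Ln (1 + om k ?z))))"
      using hp[of k] hp[of 0] by (simp add: field_simps)
    also have "exp (T * (\<Sum>j<k. (e j)\<^sup>2)) * exp (T * (e k)\<^sup>2) = exp (T * (\<Sum>j<Suc k. (e j)\<^sup>2))"
      by (simp add: exp_add[symmetric] algebra_simps)
    also have "exp (2 * Re (\<Phi> k ?z)) * exp (2 * Re (Ln (1 + om k ?z))) = exp (2 * Re (\<Phi> (Suc k) ?z))"
      by (simp add: exp_add[symmetric] \<Phi>_def algebra_simps)
    finally show ?case .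
  qed
  have "compact ((\<lambda>x. X 0 (complex_of_real x)) ` {c..d})"
  proof (intro compact_continuous_image compact_Icc)
    have "X 0 holomorphic_on D"
      unfolding X_def P_def Q_def mm_def
      by (intro holomorphic_intros weyl_holomorphic holomorphic_on_sol) (use nz[OF nnN] a_nonzero in \<open>auto simp: D_def\<close>)
    thus "continuous_on {c..d} (\<lambda>x. X 0 (complex_of_real x))"
      by (rule continuous_on_compose2[OF holomorphic_on_imp_continuous_on]) (use xD in \<open>auto intro: continuous_intros\<close>)
  qed
  then obtain X0B where X0B: "\<And>x. x \<in> {c..d} \<Longrightarrow> cmod (X 0 (of_real x)) \<le> X0B"
    by (metis bounded_iff compact_imp_bounded imageI)
  define V where "V = (\<lambda>k (x::real). (norm (opvec a b x (nn k)))\<^sup>2)"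
  have Vpos: "0 < V k x" for k x unfolding V_def by (rule opvec_norm_pos)
  \<comment> \<open>The added ones make \<open>E\<close> positive, so that its logarithm can be
    taken.\<close>
  define E where "E = (1 + (1 + B / h)\<^sup>2 + (1 / h)\<^sup>2) * ((1 + X0B\<^sup>2) * (1 + B / h) * exp (T * S))"
  have E0: "0 < E" unfolding E_def using rh by (intro mult_pos_pos add_pos_nonneg) auto
  have VE: "ln (V k x) \<le> ln E + 2 * Re (\<Phi> k (of_real x))" if x: "x \<in> {c..d}" for k x
  proof -
    let ?z = "complex_of_real x"
    note z = xD[OF x]
    have hp: "h \<le> hh j x" "hh j x \<le> B" for j
      using mI(1)[OF z, of j] mB(1)[OF z, of j] abs_Im_le_cmod[of "mp j ?z"] by (auto simp: hh_def)
    have Vc: "V k x = (cmod (P k ?z))\<^sup>2 + (cmod (Q k ?z))\<^sup>2"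
      by (simp add: V_def P_def Q_def sol_of_real_10 norm_prod_sq)
    have Q1: "cmod (Q k ?z) \<le> 1 / h * cmod (X k ?z)" using hQ[OF z, of k] rh by (simp add: field_simps)
    have "P k ?z = X k ?z + mm k ?z * Q k ?z" by (simp add: X_def)
    hence "cmod (P k ?z) \<le> cmod (X k ?z) + cmod (mm k ?z) * cmod (Q k ?z)" by (metis norm_mult norm_triangle_ineq)
    also have "\<dots> \<le> cmod (X k ?z) + B * (1 / h * cmod (X k ?z))"
      using Q1 mB(2)[OF z, of k] rh by (intro add_left_mono mult_mono) auto
    finally have P1: "cmod (P k ?z) \<le> (1 + B / h) * cmod (X k ?z)" by (simp add: algebra_simps)
    have "V k x \<le> ((1 + B / h) * cmod (X k ?z))\<^sup>2 + (1 / h * cmod (X k ?z))\<^sup>2"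
      unfolding Vc using P1 Q1 by (intro add_mono power_mono) auto
    also have "\<dots> = ((1 + B / h)\<^sup>2 + (1 / h)\<^sup>2) * (cmod (X k ?z))\<^sup>2"
      unfolding power_mult_distrib by (simp add: algebra_simps)
    also have "\<dots> \<le> (1 + (1 + B / h)\<^sup>2 + (1 / h)\<^sup>2) * (cmod (X k ?z))\<^sup>2" by (intro mult_right_mono) auto
    also have "\<dots> \<le> (1 + (1 + B / h)\<^sup>2 + (1 / h)\<^sup>2) * ((1 + X0B\<^sup>2) * (1 + B / h) * exp (T * S) * exp (2 * Re (\<Phi> k ?z)))"
    proof (rule mult_left_mono)
      have x0: "(cmod (X 0 ?z))\<^sup>2 \<le> 1 + X0B\<^sup>2" using power_mono[OF X0B[OF x], of 2] by simp
      have hr: "hh k x / hh 0 x \<le> 1 + B / h"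
      proof -
        have "hh k x / hh 0 x \<le> B / h" using hp[of k] hp[of 0] rh by (intro frac_le) auto
        thus ?thesis by simp
      qed
      have ex: "exp (T * (\<Sum>j<k. (e j)\<^sup>2)) \<le> exp (T * S)" using eS[of k] T0 by (simp add: mult_left_mono)
      have hr0: "0 \<le> hh k x / hh 0 x" using hp[of k] hp[of 0] rh by (intro divide_nonneg_nonneg) linarith+
      have Bh: "0 \<le> 1 + B / h" using rh by simp
      show "(cmod (X k ?z))\<^sup>2 \<le> (1 + X0B\<^sup>2) * (1 + B / h) * exp (T * S) * exp (2 * Re (\<Phi> k ?z))"
        by (rule order_trans[OF Xk[OF x, of k]], intro mult_right_mono mult_mono x0 hr ex)
          (use hr0 Bh in auto)
    qed (auto intro!: add_nonneg_nonneg)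
    also have "\<dots> = E * exp (2 * Re (\<Phi> k ?z))" by (simp add: E_def mult.assoc)
    finally have "ln (V k x) \<le> ln (E * exp (2 * Re (\<Phi> k ?z)))" using Vpos[of k x] E0 by (subst ln_le_cancel_iff) auto
    also have "\<dots> = ln E + 2 * Re (\<Phi> k ?z)" using E0 by (simp add: ln_mult)
    finally show ?thesis .
  qed
  define W where "W = (\<lambda>x. (x - c) * (d - x))"
  have W0: "0 \<le> W x" if "x \<in> {c..d}" for x using that by (simp add: W_def)
  have fin: "integral {c..d} (\<lambda>x. W x * ln (V k x)) \<le> ln E * integral {c..d} W + 2 * (2 * K * (d - c + r) ^ 3 / r)" for k
  proof -
    have contV: "continuous_on {c..d} (\<lambda>x. ln (V k x))"
    proof (rule continuous_on_ln)
      show "continuous_on {c..d} (V k)"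
        unfolding V_def by (rule continuous_on_opvec_norm)
      show "\<forall>x\<in>{c..d}. V k x \<noteq> 0" using Vpos by (metis less_irrefl)
    qed
    have contP: "continuous_on {c..d} (\<lambda>x. Re (\<Phi> k (of_real x)))"
      by (intro continuous_on_Re continuous_on_compose2[OF cont[of k], of "{c..d}" complex_of_real])
        (use xD in \<open>auto intro: continuous_intros\<close>)
    have contW: "continuous_on {c..d} W" unfolding W_def by (intro continuous_intros)
    have iP: "(\<lambda>x. W x * Re (\<Phi> k (of_real x))) integrable_on {c..d}"
      by (intro integrable_continuous_real continuous_intros contW contP)
    have iW: "W integrable_on {c..d}" by (intro integrable_continuous_real contW)
    have "integral {c..d} (\<lambda>x. W x * ln (V k x)) \<le> integral {c..d} (\<lambda>x. ln E * W x + 2 * (W x * Re (\<Phi> k (of_real x))))"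
    proof (rule integral_le)
      show "(\<lambda>x. W x * ln (V k x)) integrable_on {c..d}"
        by (intro integrable_continuous_real continuous_intros contW contV)
      show "(\<lambda>x. ln E * W x + 2 * (W x * Re (\<Phi> k (of_real x)))) integrable_on {c..d}"
        by (intro integrable_continuous_real continuous_intros contW contP)
      show "W x * ln (V k x) \<le> ln E * W x + 2 * (W x * Re (\<Phi> k (of_real x)))" if "x \<in> {c..d}" for x
        using mult_left_mono[OF VE[OF that, of k] W0[OF that]] by (simp add: algebra_simps)
    qed
    also have "\<dots> = ln E * integral {c..d} W + 2 * integral {c..d} (\<lambda>x. W x * Re (\<Phi> k (of_real x)))"
      using iP iW by (subst Henstock_Kurzweil_Integration.integral_add) (auto intro: integrable_on_mult_right)
    also have "\<dots> \<le> ln E * integral {c..d} W + 2 * (2 * K * (d - c + r) ^ 3 / r)"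
      using int\<Phi>[of k] unfolding W_def by linarith
    finally show ?thesis .
  qed
  show ?thesis
    by (rule that[of m]) (use fin in \<open>simp add: V_def W_def nn_def\<close>)
qed

end

section \<open>Semicontinuity of the entropy\<close>

lemma ln_1_plus_lipschitz:
  fixes u v :: real
  assumes "0 \<le> u" "0 \<le> v"
  shows "ln (1 + u) \<le> ln (1 + v) + \<bar>u - v\<bar>"
proof -
  have "ln (1 + u) - ln (1 + v) = ln ((1 + u) / (1 + v))" using assms by (simp add: ln_div)
  also have "\<dots> \<le> (1 + u) / (1 + v) - 1" using assms by (intro ln_le_minus_one) simp
  also have "\<dots> = (u - v) / (1 + v)" using assms by (simp add: field_simps)
  also have "\<dots> \<le> \<bar>u - v\<bar> / 1" using assms by (intro frac_le) auto
  finally show ?thesis by simp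
qed

text \<open>Outer regularity is applied to \<open>A\<close> and to its complement. A Urysohn
  function between the complements of the two open sets differs from the indicator only on their
  intersection, whose measure is less than \<open>2 * \<epsilon> / 3\<close>.\<close>

lemma continuous_L1_dense_indicator:
  fixes \<nu> :: "real measure"
  assumes fin: "finite_measure \<nu>" and sets: "sets \<nu> = sets borel" and A: "A \<in> sets \<nu>" and \<epsilon>: "0 < \<epsilon>"
  obtains h :: "real \<Rightarrow> real" where "continuous_on UNIV h" "\<And>x. 0 \<le> h x" "\<And>x. h x \<le> 1"
    "(\<integral>x. \<bar>indicator A x - h x\<bar> \<partial>\<nu>) < \<epsilon>"
proof -
  interpret finite_measure \<nu> by (rule fin)
  have space: "space \<nu> = UNIV" using sets_eq_imp_space_eq[OF sets] by simp
  have outer: "\<exists>U. B \<subseteq> U \<and> open U \<and> measure \<nu> U < measure \<nu> B + \<epsilon> / 3" if B: "B \<in> sets \<nu>" for B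
  proof -
    have "emeasure \<nu> B < ennreal (measure \<nu> B + \<epsilon> / 3)" using \<epsilon> by (simp add: emeasure_eq_measure ennreal_lessI)
    moreover have "emeasure \<nu> B = (INF U \<in> {U. B \<subseteq> U \<and> open U}. emeasure \<nu> U)"
      by (rule outer_regular) (use sets B in auto)
    ultimately obtain U where "B \<subseteq> U" "open U" "emeasure \<nu> U < ennreal (measure \<nu> B + \<epsilon> / 3)"
      by (auto simp: INF_less_iff)
    thus ?thesis by (intro exI[of _ U]) (auto simp: emeasure_eq_measure ennreal_less_iff)
  qed
  obtain U where U: "A \<subseteq> U" "open U" "measure \<nu> U < measure \<nu> A + \<epsilon> / 3" using outer[OF A] by blast
  have "- A \<in> sets \<nu>" using A space by (metis Compl_eq_Diff_UNIV sets.compl_sets)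
  then obtain V where V: "- A \<subseteq> V" "open V" "measure \<nu> V < measure \<nu> (- A) + \<epsilon> / 3" using outer by blast
  have mA: "measure \<nu> (- A) = measure \<nu> UNIV - measure \<nu> A"
    using finite_measure_compl[OF A] space by (simp add: Compl_eq_Diff_UNIV)
  have "closed (- V)" "closed (- U)" "- V \<inter> - U = {}" using U V by auto
  then obtain h :: "real \<Rightarrow> real" where h: "continuous_on UNIV h" "\<And>x. h x \<in> closed_segment 1 0"
    "\<And>x. x \<in> - V \<Longrightarrow> h x = 1" "\<And>x. x \<in> - U \<Longrightarrow> h x = 0"
    by (rule Urysohn[where a = "1::real" and b = 0]) blast
  have h01: "0 \<le> h x" "h x \<le> 1" for x using h(2)[of x] by (auto simp: closed_segment_eq_real_ivl)
  have UV [measurable]: "U \<in> sets \<nu>" "V \<in> sets \<nu>" using U V sets by auto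
  have hm [measurable]: "h \<in> borel_measurable \<nu>" 
    using borel_measurable_continuous_onI[OF h(1)] sets by (simp cong: measurable_cong_sets)
  have "(\<integral>x. \<bar>indicator A x - h x\<bar> \<partial>\<nu>) \<le> (\<integral>x. indicator (U \<inter> V) x \<partial>\<nu>)"
  proof (rule integral_mono)
    show "integrable \<nu> (\<lambda>x. \<bar>indicator A x - h x\<bar>)"
      using A h01 by (intro integrable_const_bound[where B = 1]) (auto simp: indicator_def)
    show "integrable \<nu> (indicat_real (U \<inter> V))" using UV by (auto simp: emeasure_finite less_top[symmetric])
    fix x
    show "\<bar>indicator A x - h x\<bar> \<le> indicat_real (U \<inter> V) x"
      using h01[of x] h(3)[of x] h(4)[of x] U(1) V(1) by (auto simp: indicator_def)
  qed
  also have "\<dots> = measure \<nu> (U \<inter> V)" using space by simp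
  also have "\<dots> = measure \<nu> U + measure \<nu> V - measure \<nu> (U \<union> V)"
    using measure_Un3[of U \<nu> V] UV by (simp add: fmeasurable_def emeasure_finite less_top[symmetric])
  also have "U \<union> V = UNIV" using U V by auto
  finally have "(\<integral>x. \<bar>indicator A x - h x\<bar> \<partial>\<nu>) < \<epsilon>" using U(3) V(3) mA \<epsilon> by linarith
  thus ?thesis using that h(1) h01 by blast
qed

lemma integrable_bounded_continuous:
  fixes \<nu> :: "real measure" and h :: "real \<Rightarrow> real"
  assumes "finite_measure \<nu>" and sets: "sets \<nu> = sets borel" and h: "continuous_on UNIV h" "bounded (range h)"
  shows "integrable \<nu> h"
proof -
  interpret finite_measure \<nu> by fact
  obtain B where "\<And>x. norm (h x) \<le> B" using h(2) unfolding bounded_iff by blast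
  moreover have "h \<in> borel_measurable \<nu>"
    using borel_measurable_continuous_onI[OF h(1)] sets by (simp cong: measurable_cong_sets)
  ultimately show ?thesis by (intro integrable_const_bound[where B = B]) auto
qed

lemma continuous_L1_dense:
  fixes \<nu> :: "real measure" and g :: "real \<Rightarrow> real"
  assumes fin: "finite_measure \<nu>" and sets: "sets \<nu> = sets borel" and g: "integrable \<nu> g"
  shows "\<forall>\<epsilon>>0. \<exists>h. continuous_on UNIV h \<and> bounded (range h) \<and> (\<integral>x. \<bar>g x - h x\<bar> \<partial>\<nu>) < \<epsilon>"
  using g
proof (induction rule: integrable_induct)
  case (base A c)
  interpret finite_measure \<nu> by (rule fin)
  show ?case
  proof (intro allI impI)
    fix \<epsilon> :: real assume \<epsilon>: "0 < \<epsilon>"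
    define \<delta> where "\<delta> = \<epsilon> / (\<bar>c\<bar> + 1)"
    have \<delta>: "0 < \<delta>" using \<epsilon> by (simp add: \<delta>_def)
    obtain h where h: "continuous_on UNIV h" "\<And>x. 0 \<le> h x" "\<And>x. h x \<le> 1" "(\<integral>x. \<bar>indicator A x - h x\<bar> \<partial>\<nu>) < \<delta>"
      using continuous_L1_dense_indicator[OF fin sets base(1) \<delta>] by blast
    have "(\<integral>x. \<bar>indicator A x *\<^sub>R c - c * h x\<bar> \<partial>\<nu>) = (\<integral>x. \<bar>c\<bar> * \<bar>indicator A x - h x\<bar> \<partial>\<nu>)"
      by (intro Bochner_Integration.integral_cong) (auto simp: abs_mult[symmetric] algebra_simps)
    also have "\<dots> = \<bar>c\<bar> * (\<integral>x. \<bar>indicator A x - h x\<bar> \<partial>\<nu>)" by simp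
    also have "\<dots> \<le> \<bar>c\<bar> * \<delta>" using h(4) by (intro mult_left_mono) auto
    also have "\<dots> < (\<bar>c\<bar> + 1) * \<delta>" using \<delta> by simp
    also have "\<dots> = \<epsilon>" by (simp add: \<delta>_def)
    finally have "(\<integral>x. \<bar>indicator A x *\<^sub>R c - c * h x\<bar> \<partial>\<nu>) < \<epsilon>" .
    moreover have "continuous_on UNIV (\<lambda>x. c * h x)" by (intro continuous_intros h)
    moreover have "bounded (range (\<lambda>x. c * h x))"
      unfolding bounded_iff using h(2,3) by (intro exI[of _ "\<bar>c\<bar>"]) (auto simp: abs_mult mult_left_le)
    ultimately show "\<exists>h. continuous_on UNIV h \<and> bounded (range h) \<and> (\<integral>x. \<bar>indicator A x *\<^sub>R c - h x\<bar> \<partial>\<nu>) < \<epsilon>"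
      by blast
  qed
next
  case (add f g)
  interpret finite_measure \<nu> by (rule fin)
  note int = integrable_bounded_continuous[OF fin sets]
  show ?case
  proof (intro allI impI)
    fix \<epsilon> :: real assume "0 < \<epsilon>"
    hence \<epsilon>: "0 < \<epsilon> / 2" by simp
    obtain h1 where h1: "continuous_on UNIV h1" "bounded (range h1)" "(\<integral>x. \<bar>f x - h1 x\<bar> \<partial>\<nu>) < \<epsilon> / 2" using add.IH(1) \<epsilon> by blast
    obtain h2 where h2: "continuous_on UNIV h2" "bounded (range h2)" "(\<integral>x. \<bar>g x - h2 x\<bar> \<partial>\<nu>) < \<epsilon> / 2" using add.IH(2) \<epsilon> by blast
    have "(\<integral>x. \<bar>(f x + g x) - (h1 x + h2 x)\<bar> \<partial>\<nu>) \<le> (\<integral>x. \<bar>f x - h1 x\<bar> + \<bar>g x - h2 x\<bar> \<partial>\<nu>)"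
      using add.hyps int[OF h1(1,2)] int[OF h2(1,2)] by (intro integral_mono) auto
    also have "\<dots> = (\<integral>x. \<bar>f x - h1 x\<bar> \<partial>\<nu>) + (\<integral>x. \<bar>g x - h2 x\<bar> \<partial>\<nu>)"
      using add.hyps int[OF h1(1,2)] int[OF h2(1,2)] by (intro Bochner_Integration.integral_add) auto
    also have "\<dots> < \<epsilon>" using h1(3) h2(3) by simp
    finally have "(\<integral>x. \<bar>(f x + g x) - (h1 x + h2 x)\<bar> \<partial>\<nu>) < \<epsilon>" .
    moreover have "continuous_on UNIV (\<lambda>x. h1 x + h2 x)" by (intro continuous_intros h1 h2)
    moreover have "bounded (range (\<lambda>x. h1 x + h2 x))" by (rule bounded_plus_comp[OF h1(2) h2(2)])
    ultimately show "\<exists>h. continuous_on UNIV h \<and> bounded (range h) \<and> (\<integral>x. \<bar>(f x + g x) - h x\<bar> \<partial>\<nu>) < \<epsilon>" by blast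
  qed
next
  case (lim f s)
  interpret finite_measure \<nu> by (rule fin)
  note int = integrable_bounded_continuous[OF fin sets]
  have "(\<lambda>i. \<integral>x. \<bar>f x - s i x\<bar> \<partial>\<nu>) \<longlonglongrightarrow> (\<integral>x. 0 \<partial>\<nu>)"
  proof (rule integral_dominated_convergence[where w = "\<lambda>x. 3 * \<bar>f x\<bar>"])
    show "AE x in \<nu>. (\<lambda>i. \<bar>f x - s i x\<bar>) \<longlonglongrightarrow> 0"
    proof (rule AE_I2)
      fix x assume "x \<in> space \<nu>"
      hence "(\<lambda>i. \<bar>f x - s i x\<bar>) \<longlonglongrightarrow> \<bar>f x - f x\<bar>" by (intro tendsto_intros lim.hyps)
      thus "(\<lambda>i. \<bar>f x - s i x\<bar>) \<longlonglongrightarrow> 0" by simp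
    qed
    show "AE x in \<nu>. norm \<bar>f x - s i x\<bar> \<le> 3 * \<bar>f x\<bar>" for i
      using lim.hyps(3)[of _ i] by (intro AE_I2) (smt (verit) real_norm_def)
  qed (use lim.hyps in auto)
  hence to0: "(\<lambda>i. \<integral>x. \<bar>f x - s i x\<bar> \<partial>\<nu>) \<longlonglongrightarrow> 0" by simp
  show ?case
  proof (intro allI impI)
    fix \<epsilon> :: real assume "0 < \<epsilon>"
    hence \<epsilon>: "0 < \<epsilon> / 2" by simp
    obtain i where i: "(\<integral>x. \<bar>f x - s i x\<bar> \<partial>\<nu>) < \<epsilon> / 2"
      using order_tendstoD(2)[OF to0 \<epsilon>] by (auto simp: eventually_sequentially)
    obtain h where h: "continuous_on UNIV h" "bounded (range h)" "(\<integral>x. \<bar>s i x - h x\<bar> \<partial>\<nu>) < \<epsilon> / 2" using lim.IH \<epsilon> by blast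
    have "(\<integral>x. \<bar>f x - h x\<bar> \<partial>\<nu>) \<le> (\<integral>x. \<bar>f x - s i x\<bar> + \<bar>s i x - h x\<bar> \<partial>\<nu>)"
      using lim.hyps int[OF h(1,2)] by (intro integral_mono) auto
    also have "\<dots> = (\<integral>x. \<bar>f x - s i x\<bar> \<partial>\<nu>) + (\<integral>x. \<bar>s i x - h x\<bar> \<partial>\<nu>)"
      using lim.hyps int[OF h(1,2)] by (intro Bochner_Integration.integral_add) auto
    also have "\<dots> < \<epsilon>" using i h(3) by simp
    finally show "\<exists>h. continuous_on UNIV h \<and> bounded (range h) \<and> (\<integral>x. \<bar>f x - h x\<bar> \<partial>\<nu>) < \<epsilon>" using h by blast
  qed
qed

text \<open>Approximating \<open>sqrt g\<close> and squaring keeps the polynomials nonnegative outside the support of \<open>\<mu>\<close>.\<close>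

lemma entropy_poly_to_continuous:
  fixes \<mu> :: "real measure" and g :: "real \<Rightarrow> real"
  assumes fin: "finite_measure \<mu>" and sets: "sets \<mu> = sets borel" and supp: "AE x in \<mu>. \<bar>x\<bar> \<le> R"
    and poly: "\<And>p :: real poly. (\<And>x. 0 \<le> poly p x) \<Longrightarrow>
      integral {c..d} (\<lambda>x. ln (1 + poly p x)) \<le> K + pi * (\<integral>x. 1 + poly p x \<partial>\<mu>)"
    and ip: "\<And>p :: real poly. integrable \<mu> (poly p)"
    and g: "continuous_on UNIV g" "\<And>x. 0 \<le> g x" "bounded (range g)" and cd: "c < d"
  shows "integral {c..d} (\<lambda>x. ln (1 + g x)) \<le> K + pi * (\<integral>x. 1 + g x \<partial>\<mu>)"
proof -
  interpret finite_measure \<mu> by (rule fin)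
  define R' where "R' = max R (max \<bar>c\<bar> \<bar>d\<bar>)"
  obtain B where "\<And>x. norm (g x) \<le> B" using g(3) unfolding bounded_iff by blast
  hence B: "g x \<le> B" for x by (metis abs_le_D1 real_norm_def)
  have B0: "0 \<le> B" using B[of 0] g(2)[of 0] by linarith
  have gi: "integrable \<mu> g"
    using B g(2) borel_measurable_continuous_onI[OF g(1)] sets
    by (intro integrable_const_bound[where B = B]) (auto cong: measurable_cong_sets)
  \<comment> \<open>An error \<open>\<epsilon>\<close> in the approximation of \<open>g\<close>
    costs \<open>pi * \<epsilon>\<close> times the mass of \<open>\<mu>\<close> on the right and
    \<open>\<epsilon>\<close> times the length of the interval on the left.\<close>
  define E where "E = pi * measure \<mu> (space \<mu>) + (d - c)"
  have E0: "0 < E" using cd by (simp add: E_def add_nonneg_pos)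
  have "integral {c..d} (\<lambda>x. ln (1 + g x)) \<le> K + pi * (\<integral>x. 1 + g x \<partial>\<mu>) + e" if e: "0 < e" for e
  proof -
    define \<epsilon> where "\<epsilon> = e / E"
    have \<epsilon>: "0 < \<epsilon>" using e E0 by (simp add: \<epsilon>_def)
    \<comment> \<open>If \<open>s\<close> is within \<open>\<delta> \<le> 1\<close> of
      \<open>sqrt (g x)\<close>, then \<open>s x + sqrt (g x)\<close> is at most
      \<open>2 * sqrt B + 1\<close> in modulus, so squaring enlarges the error at most by this
      factor.\<close>
    define \<delta> where "\<delta> = min 1 (\<epsilon> / (2 * sqrt B + 1))"
    have sB: "0 \<le> sqrt B" using B0 by simp
    hence sB1: "0 < 2 * sqrt B + 1" by linarith
    have \<delta>: "0 < \<delta>" "\<delta> \<le> 1" "\<delta> * (2 * sqrt B + 1) \<le> \<epsilon>"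
    proof -
      have "\<delta> \<le> \<epsilon> / (2 * sqrt B + 1)" by (simp add: \<delta>_def)
      thus "\<delta> * (2 * sqrt B + 1) \<le> \<epsilon>" using sB by (simp add: pos_le_divide_eq)
    qed (use \<epsilon> sB1 in \<open>auto simp: \<delta>_def\<close>)
    obtain s where s: "real_polynomial_function s" "\<And>x. x \<in> {-R'..R'} \<Longrightarrow> \<bar>sqrt (g x) - s x\<bar> < \<delta>"
      by (rule Stone_Weierstrass_real_polynomial_function[of "{-R'..R'}" "\<lambda>x. sqrt (g x)" \<delta>])
        (use \<delta> in \<open>auto intro!: continuous_intros continuous_on_subset[OF g(1)]\<close>)
    obtain cf n where cf: "s = (\<lambda>x. \<Sum>i\<le>n. cf i * x ^ i)" using s(1) by (auto simp: real_polynomial_function_iff_sum)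
    define p where "p = (\<Sum>i\<le>n. monom (cf i) i)\<^sup>2"
    have px: "poly p x = (s x)\<^sup>2" for x by (simp add: p_def cf poly_sum poly_monom)
    have contp: "continuous_on {c..d} (\<lambda>x. ln (1 + poly p x))"
    proof (intro continuous_intros)
      show "\<forall>x\<in>{c..d}. 1 + poly p x \<noteq> 0" unfolding px by (smt (verit) zero_le_power2)
    qed
    have close: "\<bar>g x - poly p x\<bar> \<le> \<epsilon>" if "x \<in> {-R'..R'}" for x
    proof -
      have 1: "\<bar>sqrt (g x) - s x\<bar> \<le> \<delta>" using s(2)[OF that] by simp
      have 2: "sqrt (g x) \<le> sqrt B" using B by simp
      have 3: "0 \<le> sqrt (g x)" using g(2) by simp
      have "g x - poly p x = (sqrt (g x) - s x) * (sqrt (g x) + s x)"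
        using g(2)[of x] by (simp add: px algebra_simps power2_eq_square[symmetric])
      hence "\<bar>g x - poly p x\<bar> = \<bar>sqrt (g x) - s x\<bar> * \<bar>sqrt (g x) + s x\<bar>" by (simp add: abs_mult)
      also have "\<dots> \<le> \<delta> * (2 * sqrt B + 1)" 
      proof (intro mult_mono 1)
        show "\<bar>sqrt (g x) + s x\<bar> \<le> 2 * sqrt B + 1" using 1 2 3 \<delta>(2) by linarith
      qed (use \<delta>(1) in auto)
      finally show ?thesis using \<delta>(3) by simp
    qed
    have "integral {c..d} (\<lambda>x. ln (1 + g x)) \<le> integral {c..d} (\<lambda>x. ln (1 + poly p x) + \<epsilon>)"
    proof (rule integral_le)
      show "(\<lambda>x. ln (1 + g x)) integrable_on {c..d}"
      proof (intro integrable_continuous_real continuous_intros continuous_on_subset[OF g(1)])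
        show "\<forall>x\<in>{c..d}. 1 + g x \<noteq> 0" using g(2) by (smt (verit))
      qed auto
      show "(\<lambda>x. ln (1 + poly p x) + \<epsilon>) integrable_on {c..d}"
        by (intro integrable_continuous_real continuous_on_add contp continuous_on_const)
      show "ln (1 + g x) \<le> ln (1 + poly p x) + \<epsilon>" if "x \<in> {c..d}" for x
      proof -
        have "\<bar>c\<bar> \<le> R'" "\<bar>d\<bar> \<le> R'" by (auto simp: R'_def)
        hence "x \<in> {-R'..R'}" using that by auto
        thus ?thesis using ln_1_plus_lipschitz[of "g x" "poly p x"] close[of x] g(2)[of x] by (simp add: px)
      qed
    qed
    also have "\<dots> = integral {c..d} (\<lambda>x. ln (1 + poly p x)) + \<epsilon> * (d - c)"
      using cd by (subst Henstock_Kurzweil_Integration.integral_add) (auto intro!: integrable_continuous_real contp)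
    also have "integral {c..d} (\<lambda>x. ln (1 + poly p x)) \<le> K + pi * (\<integral>x. 1 + poly p x \<partial>\<mu>)" by (rule poly) (simp add: px)
    also have "(\<integral>x. 1 + poly p x \<partial>\<mu>) \<le> (\<integral>x. (1 + g x) + \<epsilon> \<partial>\<mu>)"
    proof (rule integral_mono_AE)
      show "integrable \<mu> (\<lambda>x. 1 + poly p x)" using ip by (intro Bochner_Integration.integrable_add) auto
      show "integrable \<mu> (\<lambda>x. (1 + g x) + \<epsilon>)" using gi by auto
      show "AE x in \<mu>. 1 + poly p x \<le> (1 + g x) + \<epsilon>"
        using supp
      proof eventually_elim
        case (elim x)
        have "x \<in> {-R'..R'}" using elim by (auto simp: R'_def)
        thus ?case using close[of x] by auto
      qed
    qed
    also have "\<dots> = (\<integral>x. 1 + g x \<partial>\<mu>) + \<epsilon> * measure \<mu> (space \<mu>)" using gi by (subst Bochner_Integration.integral_add) auto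
    finally have "integral {c..d} (\<lambda>x. ln (1 + g x)) \<le> K + pi * ((\<integral>x. 1 + g x \<partial>\<mu>) + \<epsilon> * measure \<mu> (space \<mu>)) + \<epsilon> * (d - c)" by simp
    also have "\<dots> = K + pi * (\<integral>x. 1 + g x \<partial>\<mu>) + \<epsilon> * E" by (simp add: E_def algebra_simps)
    also have "\<epsilon> * E = e" using E0 by (simp add: \<epsilon>_def)
    finally show ?thesis by simp
  qed
  thus ?thesis by (rule field_le_epsilon)
qed

text \<open>\<open>N\<close> carries the singular part, so off \<open>N\<close> the measure has
  density \<open>f\<close>. Test functions that vanish on \<open>N\<close> thus do not see the
  singular part, and for Lebesgue null \<open>N\<close> this costs nothing on the Lebesgue
  side.\<close>

lemma nn_integral_off_singular:
  assumes dec: "lebesgue_decomposition \<mu> f \<mu>s" and sets: "sets \<mu> = sets borel"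
    and N: "N \<in> sets borel" "emeasure \<mu>s (UNIV - N) = 0"
    and g [measurable]: "g \<in> borel_measurable borel" and g0: "\<And>x. x \<in> N \<Longrightarrow> g x = 0"
  shows "(\<integral>\<^sup>+x. g x \<partial>\<mu>) = (\<integral>\<^sup>+x. ennreal (f x) * g x \<partial>lborel)"
proof -
  have f [measurable]: "f \<in> borel_measurable borel" using dec by (simp add: lebesgue_decomposition_def)
  have [measurable]: "N \<in> sets borel" by (rule N)
  have sets_s: "sets \<mu>s = sets borel" using dec by (simp add: lebesgue_decomposition_def)
  have meas: "h \<in> borel_measurable \<mu>" if "h \<in> borel_measurable borel" for h :: "real \<Rightarrow> ennreal"
    using that sets by (simp cong: measurable_cong_sets)
  have eq: "density \<mu> (indicator (- N)) = density lborel (\<lambda>x. ennreal (f x) * indicator (- N) x)"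
  proof (rule measure_eqI)
    fix A assume "A \<in> sets (density \<mu> (indicator (- N)))"
    hence A [measurable]: "A \<in> sets borel" using sets by simp
    have AN: "A - N \<in> sets borel" by measurable
    have "emeasure \<mu>s (A - N) \<le> emeasure \<mu>s (UNIV - N)" by (intro emeasure_mono) (use sets_s N in auto)
    hence s0: "emeasure \<mu>s (A - N) = 0" using N(2) by simp
    have "emeasure (density \<mu> (indicator (- N))) A = (\<integral>\<^sup>+x. indicator (- N) x * indicator A x \<partial>\<mu>)"
      using A sets by (subst emeasure_density) (auto intro!: meas)
    also have "\<dots> = (\<integral>\<^sup>+x. indicator (A - N) x \<partial>\<mu>)"
      by (intro nn_integral_cong) (auto split: split_indicator)
    also have "\<dots> = emeasure \<mu> (A - N)" using AN sets by simp
    also have "\<dots> = (\<integral>\<^sup>+x\<in>A - N. ennreal (f x) \<partial>lborel)"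
      using dec AN s0 by (simp add: lebesgue_decomposition_def)
    also have "\<dots> = emeasure (density lborel (\<lambda>x. ennreal (f x) * indicator (- N) x)) A"
      by (subst emeasure_density) (auto intro!: nn_integral_cong simp: indicator_def)
    finally show "emeasure (density \<mu> (indicator (- N))) A = emeasure (density lborel (\<lambda>x. ennreal (f x) * indicator (- N) x)) A" .
  qed (simp add: sets)
  have "(\<integral>\<^sup>+x. g x \<partial>\<mu>) = (\<integral>\<^sup>+x. indicator (- N) x * g x \<partial>\<mu>)"
    by (intro nn_integral_cong) (use g0 in \<open>auto simp: indicator_def\<close>)
  also have "\<dots> = (\<integral>\<^sup>+x. g x \<partial>density \<mu> (indicator (- N)))"
    by (subst nn_integral_density) (auto intro!: meas)
  also have "\<dots> = (\<integral>\<^sup>+x. ennreal (f x) * indicator (- N) x * g x \<partial>lborel)"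
    unfolding eq by (subst nn_integral_density) auto
  also have "\<dots> = (\<integral>\<^sup>+x. ennreal (f x) * g x \<partial>lborel)"
    by (intro nn_integral_cong) (use g0 in \<open>auto simp: indicator_def\<close>)
  finally show ?thesis .
qed

text \<open>Approximation in the space of integrable functions of a dominating measure is
  approximation for both measures at once; the sum of the two dominates.\<close>

lemma finite_measure_sum_exists:
  fixes \<mu> \<tau> :: "real measure"
  assumes "finite_measure \<mu>" "finite_measure \<tau>" and sets: "sets \<mu> = sets borel" "sets \<tau> = sets borel"
  obtains \<nu> where "finite_measure \<nu>" "sets \<nu> = sets borel" "\<mu> \<le> \<nu>" "\<tau> \<le> \<nu>"
proof -
  interpret m: finite_measure \<mu> by fact
  interpret l: finite_measure \<tau> by fact
  define \<nu> where "\<nu> = measure_of UNIV (sets (borel :: real measure)) (\<lambda>A. emeasure \<mu> A + emeasure \<tau> A)"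
  have sa: "sigma_algebra UNIV (sets (borel :: real measure))" by (metis sets.sigma_algebra_axioms space_borel)
  have sn: "sets \<nu> = sets borel" unfolding \<nu>_def using sigma_algebra.sets_measure_of_eq[OF sa] by simp
  have em: "emeasure \<nu> A = emeasure \<mu> A + emeasure \<tau> A" if "A \<in> sets borel" for A
    unfolding \<nu>_def
  proof (rule emeasure_measure_of_sigma[OF sa _ _ that])
    show "positive (sets borel) (\<lambda>A. emeasure \<mu> A + emeasure \<tau> A)" by (simp add: positive_def)
    show "countably_additive (sets borel) (\<lambda>A. emeasure \<mu> A + emeasure \<tau> A)"
    proof (rule countably_additiveI)
      fix F :: "nat \<Rightarrow> real set" assume F: "range F \<subseteq> sets borel" "disjoint_family F"
      have "(\<Sum>i. emeasure \<mu> (F i) + emeasure \<tau> (F i)) = (\<Sum>i. emeasure \<mu> (F i)) + (\<Sum>i. emeasure \<tau> (F i))"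
        by (rule suminf_add[symmetric]) auto
      thus "(\<Sum>i. emeasure \<mu> (F i) + emeasure \<tau> (F i)) = emeasure \<mu> (\<Union> (range F)) + emeasure \<tau> (\<Union> (range F))"
        using F sets by (simp add: suminf_emeasure)
    qed
  qed
  have "space \<nu> = UNIV" using sets_eq_imp_space_eq[OF sn] by simp
  hence "finite_measure \<nu>" by (intro finite_measureI) (simp add: em m.emeasure_finite l.emeasure_finite)
  moreover have "\<mu> \<le> \<nu>" "\<tau> \<le> \<nu>" using sets sn em by (auto simp: le_measure)
  ultimately show ?thesis using that sn by blast
qed

lemma integral_mono_measure_nonneg:
  fixes k :: "'a \<Rightarrow> real"
  assumes le: "\<mu> \<le> \<nu>" and sets: "sets \<mu> = sets \<nu>" and k: "integrable \<nu> k" "\<And>x. 0 \<le> k x"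
  shows "integrable \<mu> k" "(\<integral>x. k x \<partial>\<mu>) \<le> (\<integral>x. k x \<partial>\<nu>)"
proof -
  have m: "k \<in> borel_measurable \<mu>" using k(1) sets by (metis borel_measurable_integrable measurable_cong_sets)
  have nn: "(\<integral>\<^sup>+x. ennreal (k x) \<partial>\<mu>) \<le> (\<integral>\<^sup>+x. ennreal (k x) \<partial>\<nu>)" by (rule nn_integral_mono_measure[OF sets le])
  also have nu: "(\<integral>\<^sup>+x. ennreal (k x) \<partial>\<nu>) = ennreal (\<integral>x. k x \<partial>\<nu>)" using k by (intro nn_integral_eq_integral) auto
  finally have 1: "(\<integral>\<^sup>+x. ennreal (k x) \<partial>\<mu>) \<le> ennreal (\<integral>x. k x \<partial>\<nu>)" .
  show i: "integrable \<mu> k" 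
  proof (rule integrableI_bounded[OF m])
    have "(\<integral>\<^sup>+x. ennreal (norm (k x)) \<partial>\<mu>) = (\<integral>\<^sup>+x. ennreal (k x) \<partial>\<mu>)" using k(2) by simp
    also have "\<dots> < \<infinity>" using 1 by (metis ennreal_less_top infinity_ennreal_def order_le_less_trans)
    finally show "(\<integral>\<^sup>+x. ennreal (norm (k x)) \<partial>\<mu>) < \<infinity>" .
  qed
  have "(\<integral>\<^sup>+x. ennreal (k x) \<partial>\<mu>) = ennreal (\<integral>x. k x \<partial>\<mu>)" using i k by (intro nn_integral_eq_integral) auto
  with 1 show "(\<integral>x. k x \<partial>\<mu>) \<le> (\<integral>x. k x \<partial>\<nu>)"
    using k by (simp add: ennreal_le_iff integral_nonneg_AE)
qed

text \<open>A single continuous approximant must be close to \<open>g\<close> with respect to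
  \<open>\<mu>\<close>, for the right-hand side, and with respect to Lebesgue measure on the
  interval, for the left. Density for a common dominating measure provides it, and
  \<open>ln (1 + u)\<close> is Lipschitz with constant 1 on nonnegative arguments.\<close>

lemma entropy_continuous_to_measurable:
  fixes \<mu> :: "real measure" and g :: "real \<Rightarrow> real"
  assumes fin: "finite_measure \<mu>" and sets: "sets \<mu> = sets borel"
    and cont: "\<And>h. continuous_on UNIV h \<Longrightarrow> (\<And>x. 0 \<le> h x) \<Longrightarrow> bounded (range h) \<Longrightarrow>
      integral {c..d} (\<lambda>x. ln (1 + h x)) \<le> K + pi * (\<integral>x. 1 + h x \<partial>\<mu>)"
    and g: "g \<in> borel_measurable borel" "\<And>x. 0 \<le> g x" "\<And>x. g x \<le> B" and cd: "c < d"
  shows "(\<integral>x. indicator {c..d} x * ln (1 + g x) \<partial>lborel) \<le> K + pi * (\<integral>x. 1 + g x \<partial>\<mu>)"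
proof -
  interpret m: finite_measure \<mu> by (rule fin)
  define \<tau> where "\<tau> = density lborel (\<lambda>x. ennreal (indicator {c..d} x :: real))"
  have setl: "sets \<tau> = sets borel" by (simp add: \<tau>_def)
  have "emeasure \<tau> (space \<tau>) = (\<integral>\<^sup>+x. indicator {c..d} x \<partial>lborel)"
    unfolding \<tau>_def by (subst emeasure_density) (auto simp: ennreal_indicator)
  hence finl: "finite_measure \<tau>" using cd by (intro finite_measureI) simp
  interpret l: finite_measure \<tau> by (rule finl)
  obtain \<nu> where \<nu>: "finite_measure \<nu>" "sets \<nu> = sets borel" "\<mu> \<le> \<nu>" "\<tau> \<le> \<nu>"
    by (rule finite_measure_sum_exists[OF fin finl sets setl])
  interpret n: finite_measure \<nu> by (rule \<nu>(1))
  have gm: "g \<in> borel_measurable M" if "sets M = sets borel" for M :: "real measure"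
    using g(1) that by (simp cong: measurable_cong_sets)
  have gB: "norm (g x) \<le> B" for x using g(2,3)[of x] by simp
  have gi: "integrable \<nu> g" "integrable \<mu> g" "integrable \<tau> g"
    using gm \<nu>(2) sets setl gB
    by (auto intro!: n.integrable_const_bound[where B = B] m.integrable_const_bound[where B = B] l.integrable_const_bound[where B = B])
  have ll: "(\<integral>x. k x \<partial>\<tau>) = (\<integral>x. indicator {c..d} x * k x \<partial>lborel)" if "k \<in> borel_measurable borel" for k :: "real \<Rightarrow> real"
    unfolding \<tau>_def using that by (subst integral_density) auto
  have "(\<integral>x. indicator {c..d} x * ln (1 + g x) \<partial>lborel) \<le> K + pi * (\<integral>x. 1 + g x \<partial>\<mu>) + e" if e: "0 < e" for e
  proof -
    define \<epsilon> where "\<epsilon> = e / (1 + pi)"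
    have pi1: "0 < 1 + pi" using pi_gt_zero by linarith
    have \<epsilon>: "0 < \<epsilon>" using e pi1 by (simp add: \<epsilon>_def)
    obtain h0 where h0: "continuous_on UNIV h0" "bounded (range h0)" "(\<integral>x. \<bar>g x - h0 x\<bar> \<partial>\<nu>) < \<epsilon>"
      using continuous_L1_dense[OF \<nu>(1,2) gi(1)] \<epsilon> by blast
    define h where "h = (\<lambda>x. max 0 (h0 x))"
    have hc: "continuous_on UNIV h" unfolding h_def by (intro continuous_intros h0)
    have hb: "bounded (range h)"
    proof -
      obtain b0 where b0: "\<And>x. norm (h0 x) \<le> b0" using h0(2) unfolding bounded_iff by blast
      have "norm (h x) \<le> b0" for x using b0[of x] by (auto simp: h_def)
      thus ?thesis unfolding bounded_iff by blast
    qed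
    have h0': "0 \<le> h x" for x by (simp add: h_def)
    have hm: "h \<in> borel_measurable borel" by (rule borel_measurable_continuous_onI[OF hc])
    have hi: "integrable \<nu> h" "integrable \<mu> h" "integrable \<tau> h" "integrable \<nu> h0"
      using integrable_bounded_continuous \<nu>(1,2) fin sets finl setl hc hb h0(1,2) by blast+
    have "(\<integral>x. \<bar>g x - h x\<bar> \<partial>\<nu>) \<le> (\<integral>x. \<bar>g x - h0 x\<bar> \<partial>\<nu>)"
    proof (rule integral_mono)
      show "\<bar>g x - h x\<bar> \<le> \<bar>g x - h0 x\<bar>" for x using g(2)[of x] by (auto simp: h_def max_def)
    qed (use gi hi in auto)
    hence gh: "(\<integral>x. \<bar>g x - h x\<bar> \<partial>\<nu>) \<le> \<epsilon>" using h0(3) by simp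
    have iab: "integrable \<nu> (\<lambda>x. \<bar>g x - h x\<bar>)" using gi hi by auto
    have ghm: "(\<integral>x. \<bar>g x - h x\<bar> \<partial>\<mu>) \<le> \<epsilon>" "(\<integral>x. \<bar>g x - h x\<bar> \<partial>\<tau>) \<le> \<epsilon>"
      using integral_mono_measure_nonneg(2)[OF \<nu>(3) _ iab] integral_mono_measure_nonneg(2)[OF \<nu>(4) _ iab] sets setl \<nu>(2) gh by force+
    have lnb: "\<bar>ln (1 + u)\<bar> \<le> \<bar>u\<bar>" if "0 \<le> u" for u :: real
      using ln_1_plus_lipschitz[of u 0] that ln_ge_zero[of "1 + u"] by simp
    have lni: "integrable \<tau> (\<lambda>x. ln (1 + k x))" if "integrable \<tau> k" "k \<in> borel_measurable borel" "\<And>x. 0 \<le> k x" for k :: "real \<Rightarrow> real"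
      by (rule Bochner_Integration.integrable_bound[OF that(1)]) (use that(2) setl lnb[OF that(3)] in \<open>auto cong: measurable_cong_sets\<close>)
    have "(\<integral>x. indicator {c..d} x * ln (1 + g x) \<partial>lborel) = (\<integral>x. ln (1 + g x) \<partial>\<tau>)"
      using g(1) by (intro ll[symmetric]) measurable
    also have "\<dots> \<le> (\<integral>x. ln (1 + h x) + \<bar>g x - h x\<bar> \<partial>\<tau>)"
      using gi hi lni[OF gi(3) g(1,2)] lni[OF hi(3) hm h0'] ln_1_plus_lipschitz[OF g(2) h0']
      by (intro integral_mono) auto
    also have "\<dots> = (\<integral>x. ln (1 + h x) \<partial>\<tau>) + (\<integral>x. \<bar>g x - h x\<bar> \<partial>\<tau>)"
      using gi hi lni[OF hi(3) hm h0'] by (intro Bochner_Integration.integral_add) auto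
    also have "(\<integral>x. ln (1 + h x) \<partial>\<tau>) = (\<integral>x. indicator {c..d} x * ln (1 + h x) \<partial>lborel)"
      using hm by (intro ll) measurable
    also have "\<dots> = integral {c..d} (\<lambda>x. ln (1 + h x))"
    proof -
      have "continuous_on {c..d} (\<lambda>x. ln (1 + h x))"
      proof (intro continuous_intros continuous_on_subset[OF hc])
        show "\<forall>x\<in>{c..d}. 1 + h x \<noteq> 0" using h0' by (smt (verit))
      qed auto
      from set_borel_integral_eq_integral(2)[OF borel_integrable_atLeastAtMost'[OF this]]
      show ?thesis by (simp add: set_lebesgue_integral_def)
    qed
    also have "integral {c..d} (\<lambda>x. ln (1 + h x)) \<le> K + pi * (\<integral>x. 1 + h x \<partial>\<mu>)" by (rule cont[OF hc h0' hb])
    also have "(\<integral>x. 1 + h x \<partial>\<mu>) \<le> (\<integral>x. (1 + g x) + \<bar>g x - h x\<bar> \<partial>\<mu>)"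
      using gi hi by (intro integral_mono) auto
    also have "\<dots> = (\<integral>x. 1 + g x \<partial>\<mu>) + (\<integral>x. \<bar>g x - h x\<bar> \<partial>\<mu>)"
      using gi hi by (intro Bochner_Integration.integral_add) auto
    finally have "(\<integral>x. indicator {c..d} x * ln (1 + g x) \<partial>lborel) \<le> K + pi * ((\<integral>x. 1 + g x \<partial>\<mu>) + (\<integral>x. \<bar>g x - h x\<bar> \<partial>\<mu>)) + (\<integral>x. \<bar>g x - h x\<bar> \<partial>\<tau>)"
      by simp
    also have "\<dots> \<le> K + pi * ((\<integral>x. 1 + g x \<partial>\<mu>) + \<epsilon>) + \<epsilon>"
      using ghm by (intro add_mono mult_left_mono) auto
    also have "\<dots> = K + pi * (\<integral>x. 1 + g x \<partial>\<mu>) + (1 + pi) * \<epsilon>" by (simp add: algebra_simps)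
    also have "(1 + pi) * \<epsilon> = e" using pi1 by (simp add: \<epsilon>_def)
    finally show ?thesis .
  qed
  thus ?thesis by (rule field_le_epsilon)
qed

section \<open>From the logarithmic bound to the density\<close>

context square_summable_variation
begin

text \<open>The moments of the Bernstein--Szego measures agree with those of \<open>\<mu>\<close>, so \<open>ln u \<le> u - 1\<close> with
  \<open>u = (1 + p) / V n\<close> gives a bound that does not depend on \<open>n\<close>; negative values of \<open>ln (V n)\<close>
  cost at most the integral of \<open>1 / V n\<close>.\<close>

lemma entropy_poly:
  assumes csm: "canonical_spectral_measure a b \<mu>"
    and cd: "c' < c" "c < d" "d < d'"
    and C: "\<And>k. integral {c'..d'} (\<lambda>x. (x - c') * (d' - x) * ln ((norm (opvec a b x (m + k * q)))\<^sup>2)) \<le> C"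
  obtains K where "\<And>p :: real poly. (\<And>x. 0 \<le> poly p x) \<Longrightarrow>
      integral {c..d} (\<lambda>x. ln (1 + poly p x)) \<le> K + pi * (\<integral>x. 1 + poly p x \<partial>\<mu>)"
proof -
  define V where "V = (\<lambda>n (x::real). (norm (opvec a b x n))\<^sup>2)"
  have V0: "0 < V n x" for n x unfolding V_def by (rule opvec_norm_pos)
  have Vc: "continuous_on A (V n)" for A n unfolding V_def by (rule continuous_on_opvec_norm)
  have lnc: "continuous_on A (\<lambda>x. ln (V n x))" for A n
    by (rule continuous_on_ln[OF Vc]) (use V0 in \<open>metis less_irrefl\<close>)
  have ic: "continuous_on A (\<lambda>x. 1 / V n x)" for A n
    by (intro continuous_intros Vc) (use V0 in \<open>metis less_irrefl\<close>)
  define W where "W = (\<lambda>x. (x - c') * (d' - x))"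
  have Wc: "continuous_on A W" for A unfolding W_def by (intro continuous_intros)
  \<comment> \<open>The weight is at least \<open>w0\<close> on the inner interval and at most
    \<open>w1\<close> on the outer one. To drop it, and to pass from one interval to the other, the
    integrand must be nonnegative; this is why \<open>1 / V n\<close> is added to the logarithm in
    \<open>pos\<close>.\<close>
  define w0 where "w0 = (c - c') * (d' - d)"
  define w1 where "w1 = (d' - c')\<^sup>2"
  have w0: "0 < w0" using cd by (simp add: w0_def)
  have W0: "w0 \<le> W x" if "x \<in> {c..d}" for x
    unfolding w0_def W_def using that cd by (intro mult_mono) auto
  have W1: "0 \<le> W x \<and> W x \<le> w1" if "x \<in> {c'..d'}" for x
    unfolding w1_def W_def power2_eq_square using that cd by (auto intro!: mult_mono)
  have pos: "0 \<le> ln (V n x) + 1 / V n x" for n x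
  proof -
    have "ln (1 / V n x) \<le> 1 / V n x - 1" using V0[of n x] by (intro ln_le_minus_one) simp
    thus ?thesis using V0[of n x] by (simp add: ln_div)
  qed
  have poly_int: "integral {u..v} (\<lambda>x. poly r x / V n x) \<le> pi * (\<integral>x. poly r x \<partial>\<mu>)"
    if "degree r < n" "\<And>x. 0 \<le> poly r x" for r :: "real poly" and n u v
  proof -
    have "has_bochner_integral lborel (\<lambda>x. poly r x / V n x) (pi * (\<integral>x. poly r x \<partial>\<mu>))"
      using bernstein_szego_poly[OF l_pos bx csm that(1)] by (simp add: V_def norm_prod_sq)
    hence "((\<lambda>x. poly r x / V n x) has_integral (pi * (\<integral>x. poly r x \<partial>\<mu>))) UNIV"
      using has_integral_integral_lborel by (metis has_bochner_integral_iff)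
    moreover have "(\<lambda>x. poly r x / V n x) integrable_on {u..v}"
      by (intro integrable_continuous_real continuous_intros Vc) (use V0 in \<open>metis less_irrefl\<close>)
    ultimately show ?thesis
      using V0 that(2) by (intro has_integral_subset_le[OF _ integrable_integral]) (auto simp: less_imp_le)
  qed
  define K where "K = (C + w1 * pi) / w0"
  have lnK: "integral {c..d} (\<lambda>x. ln (V (m + k * q) x)) \<le> K" if k: "1 \<le> k" for k
  proof -
    define n where "n = m + k * q"
    have n: "1 \<le> n" using k q_pos by (auto simp: n_def intro: trans_le_add2)
    have i1: "integral {c'..d'} (\<lambda>x. 1 / V n x) \<le> pi"
      using poly_int[of 1 n c' d'] n csm_measure[OF l_pos bx csm] csm_space[OF l_pos bx csm] by simp
    have iv: "continuous_on A (\<lambda>x. ln (V n x) + 1 / V n x)" for A by (intro continuous_on_add lnc ic)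
    have "w0 * integral {c..d} (\<lambda>x. ln (V n x) + 1 / V n x) = integral {c..d} (\<lambda>x. w0 * (ln (V n x) + 1 / V n x))" by simp
    also have "\<dots> \<le> integral {c..d} (\<lambda>x. W x * (ln (V n x) + 1 / V n x))"
      using pos W0 by (intro integral_le integrable_continuous_real continuous_on_mult iv Wc continuous_on_const mult_right_mono) auto
    also have "\<dots> \<le> integral {c'..d'} (\<lambda>x. W x * (ln (V n x) + 1 / V n x))"
      using cd pos W1 by (intro integral_subset_le integrable_continuous_real continuous_on_mult iv Wc) auto
    also have "\<dots> \<le> integral {c'..d'} (\<lambda>x. W x * ln (V n x) + w1 * (1 / V n x))"
    proof (intro integral_le integrable_continuous_real continuous_on_mult continuous_on_add iv Wc lnc ic continuous_on_const)
      fix x assume x: "x \<in> {c'..d'}"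
      have "W x * (1 / V n x) \<le> w1 * (1 / V n x)" using W1[OF x] V0[of n x] by (intro mult_right_mono) auto
      thus "W x * (ln (V n x) + 1 / V n x) \<le> W x * ln (V n x) + w1 * (1 / V n x)" by (simp add: distrib_left)
    qed
    also have "\<dots> = integral {c'..d'} (\<lambda>x. W x * ln (V n x)) + w1 * integral {c'..d'} (\<lambda>x. 1 / V n x)"
      by (subst Henstock_Kurzweil_Integration.integral_add)
        (auto intro!: integrable_continuous_real continuous_on_mult Wc lnc ic continuous_on_const simp del: times_divide_eq_right)
    also have "\<dots> \<le> C + w1 * pi"
      using C[of k] i1 unfolding W_def V_def n_def w1_def by (intro add_mono mult_left_mono) auto
    finally have "integral {c..d} (\<lambda>x. ln (V n x) + 1 / V n x) \<le> K" using w0 by (simp add: K_def pos_le_divide_eq mult.commute)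
    moreover have "integral {c..d} (\<lambda>x. ln (V n x)) \<le> integral {c..d} (\<lambda>x. ln (V n x) + 1 / V n x)"
      using V0 by (intro integral_le integrable_continuous_real iv lnc) (auto simp: less_imp_le)
    ultimately show ?thesis by (simp add: n_def)
  qed
  show ?thesis
  proof (rule that[of K])
    fix p :: "real poly" assume p: "\<And>x. 0 \<le> poly p x"
    define k where "k = Suc (degree (1 + p))"
    define n where "n = m + k * q"
    have "k \<le> k * q" using q_pos by simp
    hence dn: "degree (1 + p) < n" by (auto simp: n_def k_def)
    have pc: "continuous_on A (\<lambda>x. ln (1 + poly p x))" for A
    proof (intro continuous_intros)
      show "\<forall>x\<in>A. 1 + poly p x \<noteq> 0" using p by (smt (verit))
    qed
    have pv: "continuous_on A (\<lambda>x. poly (1 + p) x / V n x)" for A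
      by (intro continuous_intros Vc) (use V0 in \<open>metis less_irrefl\<close>)
    have "integral {c..d} (\<lambda>x. ln (1 + poly p x)) \<le> integral {c..d} (\<lambda>x. ln (V n x) + poly (1 + p) x / V n x)"
    proof (intro integral_le integrable_continuous_real continuous_on_add pc lnc pv)
      fix x
      have "ln ((1 + poly p x) / V n x) \<le> (1 + poly p x) / V n x - 1"
        using p[of x] V0[of n x] by (intro ln_le_minus_one) (simp add: add_pos_nonneg)
      thus "ln (1 + poly p x) \<le> ln (V n x) + poly (1 + p) x / V n x"
        using p[of x] V0[of n x] by (simp add: ln_div add_pos_nonneg)
    qed
    also have "\<dots> = integral {c..d} (\<lambda>x. ln (V n x)) + integral {c..d} (\<lambda>x. poly (1 + p) x / V n x)"
      by (intro Henstock_Kurzweil_Integration.integral_add integrable_continuous_real lnc pv)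
    also have "\<dots> \<le> K + pi * (\<integral>x. poly (1 + p) x \<partial>\<mu>)"
      unfolding n_def by (intro add_mono lnK poly_int) (use dn p in \<open>auto simp: n_def k_def add_nonneg_nonneg\<close>)
    finally show "integral {c..d} (\<lambda>x. ln (1 + poly p x)) \<le> K + pi * (\<integral>x. 1 + poly p x \<partial>\<mu>)" by simp
  qed
qed

text \<open>The test functions approximate \<open>1 / f\<close> on \<open>{c..d}\<close> off the
  singular set. Their \<open>\<mu>\<close>-integrals are at most \<open>d - c\<close>, however small
  \<open>f\<close> is, while \<open>ln (1 + g j x)\<close> increases to a majorant of
  \<open>- ln (f x)\<close>; monotone convergence gives the claim. The truncation at
  \<open>1 / (j + 1)\<close> keeps each of them bounded.\<close>

lemma log_density_integrable:
  assumes csm: "canonical_spectral_measure a b \<mu>" and dec: "lebesgue_decomposition \<mu> f \<mu>s"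
    and cd: "c' < c" "c < d" "d < d'"
    and C: "\<And>k. integral {c'..d'} (\<lambda>x. (x - c') * (d' - x) * ln ((norm (opvec a b x (m + k * q)))\<^sup>2)) \<le> C"
  shows "(\<integral>\<^sup>+x\<in>{c..d}. e2ennreal (- ext_log (f x)) \<partial>lborel) < \<infinity>"
proof -
  note fin = csm_finite[OF l_pos bx csm] and sets = csm_sets[OF l_pos bx csm]
  interpret finite_measure \<mu> by (rule fin)
  obtain K where K: "\<And>p :: real poly. (\<And>x. 0 \<le> poly p x) \<Longrightarrow>
      integral {c..d} (\<lambda>x. ln (1 + poly p x)) \<le> K + pi * (\<integral>x. 1 + poly p x \<partial>\<mu>)"
    using entropy_poly[OF csm cd C] by blast
  have f [measurable]: "f \<in> borel_measurable borel" and f0: "\<And>x. 0 \<le> f x" using dec by (auto simp: lebesgue_decomposition_def)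
  obtain N where N: "N \<in> sets borel" "emeasure lborel N = 0" "emeasure \<mu>s (UNIV - N) = 0"
    using dec by (auto simp: lebesgue_decomposition_def)
  have [measurable]: "N \<in> sets borel" by (rule N)
  define g where "g = (\<lambda>j x. indicator ({c..d} - N) x * (1 / max (f x) (1 / real (Suc j))))"
  have gm [measurable]: "g j \<in> borel_measurable borel" for j unfolding g_def by measurable
  have g0: "0 \<le> g j x" for j x unfolding g_def by (intro mult_nonneg_nonneg) (auto simp: le_max_iff_disj)
  have gB: "g j x \<le> real (Suc j)" for j x
  proof -
    have "1 / max (f x) (1 / real (Suc j)) \<le> 1 / (1 / real (Suc j))"
      by (intro divide_left_mono mult_pos_pos) (auto simp: less_max_iff_disj)
    thus ?thesis by (auto simp: g_def indicator_def)
  qed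
  define K2 where "K2 = K + pi * (1 + (d - c))"
  have intg: "(\<integral>x. indicator {c..d} x * ln (1 + g j x) \<partial>lborel) \<le> K2" for j
  proof -
    have "(\<integral>x. indicator {c..d} x * ln (1 + g j x) \<partial>lborel) \<le> K + pi * (\<integral>x. 1 + g j x \<partial>\<mu>)"
    proof (rule entropy_continuous_to_measurable[OF fin sets _ gm g0 gB cd(2)])
      fix h :: "real \<Rightarrow> real" assume h: "continuous_on UNIV h" "\<And>x. 0 \<le> h x" "bounded (range h)"
      show "integral {c..d} (\<lambda>x. ln (1 + h x)) \<le> K + pi * (\<integral>x. 1 + h x \<partial>\<mu>)"
        by (rule entropy_poly_to_continuous[OF fin sets csm_support[OF l_pos bx csm] K csm_integrable_poly[OF l_pos bx csm] h cd(2)])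
    qed
    moreover have gi: "integrable \<mu> (g j)"
      using gB g0 gm sets by (intro integrable_const_bound[where B = "real (Suc j)"]) (auto cong: measurable_cong_sets)
    moreover have "(\<integral>x. 1 + g j x \<partial>\<mu>) = 1 + (\<integral>x. g j x \<partial>\<mu>)"
      using gi csm_measure[OF l_pos bx csm] csm_space[OF l_pos bx csm] by (subst Bochner_Integration.integral_add) auto
    moreover have "(\<integral>x. g j x \<partial>\<mu>) \<le> d - c"
    proof -
      have "ennreal (\<integral>x. g j x \<partial>\<mu>) = (\<integral>\<^sup>+x. ennreal (g j x) \<partial>\<mu>)"
        using gi g0 by (intro nn_integral_eq_integral[symmetric]) auto
      also have "\<dots> = (\<integral>\<^sup>+x. ennreal (f x) * ennreal (g j x) \<partial>lborel)"
        by (rule nn_integral_off_singular[OF dec sets N(1,3)]) (auto simp: g_def)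
      also have "\<dots> \<le> (\<integral>\<^sup>+x. indicator {c..d} x \<partial>lborel)"
      proof (rule nn_integral_mono)
        fix x
        have "f x * g j x \<le> indicator {c..d} x"
        proof -
          have "f x / max (f x) (1 / real (Suc j)) \<le> 1" by (subst divide_le_eq_1_pos) (auto simp: less_max_iff_disj)
          thus ?thesis by (auto simp: g_def indicator_def)
        qed
        hence "ennreal (f x * g j x) \<le> ennreal (indicator {c..d} x)" by (rule ennreal_leI)
        thus "ennreal (f x) * ennreal (g j x) \<le> indicator {c..d} x"
          using f0 g0 by (simp add: ennreal_mult[symmetric] ennreal_indicator)
      qed
      also have "\<dots> = ennreal (d - c)" using cd by simp
      finally show ?thesis using cd by (simp add: ennreal_le_iff)
    qed
    ultimately show ?thesis unfolding K2_def by (smt (verit) mult_left_mono pi_ge_zero)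
  qed
  have lng: "0 \<le> indicator {c..d} x * ln (1 + g j x)" for j x using g0[of j x] by (intro mult_nonneg_nonneg) auto
  have nng: "(\<integral>\<^sup>+x. ennreal (indicator {c..d} x * ln (1 + g j x)) \<partial>lborel) \<le> ennreal K2" for j
  proof -
    have "integrable lborel (\<lambda>x. indicator {c..d} x * ln (1 + g j x))"
    proof (rule Bochner_Integration.integrable_bound[of _ "\<lambda>x. indicator {c..d} x * real (Suc j)"])
      show "AE x in lborel. norm (indicator {c..d} x * ln (1 + g j x)) \<le> norm (indicator {c..d} x * real (Suc j))"
      proof (rule AE_I2)
        fix x
        have "ln (1 + g j x) \<le> g j x" using ln_1_plus_lipschitz[of "g j x" 0] g0[of j x] by simp
        hence "ln (1 + g j x) \<le> real (Suc j)" using gB[of j x] by linarith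
        thus "norm (indicator {c..d} x * ln (1 + g j x)) \<le> norm (indicator {c..d} x * real (Suc j))"
          using g0[of j x] by (auto simp: indicator_def)
      qed
    qed (use cd in \<open>auto intro!: integrable_real_indicator\<close>)
    hence "(\<integral>\<^sup>+x. ennreal (indicator {c..d} x * ln (1 + g j x)) \<partial>lborel) = ennreal (\<integral>x. indicator {c..d} x * ln (1 + g j x) \<partial>lborel)"
      using lng by (intro nn_integral_eq_integral) auto
    thus ?thesis using intg[of j] by (simp add: ennreal_leI)
  qed
  have inc: "incseq (\<lambda>j x. ennreal (indicator {c..d} x * ln (1 + g j x)))"
  proof (intro incseq_SucI le_funI ennreal_leI mult_left_mono)
    fix j x
    have "max (f x) (1 / real (Suc (Suc j))) \<le> max (f x) (1 / real (Suc j))" by (intro max.mono) (auto simp: frac_le)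
    hence "1 / max (f x) (1 / real (Suc j)) \<le> 1 / max (f x) (1 / real (Suc (Suc j)))"
      by (intro divide_left_mono mult_pos_pos) (auto simp: less_max_iff_disj)
    hence "g j x \<le> g (Suc j) x" by (auto simp: g_def indicator_def)
    thus "ln (1 + g j x) \<le> ln (1 + g (Suc j) x)" using g0[of j x] by simp
  qed auto
  have "(\<integral>\<^sup>+x. (SUP j. ennreal (indicator {c..d} x * ln (1 + g j x))) \<partial>lborel) = (SUP j. \<integral>\<^sup>+x. ennreal (indicator {c..d} x * ln (1 + g j x)) \<partial>lborel)"
    by (rule nn_integral_monotone_convergence_SUP[OF inc]) auto
  also have "\<dots> \<le> ennreal K2" by (intro SUP_least nng)
  finally have sup: "(\<integral>\<^sup>+x. (SUP j. ennreal (indicator {c..d} x * ln (1 + g j x))) \<partial>lborel) \<le> ennreal K2" .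
  have "(\<integral>\<^sup>+x\<in>{c..d}. e2ennreal (- ext_log (f x)) \<partial>lborel) \<le> (\<integral>\<^sup>+x. (SUP j. ennreal (indicator {c..d} x * ln (1 + g j x))) \<partial>lborel)"
  proof (rule nn_integral_mono_AE)
    have "N \<in> null_sets lborel" using N by auto
    from AE_not_in[OF this]
    show "AE x in lborel. e2ennreal (- ext_log (f x)) * indicator {c..d} x \<le> (SUP j. ennreal (indicator {c..d} x * ln (1 + g j x)))"
    proof eventually_elim
      case (elim x)
      show ?case
      proof (cases "x \<in> {c..d}")
        case x: True
        have gx: "g j x = 1 / max (f x) (1 / real (Suc j))" for j using x elim by (simp add: g_def)
        show ?thesis
        proof (cases "0 < f x")
          case True
          then obtain j where j: "1 / real (Suc j) < f x" using reals_Archimedean[of "f x"] by (auto simp: inverse_eq_divide)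
          have "- ln (f x) \<le> ln (1 + g j x)"
          proof -
            have "- ln (f x) = ln (1 / f x)" using True by (simp add: ln_div)
            also have "\<dots> \<le> ln (1 + g j x)" using True j by (subst ln_le_cancel_iff) (auto simp: gx max_def add_pos_pos)
            finally show ?thesis .
          qed
          hence "e2ennreal (- ext_log (f x)) \<le> ennreal (ln (1 + g j x))"
            using True by (simp add: ext_log_def ennreal_leI e2ennreal_ereal)
          also have "\<dots> \<le> (SUP j. ennreal (ln (1 + g j x)))" by (rule SUP_upper) simp
          finally show ?thesis using x by simp
        next
          \<comment> \<open>Where the density vanishes, the supremum has to be infinite in order to
            dominate \<open>- ext_log 0\<close>.\<close>
          case False
          hence fx: "f x = 0" using f0[of x] by simp
          have "(SUP j. ennreal (ln (1 + g j x))) = top"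
          proof (rule ennreal_SUP_eq_top)
            fix n :: nat
            obtain j where j: "exp (real n) \<le> real j" using real_arch_simple by blast
            have "real n = ln (exp (real n))" by simp
            also have "\<dots> \<le> ln (1 + g j x)" using j by (subst ln_le_cancel_iff) (auto simp: gx fx max_def add_pos_pos)
            finally have "of_nat n \<le> ennreal (ln (1 + g j x))" by (metis ennreal_leI ennreal_of_nat_eq_real_of_nat)
            thus "\<exists>j\<in>UNIV. of_nat n \<le> ennreal (ln (1 + g j x))" by blast
          qed
          moreover have "(\<lambda>j. ennreal (indicator {c..d} x * ln (1 + g j x))) = (\<lambda>j. ennreal (ln (1 + g j x)))"
            using x by simp
          ultimately show ?thesis by (simp only: top_greatest)
        qed
      qed simp
    qed
  qed
  also note sup
  finally show ?thesis by (metis ennreal_less_top infinity_ennreal_def order_le_less_trans)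
qed

section \<open>Right limits\<close>

text \<open>The translates of the coefficients lie in a product of compact sets over the integers,
  and compactness of this product yields a subsequence that converges at every site. Positivity of
  the limit is kept by the lower edge of the box.\<close>

lemma right_limit_extraction:
  assumes k: "filterlim k at_top sequentially"
  obtains r :: "nat \<Rightarrow> nat" and a' b' where "strict_mono r" "(a', b') \<in> right_limits a b"
    "\<And>n. (\<lambda>j. a (nat (n + int (k (r j))))) \<longlonglongrightarrow> a' n" "\<And>n. (\<lambda>j. b (nat (n + int (k (r j))))) \<longlonglongrightarrow> b' n"
proof -
  \<comment> \<open>Truncation by \<open>nat\<close> can reach the index 0, about which the box says
    nothing, so \<open>a 0\<close> and \<open>b 0\<close> enter the bound.\<close>
  define M' where "M' = max (max \<bar>a 0\<bar> \<bar>b 0\<bar>) (max \<bar>l\<bar> \<bar>M\<bar>)"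
  have bd: "\<bar>a i\<bar> \<le> M'" "\<bar>b i\<bar> \<le> M'" for i
  proof -
    have "\<bar>a i\<bar> \<le> M' \<and> \<bar>b i\<bar> \<le> M'"
    proof (cases "i = 0")
      case True
      thus ?thesis by (simp add: M'_def le_max_iff_disj)
    next
      case False
      hence "l \<le> a i" "a i \<le> M" "\<bar>b i\<bar> \<le> M" using bx by (auto simp: coeff_box_def)
      hence "\<bar>a i\<bar> \<le> \<bar>M\<bar>" "\<bar>b i\<bar> \<le> \<bar>M\<bar>" using l_pos by auto
      thus ?thesis by (simp add: M'_def le_max_iff_disj)
    qed
    thus "\<bar>a i\<bar> \<le> M'" "\<bar>b i\<bar> \<le> M'" by auto
  qed
  define S where "S = {- M'..M'} \<times> {- M'..M'}"
  have "compact S" unfolding S_def by (intro compact_Times compact_Icc)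
  hence "compactin (product_topology (\<lambda>i::int. euclidean) UNIV) (PiE UNIV (\<lambda>_. S))"
    by (subst compactin_PiE) auto
  hence cK: "compact (PiE UNIV (\<lambda>_::int. S))" by (simp add: euclidean_product_topology)
  define F where "F = (\<lambda>j (n::int). (a (nat (n + int (k j))), b (nat (n + int (k j)))))"
  have "F j \<in> PiE UNIV (\<lambda>_. S)" for j
    using bd by (auto simp: F_def S_def PiE_def abs_le_iff minus_le_iff)
  then obtain G r where r: "strict_mono r" "(F \<circ> r) \<longlonglongrightarrow> G"
    using compact_imp_seq_compact[OF cK] unfolding seq_compact_def by blast
  have pt: "(\<lambda>j. F (r j) n) \<longlonglongrightarrow> G n" for n
    using continuous_on_tendsto_compose[OF continuous_on_product_coordinates[of n] r(2)] by (simp add: o_def)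
  define a' where "a' = (\<lambda>n. fst (G n))"
  define b' where "b' = (\<lambda>n. snd (G n))"
  have la: "(\<lambda>j. a (nat (n + int (k (r j))))) \<longlonglongrightarrow> a' n" and lb: "(\<lambda>j. b (nat (n + int (k (r j))))) \<longlonglongrightarrow> b' n" for n
    using tendsto_fst[OF pt[of n]] tendsto_snd[OF pt[of n]] by (simp_all add: F_def a'_def b'_def)
  have kr: "filterlim (\<lambda>j. int (k (r j))) at_top sequentially"
    using filterlim_compose[OF k filterlim_subseq[OF r(1)]]
    by (intro filterlim_compose[OF filterlim_int_sequentially]) (simp add: o_def)
  have "0 < a' n" for n
  proof -
    have "\<forall>\<^sub>F j in sequentially. 1 - n \<le> int (k (r j))" using kr by (simp add: filterlim_at_top)
    hence "\<forall>\<^sub>F j in sequentially. l \<le> a (nat (n + int (k (r j))))"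
    proof eventually_elim
      case (elim j)
      hence "1 \<le> nat (n + int (k (r j)))" by simp
      thus ?case using bx by (simp add: coeff_box_def)
    qed
    hence "l \<le> a' n" by (intro tendsto_lowerbound[OF la]) auto
    thus ?thesis using l_pos by simp
  qed
  hence "(a', b') \<in> right_limits a b" unfolding right_limits_def using kr la lb by blast
  thus ?thesis using that r(1) la lb by blast
qed

lemma right_limit_props:
  assumes "(a', b') \<in> right_limits a b"
  obtains k :: "nat \<Rightarrow> nat" where "filterlim k at_top sequentially"
    "\<And>n. (\<lambda>j. a (nat (n + int (k j)))) \<longlonglongrightarrow> a' n" "\<And>n. (\<lambda>j. b (nat (n + int (k j)))) \<longlonglongrightarrow> b' n"
    "\<And>n. l \<le> a' n" "\<And>n. a' n \<le> M" "\<And>n. \<bar>b' n\<bar> \<le> M" "periodic_coeffs q a' b'"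
proof -
  obtain k :: "nat \<Rightarrow> int" where k: "filterlim k at_top sequentially"
    "\<And>n. (\<lambda>j. a (nat (n + k j))) \<longlonglongrightarrow> a' n" "\<And>n. (\<lambda>j. b (nat (n + k j))) \<longlonglongrightarrow> b' n"
    using assms by (auto simp: right_limits_def)
  have ev: "\<forall>\<^sub>F j in sequentially. 1 \<le> n + k j" for n
    using k(1) by (auto simp: filterlim_at_top algebra_simps dest!: spec[of _ "1 - n"])
  define k' where "k' = (\<lambda>j. nat (k j))"
  have nn: "\<forall>\<^sub>F j in sequentially. nat (n + k j) = nat (n + int (k' j))" for n
    using ev[of 0] by eventually_elim (simp add: k'_def)
  have k': "filterlim k' at_top sequentially"
    unfolding k'_def by (rule filterlim_compose[OF filterlim_nat_sequentially k(1)])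
  have la: "(\<lambda>j. a (nat (n + int (k' j)))) \<longlonglongrightarrow> a' n" for n
    by (rule Lim_transform_eventually[OF k(2)[of n]]) (use nn[of n] in eventually_elim, simp)
  have lb: "(\<lambda>j. b (nat (n + int (k' j)))) \<longlonglongrightarrow> b' n" for n
    by (rule Lim_transform_eventually[OF k(3)[of n]]) (use nn[of n] in eventually_elim, simp)
  have evb: "\<forall>\<^sub>F j in sequentially. l \<le> a (nat (n + k j)) \<and> a (nat (n + k j)) \<le> M \<and> \<bar>b (nat (n + k j))\<bar> \<le> M" for n
    using ev[of n]
  proof eventually_elim
    case (elim j)
    hence "1 \<le> nat (n + k j)" by simp
    thus ?case using bx by (simp add: coeff_box_def)
  qed
  have l1: "l \<le> a' n" for n by (rule tendsto_lowerbound[OF k(2)]) (use evb[of n] in \<open>auto elim: eventually_mono\<close>)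
  have M1: "a' n \<le> M" for n by (rule tendsto_upperbound[OF k(2)]) (use evb[of n] in \<open>auto elim: eventually_mono\<close>)
  have M2: "\<bar>b' n\<bar> \<le> M" for n
    by (rule tendsto_upperbound[OF tendsto_rabs[OF k(3)]]) (use evb[of n] in \<open>auto elim: eventually_mono\<close>)
  have "a' (n + int q) = a' n \<and> b' (n + int q) = b' n" for n
  proof -
    have lim: "filterlim (\<lambda>j. nat (n + k j)) at_top sequentially"
    proof (rule filterlim_compose[OF filterlim_nat_sequentially])
      show "filterlim (\<lambda>j. n + k j) at_top sequentially"
        unfolding filterlim_at_top
      proof
        fix Z show "\<forall>\<^sub>F j in sequentially. Z \<le> n + k j"
          using k(1) by (auto simp: filterlim_at_top algebra_simps dest!: spec[of _ "Z - n"])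
      qed
    qed
    have idx: "\<forall>\<^sub>F j in sequentially. nat (n + k j) + q = nat (n + int q + k j)"
      using ev[of n] by eventually_elim (simp add: nat_eq_iff)
    have "(\<lambda>j. a (nat (n + k j) + q) - a (nat (n + k j))) \<longlonglongrightarrow> 0" "(\<lambda>j. b (nat (n + k j) + q) - b (nat (n + k j))) \<longlonglongrightarrow> 0"
      by (rule filterlim_compose[OF variation_tendsto(1) lim], rule filterlim_compose[OF variation_tendsto(2) lim])
    moreover have "(\<lambda>j. a (nat (n + k j) + q) - a (nat (n + k j))) \<longlonglongrightarrow> a' (n + int q) - a' n"
      by (rule Lim_transform_eventually[OF tendsto_diff[OF k(2)[of "n + int q"] k(2)[of n]]]) (use idx in eventually_elim, simp)
    moreover have "(\<lambda>j. b (nat (n + k j) + q) - b (nat (n + k j))) \<longlonglongrightarrow> b' (n + int q) - b' n"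
      by (rule Lim_transform_eventually[OF tendsto_diff[OF k(3)[of "n + int q"] k(3)[of n]]]) (use idx in eventually_elim, simp)
    ultimately have "a' (n + int q) - a' n = 0" "b' (n + int q) - b' n = 0" by (metis LIMSEQ_unique)+
    thus ?thesis by simp
  qed
  hence "periodic_coeffs q a' b'" by (simp add: periodic_coeffs_def)
  thus ?thesis using that[OF k' la lb l1 M1 M2] by blast
qed

text \<open>The energies move along with the positions because the compactness argument in
  \<open>core_uniform\<close> extracts both limits together. The \<open>q\<close> sites after
  \<open>k j\<close> converge to the sites 1 to \<open>q\<close> of the right limit, which are those
  entering its discriminant.\<close>

lemma tr_tendsto_discriminant:
  assumes la: "\<And>n. (\<lambda>j. a (nat (n + int (k j)))) \<longlonglongrightarrow> a' n" and lb: "\<And>n. (\<lambda>j. b (nat (n + int (k j)))) \<longlonglongrightarrow> b' n"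
    and bd: "\<And>n. l \<le> a' n" "\<And>n. a' n \<le> M" "\<And>n. \<bar>b' n\<bar> \<le> M" and x: "x \<longlonglongrightarrow> (x' :: real)"
  shows "(\<lambda>j. tr (k j) (x j)) \<longlonglongrightarrow> discriminant q a' b' x'"
proof -
  define \<alpha> where "\<alpha> = (\<lambda>i::nat. a' (int i))"
  define \<beta> where "\<beta> = (\<lambda>i::nat. b' (int i))"
  have bx': "coeff_box l M \<alpha> \<beta>" using bd by (auto simp: coeff_box_def \<alpha>_def \<beta>_def)
  have "bounded (range x)" using convergent_imp_bounded[OF x] .
  then obtain R0 where R0: "\<And>j. \<bar>x j\<bar> \<le> R0" by (auto simp: bounded_iff)
  define R where "R = max R0 \<bar>x'\<bar>"
  have R: "\<bar>x j\<bar> \<le> R" "\<bar>x'\<bar> \<le> R" for j using R0[of j] by (auto simp: R_def)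
  obtain C1 where C1: "\<And>a b a' b' (z::real) z'. coeff_box l M a b \<Longrightarrow> coeff_box l M a' b' \<Longrightarrow> norm z \<le> R \<Longrightarrow> norm z' \<le> R \<Longrightarrow>
    norm (fst (sol a b z (1, 0) q) - fst (sol a' b' z' (1, 0) q)) \<le> C1 * (coeff_dist q a b a' b' + norm (z - z'))"
    using sol_lipschitz[OF l_pos, where 'k = real, of M R "(1, 0)" q] by meson
  obtain C2 where C2: "\<And>a b a' b' (z::real) z'. coeff_box l M a b \<Longrightarrow> coeff_box l M a' b' \<Longrightarrow> norm z \<le> R \<Longrightarrow> norm z' \<le> R \<Longrightarrow>
    norm (snd (sol a b z (0, 1) q) - snd (sol a' b' z' (0, 1) q)) \<le> C2 * (coeff_dist q a b a' b' + norm (z - z'))"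
    using sol_lipschitz[OF l_pos, where 'k = real, of M R "(0, 1)" q] by meson
  define e where "e = (\<lambda>j. coeff_dist q (shift (k j) a) (shift (k j) b) \<alpha> \<beta> + norm (x j - x'))"
  have "(\<lambda>j. \<bar>a (nat (int i + int (k j))) - a' (int i)\<bar> + \<bar>b (nat (int i + int (k j))) - b' (int i)\<bar>) \<longlonglongrightarrow> \<bar>a' (int i) - a' (int i)\<bar> + \<bar>b' (int i) - b' (int i)\<bar>" for i
    by (intro tendsto_intros la lb)
  moreover have "nat (int i + int m) = m + i" for i m by simp
  ultimately have "(\<lambda>j. \<bar>shift (k j) a i - \<alpha> i\<bar> + \<bar>shift (k j) b i - \<beta> i\<bar>) \<longlonglongrightarrow> 0" for i
    by (simp add: shift_def \<alpha>_def \<beta>_def)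
  hence "(\<lambda>j. coeff_dist q (shift (k j) a) (shift (k j) b) \<alpha> \<beta>) \<longlonglongrightarrow> (\<Sum>i=1..q. 0)"
    unfolding coeff_dist_def by (intro tendsto_sum)
  moreover have "(\<lambda>j. norm (x j - x')) \<longlonglongrightarrow> 0" by (rule tendsto_norm_zero[OF LIM_zero[OF x]])
  ultimately have "e \<longlonglongrightarrow> 0 + 0" unfolding e_def by (intro tendsto_add) auto
  hence "(\<lambda>j. (C1 + C2) * e j) \<longlonglongrightarrow> (C1 + C2) * (0 + 0)" by (intro tendsto_intros)
  hence e0: "(\<lambda>j. (C1 + C2) * e j) \<longlonglongrightarrow> 0" by simp
  have "norm (tr (k j) (x j) - discriminant q a' b' x') \<le> (C1 + C2) * e j" for j
  proof -
    have "discriminant q a' b' x' = fst (sol \<alpha> \<beta> x' (1, 0) q) + snd (sol \<alpha> \<beta> x' (0, 1) q)"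
      by (simp add: discriminant_eq mono_trace_def \<alpha>_def \<beta>_def)
    hence "tr (k j) (x j) - discriminant q a' b' x' = (fst (col1 (k j) (x j)) - fst (sol \<alpha> \<beta> x' (1, 0) q)) + (snd (col2 (k j) (x j)) - snd (sol \<alpha> \<beta> x' (0, 1) q))"
      by (simp add: tr_def)
    also have "norm \<dots> \<le> C1 * e j + C2 * e j"
      unfolding e_def using C1[OF shift_box[of "k j"] bx', of "x j" x'] C2[OF shift_box[of "k j"] bx', of "x j" x'] R
      by (intro norm_triangle_le add_mono) auto
    finally show ?thesis by (simp add: algebra_simps)
  qed
  hence "(\<lambda>j. tr (k j) (x j) - discriminant q a' b' x') \<longlonglongrightarrow> 0"
    by (intro Lim_null_comparison[OF _ e0]) auto
  thus ?thesis by (simp add: LIM_zero_iff)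
qed

section \<open>The common interior of the bands and the common spectrum\<close>

abbreviation "core \<equiv> \<Inter>(a', b')\<in>right_limits a b. q_int q a' b'"

text \<open>Otherwise there are positions tending to infinity and energies approaching the interval
  at which the trace is nearly 2 or more in modulus. Along a subsequence the energies converge to a
  point of the interval and the translates to a right limit, whose discriminant there is at least 2
  in modulus.\<close>

lemma core_uniform:
  assumes sub: "{c..d} \<subseteq> core" and cd: "c \<le> d"
  obtains \<eta> N c' d' where "0 < \<eta>" "c' < c" "d < d'" "\<And>n x. N \<le> n \<Longrightarrow> x \<in> {c'..d'} \<Longrightarrow> \<bar>tr n x\<bar> \<le> 2 - \<eta>"
proof (rule ccontr)
  note out = that
  assume "\<not> thesis"
  have neg: "\<exists>n x. N \<le> n \<and> x \<in> {c'..d'} \<and> \<not> \<bar>tr n x\<bar> \<le> 2 - \<eta>" if "0 < \<eta>" "c' < c" "d < d'" for \<eta> N c' d'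
    using out[OF that, of N] \<open>\<not> thesis\<close> by blast
  have "\<exists>n x. j \<le> n \<and> x \<in> {c - 1 / real (Suc j)..d + 1 / real (Suc j)} \<and> \<not> \<bar>tr n x\<bar> \<le> 2 - 1 / real (Suc j)" for j
    by (rule neg) auto
  then obtain k x where kx: "\<And>j. j \<le> k j" "\<And>j. x j \<in> {c - 1 / real (Suc j)..d + 1 / real (Suc j)}"
    "\<And>j. \<bar>tr (k j) (x j)\<bar> > 2 - 1 / real (Suc j)" by (metis not_le)
  have "x j \<in> {c - 1..d + 1}" for j
  proof -
    have "1 / real (Suc j) \<le> 1" by simp
    thus ?thesis using kx(2)[of j] unfolding atLeastAtMost_iff by linarith
  qed
  then obtain x' r1 where r1: "strict_mono r1" "(x \<circ> r1) \<longlonglongrightarrow> x'"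
    using compact_imp_seq_compact[OF compact_Icc[of "c - 1" "d + 1"]] unfolding seq_compact_def by metis
  have "filterlim k at_top sequentially" unfolding filterlim_at_top
    using kx(1) by (auto intro!: eventually_sequentiallyI intro: order_trans)
  hence "filterlim (k \<circ> r1) at_top sequentially" using filterlim_compose[OF _ filterlim_subseq[OF r1(1)]] by (simp add: o_def)
  then obtain r a' b' where r: "strict_mono r" "(a', b') \<in> right_limits a b"
    "\<And>n. (\<lambda>j. a (nat (n + int ((k \<circ> r1) (r j))))) \<longlonglongrightarrow> a' n" "\<And>n. (\<lambda>j. b (nat (n + int ((k \<circ> r1) (r j))))) \<longlonglongrightarrow> b' n"
    by (rule right_limit_extraction) (rule that; assumption)
  define s where "s = r1 \<circ> r"
  have s: "strict_mono s" unfolding s_def using r1(1) r(1) by (rule strict_mono_o)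
  have xs: "(\<lambda>j. x (s j)) \<longlonglongrightarrow> x'" using LIMSEQ_subseq_LIMSEQ[OF r1(2) r(1)] by (simp add: s_def o_def)
  have inv: "(\<lambda>j. 1 / real (Suc (s j))) \<longlonglongrightarrow> 0"
    using LIMSEQ_subseq_LIMSEQ[OF LIMSEQ_Suc[OF lim_1_over_n] s] by (simp add: o_def)
  have "x' \<in> {c..d}"
  proof -
    have "(\<lambda>j. c - 1 / real (Suc (s j))) \<longlonglongrightarrow> c - 0" "(\<lambda>j. d + 1 / real (Suc (s j))) \<longlonglongrightarrow> d + 0"
      by (intro tendsto_intros inv)+
    from LIMSEQ_le[OF this(1) xs] LIMSEQ_le[OF xs this(2)] show ?thesis using kx(2) by (auto simp del: of_nat_Suc)
  qed
  hence "x' \<in> q_int q a' b'" using sub r(2) by blast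
  hence lt: "\<bar>discriminant q a' b' x'\<bar> < 2" by (simp add: q_int_def abs_less_iff)
  have "l \<le> a' n" "a' n \<le> M" "\<bar>b' n\<bar> \<le> M" for n using right_limit_props[OF r(2)] by metis+
  hence "(\<lambda>j. tr (k (s j)) (x (s j))) \<longlonglongrightarrow> discriminant q a' b' x'"
    using tr_tendsto_discriminant[of "\<lambda>j. k (s j)" a' b' "\<lambda>j. x (s j)" x'] r(3,4) xs by (simp add: s_def)
  hence "(\<lambda>j. \<bar>tr (k (s j)) (x (s j))\<bar>) \<longlonglongrightarrow> \<bar>discriminant q a' b' x'\<bar>" by (rule tendsto_rabs)
  moreover have "(\<lambda>j. 2 - 1 / real (Suc (s j))) \<longlonglongrightarrow> 2 - 0" by (intro tendsto_intros inv)
  ultimately have "2 - 0 \<le> \<bar>discriminant q a' b' x'\<bar>"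
    using kx(3) by (intro LIMSEQ_le) (auto intro: less_imp_le simp del: of_nat_Suc)
  thus False using lt by simp
qed

lemma core_neighbourhood:
  assumes csm: "canonical_spectral_measure a b \<mu>" and dec: "lebesgue_decomposition \<mu> f \<mu>s"
    and sub: "{c..d} \<subseteq> core" and cd: "c \<le> d"
  obtains c1 d1 where "c1 < c" "d < d1" "{c1..d1} \<subseteq> core"
    "(\<integral>\<^sup>+x\<in>{c1..d1}. e2ennreal (- ext_log (f x)) \<partial>lborel) < \<infinity>"
proof -
  obtain \<eta> N c' d' where u: "0 < \<eta>" "c' < c" "d < d'" "\<And>n x. N \<le> n \<Longrightarrow> x \<in> {c'..d'} \<Longrightarrow> \<bar>tr n x\<bar> \<le> 2 - \<eta>"
    by (rule core_uniform[OF sub cd]) (rule that; assumption)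
  have c'd': "c' < d'" using u cd by simp
  obtain C m where C: "\<And>k. integral {c'..d'} (\<lambda>x. (x - c') * (d' - x) * ln ((norm (opvec a b x (m + k * q)))\<^sup>2)) \<le> C"
  proof (rule log_norm_bound[OF c'd' u(1), of N])
    show "\<bar>tr n x\<bar> \<le> 2 - \<eta>" if "N \<le> n" "x \<in> {c'..d'}" for n x by (rule u(4)[OF that])
  qed (rule that; assumption)
  \<comment> \<open>The weight vanishes at \<open>c'\<close> and \<open>d'\<close>, so integrability
    of the logarithm is obtained on a strictly smaller interval, which still is a neighbourhood of
    \<open>{c..d}\<close>.\<close>
  define c1 where "c1 = (c' + c) / 2"
  define d1 where "d1 = (d + d') / 2"
  have c1: "c' < c1" "c1 < c" "c1 < d1" "d < d1" "d1 < d'" using u cd by (auto simp: c1_def d1_def)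
  have "x \<in> q_int q a' b'" if x: "x \<in> {c1..d1}" and r: "(a', b') \<in> right_limits a b" for x a' b'
  proof -
    obtain k :: "nat \<Rightarrow> nat" where k: "filterlim k at_top sequentially"
      "\<And>n. (\<lambda>j. a (nat (n + int (k j)))) \<longlonglongrightarrow> a' n" "\<And>n. (\<lambda>j. b (nat (n + int (k j)))) \<longlonglongrightarrow> b' n"
      "\<And>n. l \<le> a' n" "\<And>n. a' n \<le> M" "\<And>n. \<bar>b' n\<bar> \<le> M" using right_limit_props[OF r] by metis
    have "(\<lambda>j. \<bar>tr (k j) x\<bar>) \<longlonglongrightarrow> \<bar>discriminant q a' b' x\<bar>"
      by (intro tendsto_rabs tr_tendsto_discriminant[OF k(2-6)] tendsto_const)
    moreover have "\<forall>\<^sub>F j in sequentially. N \<le> k j" using k(1) by (simp add: filterlim_at_top)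
    hence "\<forall>\<^sub>F j in sequentially. \<bar>tr (k j) x\<bar> \<le> 2 - \<eta>" by eventually_elim (use u(4) x c1 in auto)
    ultimately have "\<bar>discriminant q a' b' x\<bar> \<le> 2 - \<eta>" by (intro tendsto_upperbound) auto
    thus ?thesis using u(1) by (auto simp: q_int_def)
  qed
  hence "{c1..d1} \<subseteq> core" by auto
  moreover have "(\<integral>\<^sup>+x\<in>{c1..d1}. e2ennreal (- ext_log (f x)) \<partial>lborel) < \<infinity>"
    by (rule log_density_integrable[OF csm dec c1(1,3,5) C])
  ultimately show ?thesis using that c1 by blast
qed

text \<open>Where \<open>f\<close> vanishes, \<open>- ext_log (f x)\<close> is infinite, so a finite
  integral forces positivity almost everywhere on an interval. Rational endpoints reduce the
  neighbourhoods of the points of \<open>core\<close> to countably many.\<close>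

lemma density_pos_on_core:
  assumes csm: "canonical_spectral_measure a b \<mu>" and dec: "lebesgue_decomposition \<mu> f \<mu>s"
  shows "AE x in lborel. x \<in> core \<longrightarrow> 0 < f x"
proof -
  have [measurable]: "f \<in> borel_measurable borel" using dec by (simp add: lebesgue_decomposition_def)
  define X where "X = {(c, d). c \<in> \<rat> \<and> d \<in> \<rat> \<and> (\<integral>\<^sup>+x\<in>{c..d}. e2ennreal (- ext_log (f x)) \<partial>lborel) < \<infinity>}"
  have "X \<subseteq> \<rat> \<times> \<rat>" by (auto simp: X_def)
  hence "countable X" by (rule countable_subset) (intro countable_SIGMA countable_rat)
  have "AE x in lborel. \<forall>p\<in>X. x \<in> {fst p..snd p} \<longrightarrow> 0 < f x"
    unfolding AE_ball_countable[OF \<open>countable X\<close>]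
  proof
    fix p assume p: "p \<in> X"
    define c where "c = fst p"
    define d where "d = snd p"
    have "(\<integral>\<^sup>+x\<in>{c..d}. e2ennreal (- ext_log (f x)) \<partial>lborel) \<noteq> \<infinity>" using p by (auto simp: X_def c_def d_def)
    hence "AE x in lborel. e2ennreal (- ext_log (f x)) * indicator {c..d} x \<noteq> \<infinity>"
      by (intro nn_integral_PInf_AE) (auto simp: ext_log_def)
    thus "AE x in lborel. x \<in> {fst p..snd p} \<longrightarrow> 0 < f x"
      unfolding c_def[symmetric] d_def[symmetric]
      by eventually_elim (auto simp: ext_log_def split: if_splits)
  qed
  thus ?thesis
  proof eventually_elim
    case (elim x)
    show ?case
    proof
      assume x: "x \<in> core"
      hence xx: "{x..x} \<subseteq> core" by simp
      obtain c1 d1 where cd: "c1 < x" "x < d1" "(\<integral>\<^sup>+x\<in>{c1..d1}. e2ennreal (- ext_log (f x)) \<partial>lborel) < \<infinity>"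
        by (rule core_neighbourhood[OF csm dec xx order_refl]) (rule that; assumption)
      obtain c where c: "c \<in> \<rat>" "c1 < c" "c < x" using Rats_dense_in_real[OF cd(1)] by blast
      obtain d where d: "d \<in> \<rat>" "x < d" "d < d1" using Rats_dense_in_real[OF cd(2)] by blast
      have "(\<integral>\<^sup>+x\<in>{c..d}. e2ennreal (- ext_log (f x)) \<partial>lborel) \<le> (\<integral>\<^sup>+x\<in>{c1..d1}. e2ennreal (- ext_log (f x)) \<partial>lborel)"
        using c d by (intro nn_integral_mono mult_left_mono) (auto simp: indicator_def)
      hence "(c, d) \<in> X" using c d cd(3) by (auto simp: X_def)
      from bspec[OF elim this] show "0 < f x" using c d by simp
    qed
  qed
qed

lemma log_integral_on_core:
  assumes csm: "canonical_spectral_measure a b \<mu>" and dec: "lebesgue_decomposition \<mu> f \<mu>s"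
    and sub: "{c..d} \<subseteq> core"
  shows "- \<infinity> < ext_integral {c..d} (\<lambda>x. ext_log (f x))"
proof -
  have "(\<integral>\<^sup>+x\<in>{c..d}. e2ennreal (- ext_log (f x)) \<partial>lborel) < \<infinity>"
  proof (cases "c \<le> d")
    case True
    obtain c1 d1 where cd: "c1 < c" "d < d1" "(\<integral>\<^sup>+x\<in>{c1..d1}. e2ennreal (- ext_log (f x)) \<partial>lborel) < \<infinity>"
      by (rule core_neighbourhood[OF csm dec sub True]) (rule that; assumption)
    have "(\<integral>\<^sup>+x\<in>{c..d}. e2ennreal (- ext_log (f x)) \<partial>lborel) \<le> (\<integral>\<^sup>+x\<in>{c1..d1}. e2ennreal (- ext_log (f x)) \<partial>lborel)"
      using cd by (intro nn_integral_mono mult_left_mono) (auto simp: indicator_def)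
    thus ?thesis using cd(3) by simp
  qed simp
  then obtain u where u: "0 \<le> u" "(\<integral>\<^sup>+x\<in>{c..d}. e2ennreal (- ext_log (f x)) \<partial>lborel) = ennreal u"
    unfolding infinity_ennreal_def less_top_ennreal by blast
  have v: "0 \<le> enn2ereal v" for v by simp
  \<comment> \<open>With the negative part equal to a finite \<open>u\<close>, the value lies above
    \<open>- \<infinity>\<close> whether or not the positive part is finite.\<close>
  show ?thesis
    unfolding ext_integral_def u(2)
    using u(1) v[of "\<integral>\<^sup>+x\<in>{c..d}. e2ennreal (ext_log (f x)) \<partial>lborel"]
    by (cases "enn2ereal (\<integral>\<^sup>+x\<in>{c..d}. e2ennreal (ext_log (f x)) \<partial>lborel)") (auto simp: enn2ereal_ennreal)
qed

text \<open>Countably many rational triples describe the intervals on which infinitely many traces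
  are hyperbolic with a margin, and each contributes a null set. If the discriminant of a right
  limit exceeds 2 in modulus at a point, the Lipschitz bound, uniform in \<open>n\<close>, places
  the point in such an interval; elsewhere \<open>spectrum_contains_bands\<close> applies.\<close>

lemma ac_spectrum_subset:
  assumes csm: "canonical_spectral_measure a b \<mu>" and dec: "lebesgue_decomposition \<mu> f \<mu>s"
  shows "AE x in lborel. 0 < f x \<longrightarrow> x \<in> (\<Inter>(a', b')\<in>right_limits a b. jacobi2_spectrum a' b')"
proof -
  define X where "X = {(\<alpha> :: real, \<beta> :: real, \<eta> :: real). \<alpha> \<in> \<rat> \<and> \<beta> \<in> \<rat> \<and> \<eta> \<in> \<rat> \<and> 0 < \<eta> \<and> (\<forall>N. \<exists>n\<ge>N. \<forall>x\<in>{\<alpha>..\<beta>}. 2 + \<eta> \<le> \<bar>tr n x\<bar>)}"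
  have "X \<subseteq> \<rat> \<times> \<rat> \<times> \<rat>" unfolding X_def by blast
  hence "countable X" by (rule countable_subset) (intro countable_SIGMA countable_rat)
  have "AE x in lborel. \<forall>p\<in>X. x \<in> {fst p..fst (snd p)} \<longrightarrow> \<not> 0 < f x"
    unfolding AE_ball_countable[OF \<open>countable X\<close>]
  proof
    fix p assume "p \<in> X"
    hence "0 < snd (snd p)" "\<And>N. \<exists>n\<ge>N. \<forall>x\<in>{fst p..fst (snd p)}. 2 + snd (snd p) \<le> \<bar>tr n x\<bar>"
      unfolding X_def split_beta mem_Collect_eq by blast+
    thus "AE x in lborel. x \<in> {fst p..fst (snd p)} \<longrightarrow> \<not> 0 < f x"
      by (rule density_zero_of_hyperbolic[OF csm dec])
  qed
  thus ?thesis
  proof eventually_elim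
    case (elim x)
    have "x \<in> jacobi2_spectrum a' b'" if fx: "0 < f x" and r: "(a', b') \<in> right_limits a b" for a' b'
    proof -
      obtain k :: "nat \<Rightarrow> nat" where k: "filterlim k at_top sequentially"
        "\<And>n. (\<lambda>j. a (nat (n + int (k j)))) \<longlonglongrightarrow> a' n" "\<And>n. (\<lambda>j. b (nat (n + int (k j)))) \<longlonglongrightarrow> b' n"
        "\<And>n. l \<le> a' n" "\<And>n. a' n \<le> M" "\<And>n. \<bar>b' n\<bar> \<le> M" "periodic_coeffs q a' b'" using right_limit_props[OF r] by metis
      have "\<bar>discriminant q a' b' x\<bar> \<le> 2"
      proof (rule ccontr)
        assume "\<not> \<bar>discriminant q a' b' x\<bar> \<le> 2"
        \<comment> \<open>The excess over 2 is split into thirds: one is lost in the limit along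
          \<open>k\<close>, one by moving from \<open>x\<close> to a nearby \<open>y\<close>, and
          the last leaves room for the rational margin \<open>\<eta>\<close>.\<close>
        define \<eta>' where "\<eta>' = (\<bar>discriminant q a' b' x\<bar> - 2) / 3"
        have \<eta>': "0 < \<eta>'" "2 + 2 * \<eta>' < \<bar>discriminant q a' b' x\<bar>"
          using \<open>\<not> \<bar>discriminant q a' b' x\<bar> \<le> 2\<close> by (auto simp: \<eta>'_def field_simps)
        obtain C where C: "0 \<le> C" "\<And>n u v :: real. \<bar>u\<bar> \<le> \<bar>x\<bar> + 1 \<Longrightarrow> \<bar>v\<bar> \<le> \<bar>x\<bar> + 1 \<Longrightarrow> \<bar>tr n u - tr n v\<bar> \<le> C * \<bar>u - v\<bar>"
          using tr_lipschitz[of "\<bar>x\<bar> + 1"] by blast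
        define s where "s = min 1 (\<eta>' / (C + 1))"
        have s: "0 < s" "s \<le> 1" "C * s \<le> \<eta>'"
        proof -
          have "s \<le> \<eta>' / (C + 1)" by (simp add: s_def)
          hence "(C + 1) * s \<le> \<eta>'" using C(1) by (simp add: pos_le_divide_eq mult.commute)
          moreover show "0 < s" using \<eta>'(1) C(1) by (simp add: s_def)
          ultimately show "C * s \<le> \<eta>'" by (simp add: distrib_right)
        qed (simp add: s_def)
        obtain \<alpha> where \<alpha>: "\<alpha> \<in> \<rat>" "x - s < \<alpha>" "\<alpha> < x" using Rats_dense_in_real[of "x - s" x] s by auto
        obtain \<beta> where \<beta>: "\<beta> \<in> \<rat>" "x < \<beta>" "\<beta> < x + s" using Rats_dense_in_real[of x "x + s"] s by auto
        obtain \<eta> where \<eta>: "\<eta> \<in> \<rat>" "0 < \<eta>" "\<eta> < \<eta>'" using Rats_dense_in_real[OF \<eta>'(1)] by auto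
        have "(\<lambda>j. \<bar>tr (k j) x\<bar>) \<longlonglongrightarrow> \<bar>discriminant q a' b' x\<bar>"
          by (intro tendsto_rabs tr_tendsto_discriminant[OF k(2-6)] tendsto_const)
        hence ev: "\<forall>\<^sub>F j in sequentially. 2 + 2 * \<eta>' < \<bar>tr (k j) x\<bar>" using \<eta>'(2) by (rule order_tendstoD(1))
        have "\<exists>n\<ge>N. \<forall>y\<in>{\<alpha>..\<beta>}. 2 + \<eta> \<le> \<bar>tr n y\<bar>" for N
        proof -
          have "\<forall>\<^sub>F j in sequentially. N \<le> k j" using k(1) by (simp add: filterlim_at_top)
          with ev have "\<forall>\<^sub>F j in sequentially. 2 + 2 * \<eta>' < \<bar>tr (k j) x\<bar> \<and> N \<le> k j" by eventually_elim simp
          then obtain j where j: "2 + 2 * \<eta>' < \<bar>tr (k j) x\<bar>" "N \<le> k j" by (auto simp: eventually_sequentially)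
          have "2 + \<eta> \<le> \<bar>tr (k j) y\<bar>" if y: "y \<in> {\<alpha>..\<beta>}" for y
          proof -
            have ys: "\<bar>y - x\<bar> \<le> s" using y \<alpha> \<beta> by auto
            hence "\<bar>tr (k j) y - tr (k j) x\<bar> \<le> C * \<bar>y - x\<bar>" using s(2) by (intro C(2)) auto
            also have "\<dots> \<le> C * s" using ys C(1) by (rule mult_left_mono)
            also have "\<dots> \<le> \<eta>'" by (rule s(3))
            finally show ?thesis using j(1) \<eta>(3) by linarith
          qed
          thus ?thesis using j(2) by blast
        qed
        hence "(\<alpha>, \<beta>, \<eta>) \<in> X" using \<alpha> \<beta> \<eta> unfolding X_def by blast
        from bspec[OF elim this] show False using fx \<alpha> \<beta> by auto
      qed
      thus ?thesis
        using spectrum_contains_bands[OF q_pos k(7), of M x] k(4-6) l_pos by (meson less_le_trans)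
    qed
    thus ?case by auto
  qed
qed

end

theorem theorem1p2:
  fixes a b :: "nat \<Rightarrow> real" and q :: nat and \<mu> \<mu>s :: "real measure" and f :: "real \<Rightarrow> real"
  assumes "\<And>n. 1 \<le> n \<Longrightarrow> 0 < a n"
    and "bdd_above ((\<lambda>n. inverse (a n)) ` {1..})"
    and "bdd_above (a ` {1..})"
    and "bdd_above ((\<lambda>n. \<bar>b n\<bar>) ` {1..})"
    and "1 \<le> q"
    and "(\<lambda>n. \<bar>a (n + q) - a n\<bar>\<^sup>2) summable_on {1..}"
    and "(\<lambda>n. \<bar>b (n + q) - b n\<bar>\<^sup>2) summable_on {1..}"
    and "canonical_spectral_measure a b \<mu>"
    and "lebesgue_decomposition \<mu> f \<mu>s"
  shows "(\<forall>(a', b')\<in>right_limits a b. periodic_coeffs q a' b') \<and>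
    (AE x in lborel. x \<in> (\<Inter>(a', b')\<in>right_limits a b. q_int q a' b') \<longrightarrow> x \<in> Sigma_ac f) \<and>
    (AE x in lborel. x \<in> Sigma_ac f \<longrightarrow> x \<in> (\<Inter>(a', b')\<in>right_limits a b. jacobi2_spectrum a' b')) \<and>
    (\<forall>c d. {c..d} \<subseteq> (\<Inter>(a', b')\<in>right_limits a b. q_int q a' b') \<longrightarrow>
       - \<infinity> < ext_integral {c..d} (\<lambda>x. ext_log (f x)))"
proof -
  obtain A where A: "\<And>n. 1 \<le> n \<Longrightarrow> inverse (a n) \<le> A" using assms(2) by (auto simp: bdd_above_def)
  obtain M1 where M1: "\<And>n. 1 \<le> n \<Longrightarrow> a n \<le> M1" using assms(3) by (auto simp: bdd_above_def)
  obtain M2 where M2: "\<And>n. 1 \<le> n \<Longrightarrow> \<bar>b n\<bar> \<le> M2" using assms(4) by (auto simp: bdd_above_def)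
  have A0: "0 < A" using A[of 1] assms(1)[of 1] by (smt (verit) one_le_numeral le_refl inverse_positive_iff_positive)
  have low: "inverse A \<le> a n" if "1 \<le> n" for n
    using le_imp_inverse_le[OF A[OF that]] assms(1)[OF that] by simp
  interpret square_summable_variation a b q "inverse A" "max M1 M2"
    by unfold_locales (use A0 low M1 M2 assms(5-7) in \<open>auto simp: coeff_box_def le_max_iff_disj\<close>)
  have "periodic_coeffs q a' b'" if "(a', b') \<in> right_limits a b" for a' b'
    using right_limit_props[OF that] by metis
  thus ?thesis
    using density_pos_on_core[OF assms(8,9)] ac_spectrum_subset[OF assms(8,9)] log_integral_on_core[OF assms(8,9)]
    unfolding Sigma_ac_def mem_Collect_eq by blast
qed

end
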